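(* Let $\Gamma$ be a finitely generated virtually abelian group and let $\mu$ be an aperiodic probability measure on $\Gamma$ with finite second moment such that the support of $\mu$ generates $\Gamma$ as a semigroup. Then the following are equivalent: (i) the $\mu$-random walk on $\Gamma$ is noise sensitive in total variation, i.e. for all $\rho\in(0,1]$, $\left\|\pi^\rho_n-\mu_n\times\mu_n\right\|_{\mathrm{TV}}\to 0$ as $n\to\infty$; (ii) $\Gamma$ does not admit a nonzero homomorphism onto $\mathbb{Z}$.
   Context: A group is virtually abelian if it has an abelian subgroup of finite index. For a probability measure $\mu$ on a countable group, $\mu_n:=\mu^{*n}$ is the $n$-fold convolution power. For $\rho\in[0,1]$, $\pi^\rho:=\rho(\mu\times\mu)+(1-\rho)\mu_{\mathrm{diag}}$ is the probability measure on $\Gamma\times\Gamma$, where $\mu\times\mu$ is the product measure and $\mu_{\mathrm{diag}}((\gamma,\gamma'))=\mu(\gamma)$ if $\gamma=\gamma'$ and $0$ otherwise; $\pi^\rho_n:=(\pi^\rho)^{*n}$ is the $n$-fold convolution power on the group $\Gamma\times\Gamma$. The total variation distance is $\|\nu_1-\nu_2\|_{\mathrm{TV}}=\max_A|\nu_1(A)-\nu_2(A)|=\tfrac12\|\nu_1-\nu_2\|_1$. The measure $\mu$ is aperiodic if the greatest common divisor of $\{n\ge1:\mu_n(\mathrm{id})>0\}$ is $1$. It has finite second moment if $\sum_{\gamma}|\gamma|^2\mu(\gamma)<\infty$ for a (equivalently, any) word metric $|\cdot|$ associated with a finite generating set. *)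

theory Defs
  imports
    "HOL-Probability.Probability_Mass_Function"
    "HOL-Algebra.Elementary_Groups"
begin

text \<open>Probability measures on a countable group \<open>G\<close> are represented by \<open>pmf\<close>s whose support lies
  in \<open>carrier G\<close>.\<close>

definition virtually_abelian :: "('a, 'b) monoid_scheme \<Rightarrow> bool" where
  "virtually_abelian G \<longleftrightarrow>
    (\<exists>H. subgroup H G \<and> comm_group (G\<lparr>carrier := H\<rparr>) \<and> finite (rcosets\<^bsub>G\<^esub> H))"

definition finite_generating_set :: "('a, 'b) monoid_scheme \<Rightarrow> 'a set \<Rightarrow> bool" where
  "finite_generating_set G S \<longleftrightarrow> finite S \<and> S \<subseteq> carrier G \<and> generate G S = carrier G"

definition finitely_generated :: "('a, 'b) monoid_scheme \<Rightarrow> bool" where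
  "finitely_generated G \<longleftrightarrow> (\<exists>S. finite_generating_set G S)"

definition word_product :: "('a, 'b) monoid_scheme \<Rightarrow> 'a list \<Rightarrow> 'a" where
  "word_product G ws = foldr (mult G) ws \<one>\<^bsub>G\<^esub>"

text \<open>Words are in the alphabet \<open>S \<union> S\<inverse>\<close>. If \<open>S\<close> generates \<open>G\<close>, the set of lengths below is
  nonempty for every \<open>g \<in> carrier G\<close>.\<close>

definition word_length :: "('a, 'b) monoid_scheme \<Rightarrow> 'a set \<Rightarrow> 'a \<Rightarrow> nat" where
  "word_length G S g =
    (LEAST n. \<exists>ws. set ws \<subseteq> S \<union> m_inv G ` S \<and> length ws = n \<and> word_product G ws = g)"

definition finite_second_moment :: "('a, 'b) monoid_scheme \<Rightarrow> 'a pmf \<Rightarrow> bool" where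
  "finite_second_moment G \<mu> \<longleftrightarrow>
    (\<exists>S. finite_generating_set G S \<and>
      (\<lambda>\<gamma>. (real (word_length G S \<gamma>))\<^sup>2 * pmf \<mu> \<gamma>) summable_on carrier G)"

inductive_set semigroup_generate :: "('a, 'b) monoid_scheme \<Rightarrow> 'a set \<Rightarrow> 'a set"
  for G and S where
  incl: "s \<in> S \<Longrightarrow> s \<in> semigroup_generate G S"
| mult: "x \<in> semigroup_generate G S \<Longrightarrow> y \<in> semigroup_generate G S
    \<Longrightarrow> x \<otimes>\<^bsub>G\<^esub> y \<in> semigroup_generate G S"

definition convolution_pmf :: "('a, 'b) monoid_scheme \<Rightarrow> 'a pmf \<Rightarrow> 'a pmf \<Rightarrow> 'a pmf" where
  "convolution_pmf G \<mu> \<nu> = map_pmf (\<lambda>(x, y). x \<otimes>\<^bsub>G\<^esub> y) (pair_pmf \<mu> \<nu>)"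

primrec convolution_power :: "('a, 'b) monoid_scheme \<Rightarrow> 'a pmf \<Rightarrow> nat \<Rightarrow> 'a pmf" where
  "convolution_power G \<mu> 0 = return_pmf \<one>\<^bsub>G\<^esub>"
| "convolution_power G \<mu> (Suc n) = convolution_pmf G (convolution_power G \<mu> n) \<mu>"

definition aperiodic_pmf :: "('a, 'b) monoid_scheme \<Rightarrow> 'a pmf \<Rightarrow> bool" where
  "aperiodic_pmf G \<mu> \<longleftrightarrow> Gcd {n. n \<ge> 1 \<and> pmf (convolution_power G \<mu> n) \<one>\<^bsub>G\<^esub> > 0} = 1"

definition diag_pmf :: "'a pmf \<Rightarrow> ('a \<times> 'a) pmf" where
  "diag_pmf \<mu> = map_pmf (\<lambda>\<gamma>. (\<gamma>, \<gamma>)) \<mu>"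

text \<open>For \<open>\<rho> \<in> [0,1]\<close> this is the mixture \<open>\<rho> (\<mu> \<times> \<mu>) + (1 - \<rho>) \<mu>\<^sub>d\<^sub>i\<^sub>a\<^sub>g\<close>.\<close>

definition noise_pmf :: "real \<Rightarrow> 'a pmf \<Rightarrow> ('a \<times> 'a) pmf" where
  "noise_pmf \<rho> \<mu> =
    bind_pmf (bernoulli_pmf \<rho>) (\<lambda>b. if b then pair_pmf \<mu> \<mu> else diag_pmf \<mu>)"

lemma pmf_diag_pmf: "pmf (diag_pmf \<mu>) (x, y) = (if x = y then pmf \<mu> x else 0)"
proof (cases "x = y")
  case True
  have "inj (\<lambda>\<gamma>. (\<gamma>, \<gamma>))" by (auto intro: injI)
  from pmf_map_inj'[OF this, of \<mu> x] True show ?thesis by (simp add: diag_pmf_def)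
next
  case False
  then have "(x, y) \<notin> set_pmf (diag_pmf \<mu>)" by (auto simp: diag_pmf_def)
  with False show ?thesis by (simp add: set_pmf_iff)
qed

lemma pmf_noise_pmf:
  assumes "0 \<le> \<rho>" "\<rho> \<le> 1"
  shows "pmf (noise_pmf \<rho> \<mu>) z = \<rho> * pmf (pair_pmf \<mu> \<mu>) z + (1 - \<rho>) * pmf (diag_pmf \<mu>) z"
  using assms by (simp add: noise_pmf_def pmf_bind)

definition tv_dist :: "'a pmf \<Rightarrow> 'a pmf \<Rightarrow> real" where
  "tv_dist p q = (SUP A. \<bar>measure_pmf.prob p A - measure_pmf.prob q A\<bar>)"

definition noise_sensitive_tv :: "('a, 'b) monoid_scheme \<Rightarrow> 'a pmf \<Rightarrow> bool" where
  "noise_sensitive_tv G \<mu> \<longleftrightarrow>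
    (\<forall>\<rho>\<in>{0<..1}.
      (\<lambda>n. tv_dist (convolution_power (G \<times>\<times> G) (noise_pmf \<rho> \<mu>) n)
                   (pair_pmf (convolution_power G \<mu> n) (convolution_power G \<mu> n)))
        \<longlonglongrightarrow> 0)"

end

theory Submission
  imports Defs "HOL-Probability.Probability"
begin

text \<open>Let \<open>B\<close> be a free abelian subgroup of finite index in \<open>\<Gamma>\<close>. The transfer of \<open>\<Gamma>\<close> into \<open>B\<close> is a
  homomorphism to a lattice, so if \<open>\<Gamma>\<close> has no epimorphism onto the integers it vanishes. Then every
  coordinate of \<open>B\<close> extends to a \<open>\<mu>\<close>-harmonic function on \<open>\<Gamma>\<close> whose increments average to zero over
  the cosets of \<open>B\<close>. A real combination \<open>M\<close> of such functions of the two components is a martingale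
  along the \<open>\<pi>\<^sup>\<rho>\<close>-walk, the averaging kills the cross term in its limiting variance, and so the limits
  of the characteristic functions of \<open>M / \<surd>n\<close>, restricted to any coset, do not depend on \<open>\<rho>\<close>; the case
  \<open>\<rho> = 1\<close> is \<open>\<mu>\<^sub>n \<times> \<mu>\<^sub>n\<close>. Finite Fourier inversion on a torus of side of order \<open>\<surd>n\<close> turns this into
  convergence in total variation: second moments control the mass outside a fundamental domain, and the
  Fourier coefficients have a Gaussian bound uniform in \<open>n\<close>, because left multiplication of \<open>x\<close> by a
  basis element is right multiplication by one of finitely many elements.

  Conversely let \<open>\<phi>\<close> be an epimorphism onto the integers and put \<open>f t = \<bar>E exp (i t \<phi>)\<bar>\<^sup>2\<close>. If
  \<open>f t\<^sub>n = 1 - 1/n\<close>, then the character \<open>exp (i t\<^sub>n (\<phi> x - \<phi> y))\<close> has expectation \<open>(1 - \<rho>/n)\<^sup>n\<close> under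
  \<open>\<pi>\<^sup>\<rho>\<^sub>n\<close>, and the limit \<open>exp (-\<rho>)\<close> depends on \<open>\<rho>\<close>.\<close>

subsection \<open>Convolution of probability mass functions\<close>

text \<open>The obstacle is that a step \<open>g\<close>, multiplied on the right, changes the
  coordinates by an amount that depends on the current coset, so the coordinates are not sums of
  independent terms. Adding a bounded function of the coset, a solution of a Poisson equation, turns
  them into martingales. That equation is solvable only for data of mean zero over the cosets, and
  the drift has mean zero because the transfer vanishes. The same vanishing holds for each fixed
  step, not just in the mean over steps, and it is this stronger form that removes the cross term.
  No limit law is identified. The two walks are compared frequency by frequency: for a fixed
  frequency both characteristic functions are close to the same power of
  \<open>1 - t\<^sup>2 * Q / 2\<close>, with equal \<open>Q\<close>. Two limits have to be taken in
  the right order. A box of side \<open>R \<surd>n\<close> leaves outside a mass of order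
  \<open>1/R\<^sup>2\<close>, uniformly in \<open>n\<close>, so \<open>R\<close> is fixed first.
  Then \<open>n\<close> grows, the box of frequencies grows with it, and the uniform Gaussian bound
  serves as a dominating function.\<close>

abbreviation expect :: "'a pmf \<Rightarrow> ('a \<Rightarrow> 'b::{banach, second_countable_topology}) \<Rightarrow> 'b" ("\<E>")
  where "\<E> p f \<equiv> measure_pmf.expectation p f"

lemma integrable_pmf_bounded:
  fixes f :: "'a \<Rightarrow> 'b::{banach, second_countable_topology}"
  assumes "\<And>x. x \<in> set_pmf p \<Longrightarrow> norm (f x) \<le> B"
  shows "integrable (measure_pmf p) f"
  by (rule measure_pmf.integrable_const_bound[where B = B]) (auto simp: AE_measure_pmf_iff assms)

lemma expectation_bind_pmf_real:
  fixes f :: "'b \<Rightarrow> real"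
  assumes "\<And>y. \<bar>f y\<bar> \<le> B"
  shows "\<E> (bind_pmf p q) f =
    \<E> p (\<lambda>x. \<E> (q x) f)"
  unfolding measure_pmf_bind
  by (rule integral_bind[where K = "count_space UNIV" and B' = 1 and B = B])
     (auto simp: assms measure_pmf.finite_measure_axioms measure_pmf.emeasure_space_1
        measure_pmf_in_subprob_algebra intro!: measurable_measure_pmf)

lemma integral_complex_of_parts:
  assumes "integrable M f"
  shows "integral\<^sup>L M f = Complex (integral\<^sup>L M (\<lambda>x. Re (f x))) (integral\<^sup>L M (\<lambda>x. Im (f x)))"
  using assms by (simp add: complex_eq_iff)

lemma norm_expectation_le:
  fixes f :: "'a \<Rightarrow> complex"
  assumes "\<And>x. x \<in> set_pmf p \<Longrightarrow> norm (f x) \<le> B"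
  shows "norm (\<E> p f) \<le> B"
proof -
  have "integrable (measure_pmf p) f" by (rule integrable_pmf_bounded[OF assms])
  then show ?thesis
    by (intro order.trans[OF integral_norm_bound] measure_pmf.integral_le_const)
       (auto simp: AE_measure_pmf_iff assms)
qed

lemma expectation_bind_pmf_complex:
  fixes f :: "'b \<Rightarrow> complex"
  assumes B: "\<And>y. norm (f y) \<le> B"
  shows "\<E> (bind_pmf p q) f =
    \<E> p (\<lambda>x. \<E> (q x) f)"
proof -
  have i: "integrable (measure_pmf r) f" for r by (rule integrable_pmf_bounded[OF B])
  have re: "\<bar>Re (f y)\<bar> \<le> B" and im: "\<bar>Im (f y)\<bar> \<le> B" for y
    using B[of y] abs_Re_le_cmod[of "f y"] abs_Im_le_cmod[of "f y"] by auto
  have "norm (\<E> (q x) f) \<le> B" for x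
    by (rule norm_expectation_le[OF B])
  then have j: "integrable (measure_pmf p) (\<lambda>x. \<E> (q x) f)"
    by (rule integrable_pmf_bounded)
  show ?thesis
    by (subst integral_complex_of_parts[OF i], subst integral_complex_of_parts[OF j])
       (simp add: i expectation_bind_pmf_real[OF re] expectation_bind_pmf_real[OF im])
qed

text \<open>Most functions of interest are bounded on the carrier only, so the bound is asked on the
  support alone. Setting \<open>f\<close> to zero elsewhere reduces this to a global bound.\<close>

lemma expectation_bind_pmf:
  fixes f :: "'b \<Rightarrow> complex"
  assumes B: "\<And>x y. x \<in> set_pmf p \<Longrightarrow> y \<in> set_pmf (q x) \<Longrightarrow> norm (f y) \<le> B"
  shows "\<E> (bind_pmf p q) f =
    \<E> p (\<lambda>x. \<E> (q x) f)"
proof -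
  define g where "g = (\<lambda>y. if y \<in> set_pmf (bind_pmf p q) then f y else 0)"
  have "norm (g y) \<le> max 0 B" for y using B by (auto simp: g_def le_max_iff_disj)
  note g = expectation_bind_pmf_complex[of g, OF this, of p q]
  have "\<E> (bind_pmf p q) f = \<E> (bind_pmf p q) g"
    by (rule integral_cong_AE) (auto simp: AE_measure_pmf_iff g_def)
  moreover have "\<E> (q x) f = \<E> (q x) g"
    if "x \<in> set_pmf p" for x
    using that by (intro integral_cong_AE) (auto simp: AE_measure_pmf_iff g_def)
  then have "\<E> p (\<lambda>x. \<E> (q x) f) =
      \<E> p (\<lambda>x. \<E> (q x) g)"
    by (intro integral_cong_AE) (auto simp: AE_measure_pmf_iff)
  ultimately show ?thesis using g by simp
qed

text \<open>A Doeblin splitting. The multiple \<open>a\<close> of counting measure on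
  \<open>W\<close> is kept together so that cancellation in the sum over \<open>W\<close> survives;
  the remaining mass \<open>1 - a * card W\<close> is estimated by \<open>B\<close>. It is used with
  a sum that vanishes (mixing of cosets), with two values of known ratio (characters), and with two
  opposite values (the converse).\<close>

lemma norm_expectation_minorized_le:
  fixes f :: "'a \<Rightarrow> complex"
  assumes "0 \<le> a" and W: "finite W" "\<And>h. h \<in> W \<Longrightarrow> a \<le> pmf p h" "\<And>h. h \<in> W \<Longrightarrow> norm (f h) \<le> B"
    and B: "\<And>h. h \<in> set_pmf p \<Longrightarrow> norm (f h) \<le> B"
  shows "norm (\<E> p f) \<le> a * norm (\<Sum>h\<in>W. f h) + (1 - a * card W) * B"
proof -
  have i: "integrable (measure_pmf p) f" by (rule integrable_pmf_bounded[OF B])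
  have iW: "integrable (measure_pmf p) (\<lambda>x. indicat_real W x *\<^sub>R f x)"
    using B by (intro integrable_pmf_bounded[where B = B]) (auto simp: indicator_def intro: order.trans[OF norm_ge_zero])
  have iC: "integrable (measure_pmf p) (\<lambda>x. indicat_real (-W) x *\<^sub>R f x)"
    using B by (intro integrable_pmf_bounded[where B = B]) (auto simp: indicator_def intro: order.trans[OF norm_ge_zero])
  have "\<E> p f = \<E> p (\<lambda>x. indicat_real W x *\<^sub>R f x + indicat_real (-W) x *\<^sub>R f x)"
    by (intro Bochner_Integration.integral_cong) (auto simp: indicator_def)
  also have "\<dots> = \<E> p (\<lambda>x. indicat_real W x *\<^sub>R f x)
      + \<E> p (\<lambda>x. indicat_real (-W) x *\<^sub>R f x)"
    by (rule Bochner_Integration.integral_add[OF iW iC])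
  also have "\<E> p (\<lambda>x. indicat_real W x *\<^sub>R f x) = (\<Sum>h\<in>W. pmf p h *\<^sub>R f h)"
    by (subst integral_measure_pmf[of W]) (auto simp: W indicator_def split: if_splits)
  also have "\<dots> = a *\<^sub>R (\<Sum>h\<in>W. f h) + (\<Sum>h\<in>W. (pmf p h - a) *\<^sub>R f h)"
    by (simp add: scaleR_sum_right sum.distrib[symmetric] algebra_simps)
  finally have eq: "\<E> p f = a *\<^sub>R (\<Sum>h\<in>W. f h) + (\<Sum>h\<in>W. (pmf p h - a) *\<^sub>R f h)
      + \<E> p (\<lambda>x. indicat_real (-W) x *\<^sub>R f x)" .
  have 1: "norm (\<Sum>h\<in>W. (pmf p h - a) *\<^sub>R f h) \<le> (\<Sum>h\<in>W. (pmf p h - a) * B)"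
    using W by (intro sum_norm_le) (auto intro!: mult_left_mono)
  have "norm (\<E> p (\<lambda>x. indicat_real (-W) x *\<^sub>R f x)) \<le>
      \<E> p (\<lambda>x. norm (indicat_real (-W) x *\<^sub>R f x))"
    by (rule integral_norm_bound)
  also have "\<dots> \<le> \<E> p (\<lambda>x. indicat_real (-W) x * B)"
  proof (intro integral_mono_AE integrable_norm iC)
    show "integrable (measure_pmf p) (\<lambda>x. indicat_real (-W) x * B)"
      by (intro integrable_pmf_bounded[where B = "\<bar>B\<bar>"]) (auto simp: indicator_def)
  qed (use B in \<open>auto simp: AE_measure_pmf_iff indicator_def\<close>)
  also have "\<dots> = (1 - (\<Sum>h\<in>W. pmf p h)) * B"
    using W(1) measure_pmf.prob_compl[of W p] by (simp add: measure_measure_pmf_finite Compl_eq_Diff_UNIV)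
  finally have 2: "norm (\<E> p (\<lambda>x. indicat_real (-W) x *\<^sub>R f x)) \<le> (1 - (\<Sum>h\<in>W. pmf p h)) * B" .
  have "norm (\<E> p f) \<le> norm (a *\<^sub>R (\<Sum>h\<in>W. f h)) + norm (\<Sum>h\<in>W. (pmf p h - a) *\<^sub>R f h)
      + norm (\<E> p (\<lambda>x. indicat_real (-W) x *\<^sub>R f x))"
    unfolding eq by (intro norm_triangle_le add_mono norm_triangle_ineq) auto
  also have "\<dots> \<le> a * norm (\<Sum>h\<in>W. f h) + (\<Sum>h\<in>W. (pmf p h - a) * B) + (1 - (\<Sum>h\<in>W. pmf p h)) * B"
    using 1 2 assms(1) by simp
  also have "\<dots> = a * norm (\<Sum>h\<in>W. f h) + (1 - a * card W) * B"
    by (simp add: sum_subtractf flip: sum_distrib_right) (simp add: algebra_simps)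
  finally show ?thesis .
qed

lemma convolution_pmf_bind:
  "convolution_pmf G p q = bind_pmf p (\<lambda>x. map_pmf (\<lambda>y. x \<otimes>\<^bsub>G\<^esub> y) q)"
  by (simp add: convolution_pmf_def pair_pmf_def map_pmf_def bind_assoc_pmf bind_return_pmf)

lemma set_convolution_pmf:
  "set_pmf (convolution_pmf G p q) = (\<lambda>(x, y). x \<otimes>\<^bsub>G\<^esub> y) ` (set_pmf p \<times> set_pmf q)"
  by (simp add: convolution_pmf_def)

lemma expectation_convolution_pmf:
  fixes f :: "'a \<Rightarrow> complex"
  assumes B: "\<And>x y. x \<in> set_pmf p \<Longrightarrow> y \<in> set_pmf q \<Longrightarrow> norm (f (x \<otimes>\<^bsub>G\<^esub> y)) \<le> B"
  shows "\<E> (convolution_pmf G p q) f =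
    \<E> p (\<lambda>x. \<E> q (\<lambda>y. f (x \<otimes>\<^bsub>G\<^esub> y)))"
  unfolding convolution_pmf_bind using B by (subst expectation_bind_pmf[where B = B]) auto

lemma nn_integral_convolution_pmf:
  "(\<integral>\<^sup>+x. f x \<partial>convolution_pmf G p q) = (\<integral>\<^sup>+x. \<integral>\<^sup>+y. f (x \<otimes>\<^bsub>G\<^esub> y) \<partial>q \<partial>p)"
  unfolding convolution_pmf_bind by simp

context group
begin

lemma convolution_power_carrier:
  assumes "set_pmf \<nu> \<subseteq> carrier G"
  shows "set_pmf (convolution_power G \<nu> n) \<subseteq> carrier G"
  using assms by (induction n) (auto simp: set_convolution_pmf)

lemma convolution_pmf_assoc:
  assumes "set_pmf p \<subseteq> carrier G" "set_pmf q \<subseteq> carrier G" "set_pmf r \<subseteq> carrier G"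
  shows "convolution_pmf G (convolution_pmf G p q) r = convolution_pmf G p (convolution_pmf G q r)"
  unfolding convolution_pmf_bind map_pmf_def bind_assoc_pmf bind_return_pmf
  using assms by (intro bind_pmf_cong refl) (auto simp: m_assoc subset_iff)

lemma convolution_pmf_one:
  assumes "set_pmf p \<subseteq> carrier G"
  shows "convolution_pmf G p (return_pmf \<one>) = p" "convolution_pmf G (return_pmf \<one>) p = p"
proof -
  have "bind_pmf p (\<lambda>x. return_pmf (x \<otimes> \<one>)) = bind_pmf p return_pmf"
    using assms by (intro bind_pmf_cong) auto
  then show "convolution_pmf G p (return_pmf \<one>) = p"
    by (simp add: convolution_pmf_bind bind_return_pmf')
  have "map_pmf (\<lambda>y. \<one> \<otimes> y) p = map_pmf (\<lambda>y. y) p"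
    using assms by (intro map_pmf_cong) auto
  then show "convolution_pmf G (return_pmf \<one>) p = p"
    by (simp add: convolution_pmf_bind bind_return_pmf)
qed

lemma convolution_power_add:
  assumes "set_pmf \<nu> \<subseteq> carrier G"
  shows "convolution_power G \<nu> (m + n) =
    convolution_pmf G (convolution_power G \<nu> m) (convolution_power G \<nu> n)"
  using assms
  by (induction n) (auto simp: convolution_pmf_one convolution_power_carrier convolution_pmf_assoc)

end

text \<open>The least positive difference \<open>d\<close> of two elements divides every element,
  since otherwise a remainder would be a smaller difference. So \<open>d = 1\<close>, and two
  consecutive elements \<open>b\<close>, \<open>b + 1\<close> produce every number from
  \<open>b * b\<close> on.\<close>

lemma add_closed_Gcd_1_eventually:
  fixes N :: "nat set"
  assumes add: "\<And>a b. a \<in> N \<Longrightarrow> b \<in> N \<Longrightarrow> a + b \<in> N" and gcd: "Gcd N = 1"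
  shows "\<exists>K. \<forall>k\<ge>K. k \<in> N"
proof -
  have mult: "Suc m * x \<in> N" if "x \<in> N" for m x
    by (induction m) (use that add in auto)
  have "\<not> N \<subseteq> {0}" using gcd by (auto simp flip: Gcd_0_iff)
  then obtain a0 where a0: "a0 \<in> N" "a0 > 0" by auto
  define D where "D = (\<lambda>d. d > 0 \<and> (\<exists>a\<in>N. a + d \<in> N))"
  define d where "d = (LEAST d. D d)"
  have "D a0" using a0 add by (auto simp: D_def)
  then have "D d" and least: "\<And>e. D e \<Longrightarrow> d \<le> e" unfolding d_def by (auto intro: LeastI Least_le)
  then obtain a where a: "a \<in> N" "a + d \<in> N" "d > 0" by (auto simp: D_def)
  have "d dvd x" if x: "x \<in> N" for x
  proof (rule ccontr)
    assume "\<not> d dvd x"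
    then have r: "x mod d > 0" by (simp add: mod_greater_zero_iff_not_dvd)
    have rd: "x mod d < d" using a by simp
    show False
    proof (cases "x div d")
      case 0
      then have "x < d" using a by (simp add: div_eq_0_iff)
      moreover have "D x" using x r add \<open>x < d\<close> by (auto simp: D_def)
      ultimately show False using least[of x] by simp
    next
      case (Suc q)
      \<comment> \<open>The left side without the remainder is in \<open>N\<close>, and so is the
        right side; hence the remainder is itself a difference of elements. The quotient 0 was
        treated apart because \<open>N\<close> need not contain 0.\<close>
      have "Suc q * (a + d) + x mod d = x + Suc q * a"
        using div_mult_mod_eq[of x d] unfolding Suc by (simp add: algebra_simps)
      then have "D (x mod d)" unfolding D_def using r mult[OF a(2), of q] mult[OF a(1), of q] add x by metis
      then show False using least rd by fastforce
    qed
  qed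
  then have "d dvd Gcd N" by (auto intro: Gcd_greatest)
  then have d1: "d = 1" using gcd by simp
  \<comment> \<open>\<open>a\<close> may be 0, whereas \<open>b = 2 * a + 1\<close> is positive and
    \<open>b + 1 = 2 * (a + 1)\<close> is again in \<open>N\<close>.\<close>
  define b where "b = a + (a + 1)"
  have b: "b \<in> N" "b + 1 \<in> N" "b > 0"
    using a add[of a "a+1"] add[of "a+1" "a+1"] by (auto simp: b_def d1 algebra_simps)
  have "k \<in> N" if "k \<ge> b * b" for k
  proof -
    define q r where "q = k div b" and "r = k mod b"
    have r: "r < b" using b by (simp add: r_def)
    have q: "b \<le> q" using div_le_mono[OF that, of b] b by (simp add: q_def)
    have "k = (q - r) * b + r * (b + 1)"
    proof -
      have "k = q * b + r" by (simp add: q_def r_def)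
      also have "q * b = (q - r) * b + r * b" using q r by (simp flip: add_mult_distrib)
      finally show ?thesis by simp
    qed
    moreover obtain m where "q - r = Suc m" using q r by (metis Suc_diff_Suc less_le_trans)
    then have "(q - r) * b \<in> N" using mult[OF b(1), of m] by simp
    moreover have "r = 0 \<or> r * (b + 1) \<in> N" using mult[OF b(2), of "r - 1"] by (cases r) auto
    ultimately show ?thesis using add by auto
  qed
  then show ?thesis by blast
qed

text \<open>Generation as a semigroup gives one time at which \<open>g\<close> is reached; returns
  to the identity are possible at all large times and can be appended.\<close>

lemma (in group) aperiodic_generating_eventually_pos:
  assumes car: "set_pmf \<mu> \<subseteq> carrier G" and ap: "aperiodic_pmf G \<mu>"
    and gen: "semigroup_generate G (set_pmf \<mu>) = carrier G" and g: "g \<in> carrier G"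
  shows "\<exists>K. \<forall>k\<ge>K. g \<in> set_pmf (convolution_power G \<mu> k)"
proof -
  let ?P = "convolution_power G \<mu>"
  have mem: "x \<otimes> y \<in> set_pmf (?P (m + n))" if "x \<in> set_pmf (?P m)" "y \<in> set_pmf (?P n)" for x y m n
    using that by (auto simp: convolution_power_add[OF car] set_convolution_pmf)
  define N where "N = {n. n \<ge> 1 \<and> pmf (?P n) \<one> > 0}"
  have "\<exists>K. \<forall>k\<ge>K. k \<in> N"
  proof (rule add_closed_Gcd_1_eventually)
    show "Gcd N = 1" using ap by (simp add: N_def aperiodic_pmf_def)
    show "a + b \<in> N" if "a \<in> N" "b \<in> N" for a b
      using mem[of \<one> a \<one> b] that by (auto simp: N_def pmf_positive_iff)
  qed
  then obtain K where K: "\<And>k. k \<ge> K \<Longrightarrow> \<one> \<in> set_pmf (?P k)"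
    by (auto simp: N_def pmf_positive_iff)
  have "g \<in> semigroup_generate G (set_pmf \<mu>)" using g gen by simp
  then have "\<exists>n. g \<in> set_pmf (?P n)"
  proof induction
    case (incl s)
    then have "s \<in> set_pmf (?P 1)" using car by (force simp: set_convolution_pmf image_iff subset_iff)
    then show ?case by blast
  next
    case (mult x y)
    then show ?case using mem by blast
  qed
  then obtain n where n: "g \<in> set_pmf (?P n)" by blast
  have "g \<in> set_pmf (?P k)" if "k \<ge> K + n" for k
    using mem[OF n K[of "k - n"]] that g by simp
  then show ?thesis by blast
qed

subsection \<open>Free abelian subgroups of finite index\<close>

text \<open>A presentation of a group with a free abelian subgroup of finite index: the \<open>c i\<close> are a basis of
  the subgroup, \<open>rep x\<close> is a representative of its coset through \<open>x\<close>, and the \<open>P i x\<close> are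
  coordinates of \<open>x\<close> within that coset. That the \<open>c i\<close> commute follows from \<open>coord_inj\<close>.\<close>

locale lattice_group = group G for G (structure) +
  fixes I :: "'i set" and c :: "'i \<Rightarrow> 'a" and P :: "'i \<Rightarrow> 'a \<Rightarrow> int" and rep :: "'a \<Rightarrow> 'a"
  assumes finite_I: "finite I"
    and c_closed: "i \<in> I \<Longrightarrow> c i \<in> carrier G"
    and rep_closed: "x \<in> carrier G \<Longrightarrow> rep x \<in> carrier G"
    and rep_rep: "x \<in> carrier G \<Longrightarrow> rep (rep x) = rep x"
    and finite_rep: "finite (rep ` carrier G)"
    and rep_c: "i \<in> I \<Longrightarrow> x \<in> carrier G \<Longrightarrow> rep (c i \<otimes> x) = rep x"
    and P_c: "i \<in> I \<Longrightarrow> j \<in> I \<Longrightarrow> x \<in> carrier G \<Longrightarrow> P i (c j \<otimes> x) = P i x + (if i = j then 1 else 0)"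
    and coord_inj: "x \<in> carrier G \<Longrightarrow> y \<in> carrier G \<Longrightarrow> rep x = rep y \<Longrightarrow> (\<And>i. i \<in> I \<Longrightarrow> P i x = P i y) \<Longrightarrow> x = y"

context group
begin

text \<open>The choice is made from the coset as a set and thus depends on the coset only. In
  particular the representative of \<open>H\<close> need not be the identity.\<close>

lemma coset_representative:
  assumes H: "subgroup H G" and x: "x \<in> carrier G"
  defines "y \<equiv> (SOME y. y \<in> H #> x)"
  shows "y \<in> H #> x" "y \<in> carrier G" "x \<otimes> inv y \<in> H"
proof -
  interpret H: subgroup H G by (rule H)
  show y: "y \<in> H #> x" unfolding y_def by (rule someI[of _ x]) (rule rcos_self[OF x H])
  show "y \<in> carrier G" using y r_coset_subset_G[OF H.subset x] by auto
  obtain h where h: "h \<in> H" "y = h \<otimes> x" using y by (auto simp: r_coset_def)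
  then have "x \<otimes> inv y = x \<otimes> (inv x \<otimes> inv h)" using x by (simp add: inv_mult_group)
  also have "\<dots> = inv h" using x h by (simp add: m_assoc[symmetric])
  finally show "x \<otimes> inv y \<in> H" using h by simp
qed

text \<open>Schreier's argument.\<close>

lemma finite_index_finitely_generated:
  assumes H: "subgroup H G" and fin: "finite (rcosets H)" and S: "finite S" "S \<subseteq> carrier G"
    and gen: "generate G S = carrier G"
  shows "\<exists>S' T. finite S' \<and> S' \<subseteq> H \<and> finite T \<and> T \<subseteq> carrier G \<and>
    (\<forall>x\<in>carrier G. \<exists>h\<in>generate G S'. \<exists>t\<in>T. x = h \<otimes> t)"
proof -
  interpret H: subgroup H G by (rule H)
  define \<sigma> where "\<sigma> = (\<lambda>x. SOME y. y \<in> H #> x)"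
  have \<sigma>c: "\<sigma> x \<in> carrier G" and \<sigma>h: "x \<otimes> inv (\<sigma> x) \<in> H" if "x \<in> carrier G" for x
    using coset_representative[OF H that] by (simp_all add: \<sigma>_def)
  define T where "T = \<sigma> ` carrier G"
  have T: "T \<subseteq> carrier G" using \<sigma>c by (auto simp: T_def)
  have "T \<subseteq> (\<lambda>C. SOME y. y \<in> C) ` (rcosets H)" by (auto simp: T_def \<sigma>_def RCOSETS_def)
  then have finT: "finite T" using fin finite_surj by blast
  define U where "U = S \<union> m_inv G ` S"
  have U: "finite U" "U \<subseteq> carrier G" using S by (auto simp: U_def)
  \<comment> \<open>the Schreier generators, and one element that brings \<open>\<one>\<close> into \<open>Y\<close>\<close>
  define S' where "S' = insert (inv (\<sigma> \<one>)) ((\<lambda>(t, s). t \<otimes> s \<otimes> inv (\<sigma> (t \<otimes> s))) ` (T \<times> U))"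
  have S': "finite S'" "S' \<subseteq> H"
    using finT U T \<sigma>h \<sigma>h[of \<one>] \<sigma>c[of \<one>] by (auto simp: S'_def subset_iff)
  have S'c: "S' \<subseteq> carrier G" using S' H.subset by auto
  define Y where "Y = {h \<otimes> t |h t. h \<in> generate G S' \<and> t \<in> T}"
  have gc: "h \<in> generate G S' \<Longrightarrow> h \<in> carrier G" for h using generate_incl[OF S'c] by auto
  have one: "\<one> \<in> Y" unfolding Y_def
    by (rule CollectI, rule exI[of _ "inv (\<sigma> \<one>)"], rule exI[of _ "\<sigma> \<one>"])
      (auto simp: S'_def T_def \<sigma>c intro!: generate.incl)
  have step: "y \<otimes> s \<in> Y" if "y \<in> Y" "s \<in> U" for y s
  proof -
    obtain h t where y: "y = h \<otimes> t" "h \<in> generate G S'" "t \<in> T" using \<open>y \<in> Y\<close> by (auto simp: Y_def)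
    have c: "h \<in> carrier G" "t \<in> carrier G" "s \<in> carrier G" "\<sigma> (t \<otimes> s) \<in> carrier G"
      using y gc T U that \<sigma>c by (auto simp: subset_iff)
    have "t \<otimes> s \<otimes> inv (\<sigma> (t \<otimes> s)) \<in> generate G S'"
      using y that by (intro generate.incl) (auto simp: S'_def)
    then have "h \<otimes> (t \<otimes> s \<otimes> inv (\<sigma> (t \<otimes> s))) \<in> generate G S'" by (rule generate.eng[OF y(2)])
    moreover have "y \<otimes> s = (h \<otimes> (t \<otimes> s \<otimes> inv (\<sigma> (t \<otimes> s)))) \<otimes> \<sigma> (t \<otimes> s)"
      using c y by (simp add: m_assoc)
    ultimately show ?thesis unfolding Y_def using c by (auto simp: T_def)
  qed
  have Yc: "Y \<subseteq> carrier G" using gc T by (auto simp: Y_def)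
  have "y \<otimes> x \<in> Y" if "x \<in> generate G S" "y \<in> Y" for x y
    using that
  proof (induction x arbitrary: y)
    case one
    then show ?case using Yc by (auto simp: subset_iff)
  next
    case (incl h)
    then show ?case using step by (auto simp: U_def)
  next
    case (inv h)
    then show ?case using step by (auto simp: U_def)
  next
    case (eng h1 h2)
    have "h1 \<in> carrier G" "h2 \<in> carrier G" using eng generate_incl[OF S(2)] by auto
    then have "y \<otimes> (h1 \<otimes> h2) = (y \<otimes> h1) \<otimes> h2" using eng Yc by (auto simp: m_assoc subset_iff)
    then show ?case using eng by simp
  qed
  from this[OF _ one] have "x \<in> Y" if "x \<in> carrier G" for x using that gen by fastforce
  then have "\<forall>x\<in>carrier G. \<exists>h\<in>generate G S'. \<exists>t\<in>T. x = h \<otimes> t" unfolding Y_def by blast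
  then show ?thesis using S' finT T by blast
qed

lemma generate_insert_comm:
  assumes H: "subgroup H G" and comm: "\<And>x y. x \<in> H \<Longrightarrow> y \<in> H \<Longrightarrow> x \<otimes> y = y \<otimes> x"
    and F: "F \<subseteq> H" "s \<in> H" and z: "z \<in> generate G (insert s F)"
  shows "\<exists>x\<in>generate G F. \<exists>l::int. z = x \<otimes> s [^] l"
proof -
  interpret H: subgroup H G by (rule H)
  have gH: "x \<in> generate G F \<Longrightarrow> x \<in> H" for x using generate_subgroup_incl[OF F(1) H] by auto
  have sl: "s [^] (l::int) \<in> H" for l using F(2) subgroup_int_pow_closed[OF H] by blast
  have sc: "s \<in> carrier G" using F by auto
  show ?thesis using z
  proof induction
    case one
    show ?case by (rule bexI[OF _ generate.one], rule exI[of _ 0]) simp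
  next
    case (incl h)
    then show ?case
    proof
      assume "h = s" then show ?thesis using sc
        by (intro bexI[OF _ generate.one] exI[of _ 1]) (simp add: int_pow_1)
    next
      assume "h \<in> F" then show ?thesis using F
        by (intro bexI[OF _ generate.incl] exI[of _ 0]) (auto simp: subset_iff)
    qed
  next
    case (inv h)
    then show ?case
    proof
      assume "h = s" then show ?thesis using sc
        by (intro bexI[OF _ generate.one] exI[of _ "-1"]) (simp add: int_pow_neg int_pow_1)
    next
      assume "h \<in> F" then show ?thesis using F
        by (intro bexI[OF _ generate.inv] exI[of _ 0]) (auto simp: subset_iff)
    qed
  next
    case (eng h1 h2)
    then obtain x1 l1 x2 l2 where x: "x1 \<in> generate G F" "x2 \<in> generate G F"
      and h: "h1 = x1 \<otimes> s [^] (l1::int)" "h2 = x2 \<otimes> s [^] (l2::int)" by blast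
    note c = gH[OF x(1)] gH[OF x(2)] sl[of l1] sl[of l2]
    note cc = c[THEN H.mem_carrier]
    have "h1 \<otimes> h2 = x1 \<otimes> ((s [^] l1 \<otimes> x2) \<otimes> s [^] l2)" using cc by (simp add: h m_assoc)
    also have "s [^] l1 \<otimes> x2 = x2 \<otimes> s [^] l1" using c comm by blast
    also have "x1 \<otimes> ((x2 \<otimes> s [^] l1) \<otimes> s [^] l2) = (x1 \<otimes> x2) \<otimes> s [^] (l1 + l2)"
      using cc sc by (simp add: m_assoc int_pow_mult)
    finally show ?case using generate.eng[OF x] by blast
  qed
qed

text \<open>Induction on the generators. If a positive power of the new generator \<open>s\<close>
  lies in \<open>B\<close>, then \<open>B\<close> is kept and the finitely many residual powers of
  \<open>s\<close> go into \<open>T\<close>. Otherwise \<open>B\<close> and \<open>s\<close>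
  generate a direct product with an infinite cyclic group, and the exponent of \<open>s\<close>
  becomes a new coordinate. All torsion ends up in \<open>T\<close>.\<close>

lemma finite_index_free_abelian:
  assumes H: "subgroup H G" and comm: "\<And>x y. x \<in> H \<Longrightarrow> y \<in> H \<Longrightarrow> x \<otimes> y = y \<otimes> x"
    and F: "finite F" "F \<subseteq> H"
  shows "\<exists>(n::nat) b (p :: nat \<Rightarrow> 'a \<Rightarrow> int) B T. subgroup B G \<and> B \<subseteq> H \<and> (\<forall>j<n. b j \<in> B) \<and>
     (\<forall>i<n. \<forall>j<n. \<forall>x\<in>B. p i (b j \<otimes> x) = p i x + (if i = j then 1 else 0)) \<and>
     (\<forall>x\<in>B. \<forall>y\<in>B. (\<forall>i<n. p i x = p i y) \<longrightarrow> x = y) \<and>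
     finite T \<and> T \<subseteq> H \<and> (\<forall>x\<in>generate G F. \<exists>y\<in>B. \<exists>t\<in>T. x = y \<otimes> t)"
  using F
proof (induction F)
  case empty
  show ?case
    by (rule exI[of _ 0], rule exI, rule exI, rule exI[of _ "{\<one>}"], rule exI[of _ "{\<one>}"])
      (auto simp: subgroup.one_closed[OF H] triv_subgroup generate_empty)
next
  case (insert s F)
  interpret H: subgroup H G by (rule H)
  have sH: "s \<in> H" and FH: "F \<subseteq> H" using insert.prems by auto
  from insert.IH[OF FH] obtain n :: nat and b and p :: "nat \<Rightarrow> 'a \<Rightarrow> int" and B T where B: "subgroup B G" "B \<subseteq> H"
    and b': "\<forall>j<n. b j \<in> B"
    and p': "\<forall>i<n. \<forall>j<n. \<forall>x\<in>B. p i (b j \<otimes> x) = p i x + (if i = j then 1 else 0)"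
    and inj': "\<forall>x\<in>B. \<forall>y\<in>B. (\<forall>i<n. p i x = p i y) \<longrightarrow> x = y"
    and T: "finite T" "T \<subseteq> H" and cov0: "\<forall>x\<in>generate G F. \<exists>y\<in>B. \<exists>t\<in>T. x = y \<otimes> t"
     by blast
  note b = b'[rule_format] and p = p'[rule_format] and inj = inj'[rule_format] and cov = cov0[rule_format]
  interpret B: subgroup B G by (rule B)
  have sc: "s \<in> carrier G" using sH by auto
  have sl: "s [^] (l::int) \<in> H" for l using sH subgroup_int_pow_closed[OF H] by blast
  note gi = generate_insert_comm[OF H comm FH sH]
  show ?case
  proof (cases "\<exists>m>0. s [^] (int m) \<in> B")
    case True
    then obtain m where m: "m > 0" "s [^] (int m) \<in> B" by blast
    define T' where "T' = (\<lambda>(t, r). t \<otimes> s [^] (int r)) ` (T \<times> {..<m})"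
    have T': "finite T'" "T' \<subseteq> H" using T sl by (auto simp: T'_def subset_iff)
    have "\<exists>y\<in>B. \<exists>t\<in>T'. z = y \<otimes> t" if z: "z \<in> generate G (insert s F)" for z
    proof -
      obtain x l where x: "x \<in> generate G F" "z = x \<otimes> s [^] (l::int)" using gi[OF _ _ z] by blast
      obtain y t where y: "y \<in> B" "t \<in> T" "x = y \<otimes> t" using cov[OF x(1)] by blast
      define q r where "q = l div int m" and "r = nat (l mod int m)"
      have r: "r < m" "int r = l mod int m" using m by (auto simp: r_def nat_less_iff)
      have u: "(s [^] (int m)) [^] q \<in> B" using m subgroup_int_pow_closed[OF B(1)] by blast
      have "l = int m * q + int r" by (simp add: q_def r(2))
      then have sl': "s [^] l = (s [^] (int m)) [^] q \<otimes> s [^] (int r)"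
        using sc by (simp add: int_pow_mult int_pow_pow)
      note h = u[THEN subsetD[OF B(2)]] y(1)[THEN subsetD[OF B(2)]] y(2)[THEN subsetD[OF T(2)]] sl[of "int r"]
      note hc = h[THEN H.mem_carrier]
      have "z = y \<otimes> ((t \<otimes> (s [^] (int m)) [^] q) \<otimes> s [^] (int r))"
        using hc by (simp add: x y sl' m_assoc)
      also have "t \<otimes> (s [^] (int m)) [^] q = (s [^] (int m)) [^] q \<otimes> t" using h comm by blast
      also have "y \<otimes> (((s [^] (int m)) [^] q \<otimes> t) \<otimes> s [^] (int r)) =
          (y \<otimes> (s [^] (int m)) [^] q) \<otimes> (t \<otimes> s [^] (int r))" using hc by (simp add: m_assoc)
      finally have "z = (y \<otimes> (s [^] (int m)) [^] q) \<otimes> (t \<otimes> s [^] (int r))" .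
      moreover have "t \<otimes> s [^] (int r) \<in> T'" using y(2) r(1) by (force simp: T'_def)
      ultimately show ?thesis using y(1) u B.m_closed by blast
    qed
    then show ?thesis using B b' p' inj' T' by blast
  next
    case False
    have noB: "l = 0" if "s [^] (l::int) \<in> B" for l
    proof (rule ccontr)
      assume "l \<noteq> 0"
      have "s [^] (-l) \<in> B" using that sc by (simp add: int_pow_neg)
      then have "s [^] \<bar>l\<bar> \<in> B" using that by (auto simp: abs_if)
      then have "s [^] (int (nat \<bar>l\<bar>)) \<in> B" by simp
      then show False using False \<open>l \<noteq> 0\<close> by (metis zero_less_nat_eq zero_less_abs_iff)
    qed
    define B' where "B' = {y \<otimes> s [^] (l::int) |y l. y \<in> B}"
    have uniq: "y = y' \<and> l = l'" if "y \<in> B" "y' \<in> B" "y \<otimes> s [^] (l::int) = y' \<otimes> s [^] (l'::int)" for y y' l l'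
    proof -
      have "s [^] (l - l') = s [^] l \<otimes> inv (s [^] l')" using sc by (simp add: int_pow_diff)
      also have "s [^] l = inv y \<otimes> (y \<otimes> s [^] l)" using that(1) sc by (simp add: m_assoc[symmetric])
      also have "\<dots> = inv y \<otimes> (y' \<otimes> s [^] l')" using that(3) by simp
      also have "\<dots> \<otimes> inv (s [^] l') = inv y \<otimes> y'" using that(1,2) sc by (simp add: m_assoc)
      finally have "s [^] (l - l') \<in> B" using that by simp
      then have l: "l = l'" using noB by fastforce
      then show ?thesis using that sc by auto
    qed
    \<comment> \<open>By \<open>uniq\<close> the choice can only return the one decomposition, so
      \<open>f\<close> reads off the old part and the exponent of \<open>s\<close>.\<close>
    define f where "f = (\<lambda>x. SOME z. fst z \<in> B \<and> x = fst z \<otimes> s [^] (snd z :: int))"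
    have f: "f (y \<otimes> s [^] l) = (y, l)" if "y \<in> B" for y and l :: int
    proof -
      have "fst (f (y \<otimes> s [^] l)) \<in> B \<and> y \<otimes> s [^] l = fst (f (y \<otimes> s [^] l)) \<otimes> s [^] (snd (f (y \<otimes> s [^] l)))"
        unfolding f_def by (rule someI[of _ "(y, l)"]) (use that in simp)
      then show ?thesis using uniq that by (metis prod.collapse)
    qed
    have comm': "s [^] (l::int) \<otimes> y = y \<otimes> s [^] l" if "y \<in> B" for y l using sl B that comm by blast
    have mulB': "(y \<otimes> s [^] (l::int)) \<otimes> (y' \<otimes> s [^] (l'::int)) = (y \<otimes> y') \<otimes> s [^] (l + l')"
      if "y \<in> B" "y' \<in> B" for y y' l l'
    proof -
      have "(y \<otimes> s [^] l) \<otimes> (y' \<otimes> s [^] l') = y \<otimes> ((s [^] l \<otimes> y') \<otimes> s [^] l')"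
        using that sc by (simp add: m_assoc)
      then show ?thesis using that sc by (simp add: comm' m_assoc int_pow_mult)
    qed
    have B'sub: "subgroup B' G"
    proof (rule subgroupI)
      show "B' \<subseteq> carrier G" using sc by (auto simp: B'_def)
      show "B' \<noteq> {}" unfolding B'_def using B.one_closed by blast
      fix a assume "a \<in> B'"
      then obtain y l where y: "y \<in> B" "a = y \<otimes> s [^] (l::int)" by (auto simp: B'_def)
      have "inv a = s [^] (-l) \<otimes> inv y" using y sc by (simp add: inv_mult_group int_pow_neg)
      also have "\<dots> = inv y \<otimes> s [^] (-l)" using y by (intro comm') auto
      finally show "inv a \<in> B'" unfolding B'_def using y B.m_inv_closed by blast
      fix a' assume "a' \<in> B'"
      then obtain y' l' where "y' \<in> B" "a' = y' \<otimes> s [^] (l'::int)" by (auto simp: B'_def)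
      then show "a \<otimes> a' \<in> B'" using y mulB' by (auto simp: B'_def)
    qed
    have B'H: "B' \<subseteq> H" using B sl by (auto simp: B'_def)
    define b\<^sub>1 where b1d: "b\<^sub>1 = (\<lambda>j. if j < n then b j else s)"
    define p\<^sub>1 where p1d: "p\<^sub>1 = (\<lambda>i x. if i < n then p i (fst (f x)) else snd (f x))"
    have b'j: "b\<^sub>1 j = (if j < n then b j else \<one>) \<otimes> s [^] (if j < n then 0 else 1::int)" if "j < Suc n" for j
      using b sc by (auto simp: b1d int_pow_1)
    have b'B: "(if j < n then b j else \<one>) \<in> B" for j using b by auto
    have 1: "\<forall>j<Suc n. b\<^sub>1 j \<in> B'" using b'j b'B unfolding B'_def by blast
    have 2: "p\<^sub>1 i (b\<^sub>1 j \<otimes> x) = p\<^sub>1 i x + (if i = j then 1 else 0)"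
      if "i < Suc n" "j < Suc n" and xB: "x \<in> B'" for i j x
    proof -
      obtain y l where y: "y \<in> B" "x = y \<otimes> s [^] (l::int)" using xB by (auto simp: B'_def)
      have "b\<^sub>1 j \<otimes> x = ((if j < n then b j else \<one>) \<otimes> y) \<otimes> s [^] ((if j < n then 0 else 1) + l)"
        using b'j[OF that(2)] b'B[of j] y mulB' by simp
      then have fb: "f (b\<^sub>1 j \<otimes> x) = ((if j < n then b j else \<one>) \<otimes> y, (if j < n then 0 else 1) + l)"
        using f b'B[of j] y by simp
      have fx: "f x = (y, l)" using y f by simp
      show ?thesis using that y(1) p by (auto simp: p1d fb fx less_Suc_eq)
    qed
    have 3: "x = x'" if xB: "x \<in> B'" "x' \<in> B'" and eq: "\<forall>i<Suc n. p\<^sub>1 i x = p\<^sub>1 i x'" for x x'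
    proof -
      obtain y l where y: "y \<in> B" "x = y \<otimes> s [^] (l::int)" using xB by (auto simp: B'_def)
      obtain y' l' where y': "y' \<in> B" "x' = y' \<otimes> s [^] (l'::int)" using xB by (auto simp: B'_def)
      have "f x = (y, l)" "f x' = (y', l')" using y y' f by auto
      then have "\<forall>i<n. p i y = p i y'" "l = l'" using eq by (auto simp: p1d less_Suc_eq)
      then show ?thesis using inj y y' by auto
    qed
    have 4: "\<exists>y\<in>B'. \<exists>t\<in>T. z = y \<otimes> t" if z: "z \<in> generate G (insert s F)" for z
    proof -
      obtain x l where x: "x \<in> generate G F" "z = x \<otimes> s [^] (l::int)" using gi[OF _ _ z] by blast
      obtain y t where y: "y \<in> B" "t \<in> T" "x = y \<otimes> t" using cov[OF x(1)] by blast
      have tH: "t \<in> H" using y T by auto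
      have "z = y \<otimes> (t \<otimes> s [^] l)" using y tH sc by (simp add: x m_assoc)
      also have "t \<otimes> s [^] l = s [^] l \<otimes> t" using comm tH sl by blast
      also have "y \<otimes> (s [^] l \<otimes> t) = (y \<otimes> s [^] l) \<otimes> t" using y tH sc by (simp add: m_assoc)
      finally show ?thesis using y by (auto simp: B'_def)
    qed
    show ?thesis
      by (rule exI[of _ "Suc n"], rule exI[of _ b\<^sub>1], rule exI[of _ p\<^sub>1], rule exI[of _ B'], rule exI[of _ T])
        (use B'sub B'H 1 2 3 4 T in blast)
  qed
qed

text \<open>The cosets \<open>B #> x\<close> are preserved by multiplication from the left by
  \<open>B\<close>, while the walk multiplies from the right. The two operations commute, which
  makes the coset of the walk a Markov chain.\<close>

lemma virtually_abelian_lattice_group: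
  assumes fg: "finitely_generated G" and va: "virtually_abelian G"
  shows "\<exists>(n::nat) b P rep. lattice_group G {..<n} b P rep"
proof -
  obtain H where H: "subgroup H G" "comm_group (G\<lparr>carrier := H\<rparr>)" "finite (rcosets H)"
    using va by (auto simp: virtually_abelian_def)
  interpret H: subgroup H G by (rule H)
  have comm: "x \<otimes> y = y \<otimes> x" if "x \<in> H" "y \<in> H" for x y
    using comm_monoid.m_comm[OF comm_group.axioms(1)[OF H(2)], of x y] that by simp
  obtain S where S: "finite S" "S \<subseteq> carrier G" "generate G S = carrier G"
    using fg by (auto simp: finitely_generated_def finite_generating_set_def)
  obtain S' T where S': "finite S'" "S' \<subseteq> H" and T: "finite T" "T \<subseteq> carrier G"
    and cov: "\<forall>x\<in>carrier G. \<exists>h\<in>generate G S'. \<exists>t\<in>T. x = h \<otimes> t"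
    using finite_index_finitely_generated[OF H(1,3) S] by (elim exE conjE)
  obtain n :: nat and b and p :: "nat \<Rightarrow> 'a \<Rightarrow> int" and B T' where B: "subgroup B G" "B \<subseteq> H"
    and b': "\<forall>j<n. b j \<in> B"
    and p': "\<forall>i<n. \<forall>j<n. \<forall>x\<in>B. p i (b j \<otimes> x) = p i x + (if i = j then 1 else 0)"
    and inj': "\<forall>x\<in>B. \<forall>y\<in>B. (\<forall>i<n. p i x = p i y) \<longrightarrow> x = y"
    and T': "finite T'" "T' \<subseteq> H" and cov0: "\<forall>x\<in>generate G S'. \<exists>y\<in>B. \<exists>t\<in>T'. x = y \<otimes> t"
    using finite_index_free_abelian[OF H(1) comm S'] by blast
  note b = b'[rule_format] and p = p'[rule_format] and inj = inj'[rule_format] and cov' = cov0[rule_format]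
  interpret B: subgroup B G by (rule B)
  define \<sigma> where "\<sigma> = (\<lambda>x. SOME y. y \<in> B #> x)"
  have \<sigma>: "\<sigma> x \<in> B #> x" and \<sigma>c: "\<sigma> x \<in> carrier G" and \<sigma>h: "x \<otimes> inv (\<sigma> x) \<in> B" if "x \<in> carrier G" for x
    using coset_representative[OF B(1) that] by (simp_all add: \<sigma>_def)
  have \<sigma>cong: "\<sigma> (y \<otimes> x) = \<sigma> x" if "x \<in> carrier G" "y \<in> B" for x y
    unfolding \<sigma>_def using that by (simp flip: coset_mult_assoc add: coset_join2[OF _ B(1)] B.subset)
  define P where "P = (\<lambda>i x. p i (x \<otimes> inv (\<sigma> x)))"
  have "lattice_group G {..<n} b P \<sigma>"
  proof
    show "finite {..<n}" by simp
    show "b i \<in> carrier G" if "i \<in> {..<n}" for i using b that by auto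
    show "\<sigma> x \<in> carrier G" if "x \<in> carrier G" for x using \<sigma>c that .
    show "\<sigma> (\<sigma> x) = \<sigma> x" if xc: "x \<in> carrier G" for x
    proof -
      obtain h where h: "h \<in> B" "\<sigma> x = h \<otimes> x" using \<sigma>[OF xc] by (auto simp: r_coset_def)
      then show ?thesis using \<sigma>cong[OF xc h(1)] by simp
    qed
    \<comment> \<open>Every element has the form \<open>y \<otimes> t' \<otimes> t\<close> with
      \<open>y\<close> in \<open>B\<close>, so the finitely many products
      \<open>t' \<otimes> t\<close> meet every coset.\<close>
    have "\<sigma> ` carrier G \<subseteq> (\<lambda>(t', t). \<sigma> (t' \<otimes> t)) ` (T' \<times> T)"
    proof
      fix z assume "z \<in> \<sigma> ` carrier G"
      then obtain x where x: "x \<in> carrier G" "z = \<sigma> x" by auto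
      obtain h t where h: "h \<in> generate G S'" "t \<in> T" "x = h \<otimes> t" using bspec[OF cov x(1)] by blast
      obtain y t' where y: "y \<in> B" "t' \<in> T'" "h = y \<otimes> t'" using cov'[OF h(1)] by blast
      have cc: "t \<in> carrier G" "t' \<in> carrier G" using h y T T' by auto
      have "\<sigma> x = \<sigma> (y \<otimes> (t' \<otimes> t))" using h y cc by (simp add: m_assoc)
      also have "\<dots> = \<sigma> (t' \<otimes> t)" using y cc by (intro \<sigma>cong) auto
      finally show "z \<in> (\<lambda>(t', t). \<sigma> (t' \<otimes> t)) ` (T' \<times> T)" using x h y by auto
    qed
    then show "finite (\<sigma> ` carrier G)" using T T' by (meson finite_SigmaI finite_surj)
    show "\<sigma> (b i \<otimes> x) = \<sigma> x" if "i \<in> {..<n}" "x \<in> carrier G" for i x using \<sigma>cong b that by auto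
    show "P i (b j \<otimes> x) = P i x + (if i = j then 1 else 0)"
      if "i \<in> {..<n}" "j \<in> {..<n}" "x \<in> carrier G" for i j x
    proof -
      have "b j \<otimes> x \<otimes> inv (\<sigma> x) = b j \<otimes> (x \<otimes> inv (\<sigma> x))" using that b \<sigma>c by (simp add: m_assoc)
      then show ?thesis using that p[OF _ _ \<sigma>h] \<sigma>cong b by (simp add: P_def)
    qed
    show "x = y" if "x \<in> carrier G" "y \<in> carrier G" "\<sigma> x = \<sigma> y" "\<And>i. i \<in> {..<n} \<Longrightarrow> P i x = P i y" for x y
    proof -
      have "x \<otimes> inv (\<sigma> x) = y \<otimes> inv (\<sigma> y)" using \<sigma>h[OF that(1)] \<sigma>h[OF that(2)] that(4) by (intro inj) (auto simp: P_def)
      then show ?thesis using that \<sigma>c by (metis inv_closed right_cancel)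
    qed
  qed
  then show ?thesis by blast
qed

end

subsection \<open>Mixing of the coset chain\<close>

text \<open>A geometric series with each term repeated \<open>k\<close> times: contraction will be
  available only once every \<open>k\<close> steps.\<close>

lemma summable_power_div:
  fixes r :: real
  assumes "0 \<le> r" "r < 1" "0 < k"
  shows "summable (\<lambda>j. r ^ (j div k))"
proof (rule summableI_nonneg_bounded[where x = "real k * (1 / (1 - r))"])
  show "0 \<le> r ^ (j div k)" for j using assms by simp
  fix n
  have "n \<le> n * k" using assms by simp
  then have "(\<Sum>j<n. r ^ (j div k)) \<le> (\<Sum>j<n*k. r ^ (j div k))"
    using assms by (intro sum_mono2) auto
  also have "\<dots> = (\<Sum>m<n. \<Sum>j=m*k..<m*k+k. r ^ (j div k))" by (simp add: sum.nat_group)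
  also have "\<dots> = (\<Sum>m<n. real k * r ^ m)"
  proof (intro sum.cong refl)
    fix m
    have "(\<Sum>j=m*k..<m*k+k. r ^ (j div k)) = (\<Sum>j=m*k..<m*k+k. r ^ m)"
    proof (intro sum.cong refl)
      fix j assume "j \<in> {m*k..<m*k+k}"
      then have "j div k = m" by (intro div_nat_eqI) (auto simp: algebra_simps)
      then show "r ^ (j div k) = r ^ m" by simp
    qed
    then show "(\<Sum>j=m*k..<m*k+k. r ^ (j div k)) = real k * r ^ m" by simp
  qed
  also have "\<dots> = real k * (\<Sum>m<n. r ^ m)" by (simp add: sum_distrib_left)
  also have "\<dots> \<le> real k * (1 / (1 - r))"
    using sum_le_suminf[of "\<lambda>m. r ^ m" "{..<n}"] assms
    by (intro mult_left_mono) (auto simp: suminf_geometric summable_geometric)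
  finally show "(\<Sum>j<n. r ^ (j div k)) \<le> real k * (1 / (1 - r))" .
qed

context lattice_group
begin

text \<open>Functions on the finite set of cosets, written as functions on the group.\<close>

definition class_fun :: "('a \<Rightarrow> 'z) \<Rightarrow> bool" where
  "class_fun f \<longleftrightarrow> (\<forall>i\<in>I. \<forall>x\<in>carrier G. f (c i \<otimes> x) = f x)"

definition reps :: "'a set" where "reps = rep ` carrier G"

lemma finite_reps: "finite reps" by (simp add: reps_def finite_rep)

lemma reps_carrier: "t \<in> reps \<Longrightarrow> t \<in> carrier G" by (auto simp: reps_def rep_closed)

lemma rep_reps: "t \<in> reps \<Longrightarrow> rep t = t" by (auto simp: reps_def rep_rep)

lemma rep_in_reps: "x \<in> carrier G \<Longrightarrow> rep x \<in> reps" by (auto simp: reps_def)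

lemma card_reps: "card reps > 0"
  using finite_reps rep_in_reps[OF one_closed] by (auto simp: card_gt_0_iff)

text \<open>Invariance is given for the \<open>c i\<close> and not for their inverses. The descent
  on the distance of the coordinates therefore always raises the smaller coordinate, on whichever of
  the two sides it is.\<close>

lemma class_fun_cong:
  assumes f: "class_fun f" and "x \<in> carrier G" "y \<in> carrier G" "rep x = rep y"
  shows "f x = f y"
  using assms(2-)
proof (induction "\<Sum>i\<in>I. nat \<bar>P i x - P i y\<bar>" arbitrary: x y rule: less_induct)
  case less
  show ?case
  proof (cases "\<forall>i\<in>I. P i x = P i y")
    case True
    then show ?thesis using coord_inj[of x y] less.prems by auto
  next
    case False
    then obtain i where i: "i \<in> I" "P i x \<noteq> P i y" by auto
    note c = c_closed[OF i(1)]
    show ?thesis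
    proof (cases "P i x < P i y")
      case True
      have "(\<Sum>j\<in>I. nat \<bar>P j (c i \<otimes> x) - P j y\<bar>) < (\<Sum>j\<in>I. nat \<bar>P j x - P j y\<bar>)"
        using i True less.prems by (intro sum_strict_mono_ex1 finite_I) (auto simp: P_c intro!: bexI[of _ i])
      then have "f (c i \<otimes> x) = f y" using less.hyps[of "c i \<otimes> x" y] less.prems c i by (simp add: rep_c)
      then show ?thesis using f i less.prems by (simp add: class_fun_def)
    next
      case F: False
      have "(\<Sum>j\<in>I. nat \<bar>P j x - P j (c i \<otimes> y)\<bar>) < (\<Sum>j\<in>I. nat \<bar>P j x - P j y\<bar>)"
        using i F less.prems by (intro sum_strict_mono_ex1 finite_I) (auto simp: P_c intro!: bexI[of _ i])
      then have "f x = f (c i \<otimes> y)" using less.hyps[of x "c i \<otimes> y"] less.prems c i by (simp add: rep_c)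
      then show ?thesis using f i less.prems by (simp add: class_fun_def)
    qed
  qed
qed

lemma class_fun_rep: "class_fun f \<Longrightarrow> x \<in> carrier G \<Longrightarrow> f (rep x) = f x"
  by (rule class_fun_cong) (auto simp: rep_closed rep_rep)

lemma class_fun_bounded:
  fixes f :: "'a \<Rightarrow> 'z::real_normed_vector"
  assumes "class_fun f"
  shows "\<exists>B\<ge>0. \<forall>x\<in>carrier G. norm (f x) \<le> B"
proof -
  have "norm (f x) \<le> (\<Sum>t\<in>reps. norm (f t))" if "x \<in> carrier G" for x
    using member_le_sum[of "rep x" reps "\<lambda>t. norm (f t)"] class_fun_rep[OF assms that]
      rep_in_reps[OF that] finite_reps by auto
  then show ?thesis by (intro exI[of _ "\<Sum>t\<in>reps. norm (f t)"]) (auto intro: sum_nonneg)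
qed

lemma class_fun_translate: "class_fun f \<Longrightarrow> g \<in> carrier G \<Longrightarrow> class_fun (\<lambda>x. f (x \<otimes> g))"
  by (auto simp: class_fun_def m_assoc c_closed)

lemma class_fun_self_rep: "class_fun rep" by (simp add: class_fun_def rep_c)

text \<open>Right translation permutes the cosets, so the uniform distribution on them is invariant
  under every step.\<close>

lemma sum_reps_translate:
  fixes f :: "'a \<Rightarrow> 'z::comm_monoid_add"
  assumes f: "class_fun f" and g: "g \<in> carrier G"
  shows "(\<Sum>t\<in>reps. f (t \<otimes> g)) = (\<Sum>t\<in>reps. f t)"
proof -
  have inj: "inj_on (\<lambda>t. rep (t \<otimes> g)) reps"
  proof (rule inj_onI)
    fix t t' assume t: "t \<in> reps" "t' \<in> reps" and eq: "rep (t \<otimes> g) = rep (t' \<otimes> g)"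
    note tc = t[THEN reps_carrier]
    have "rep (t \<otimes> g \<otimes> inv g) = rep (t' \<otimes> g \<otimes> inv g)"
      by (rule class_fun_cong[OF class_fun_translate[OF class_fun_self_rep]]) (use tc g eq in auto)
    then show "t = t'" using t tc g by (simp add: m_assoc rep_reps)
  qed
  have "bij_betw (\<lambda>t. rep (t \<otimes> g)) reps reps"
    unfolding bij_betw_def
    using endo_inj_surj[OF finite_reps _ inj] inj rep_in_reps reps_carrier g by (auto simp: image_subset_iff)
  then have "(\<Sum>t\<in>reps. f (rep (t \<otimes> g))) = (\<Sum>t\<in>reps. f t)" by (rule sum.reindex_bij_betw)
  moreover have "(\<Sum>t\<in>reps. f (rep (t \<otimes> g))) = (\<Sum>t\<in>reps. f (t \<otimes> g))"
    by (intro sum.cong refl class_fun_rep f) (use reps_carrier g in auto)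
  ultimately show ?thesis by simp
qed

lemma c_commute:
  assumes "i \<in> I" "j \<in> I"
  shows "c i \<otimes> c j = c j \<otimes> c i"
proof (rule coord_inj)
  show "rep (c i \<otimes> c j) = rep (c j \<otimes> c i)"
    using rep_c[of i "c j"] rep_c[of j "c i"] rep_c[of i \<one>] rep_c[of j \<one>] assms c_closed by simp
  show "P l (c i \<otimes> c j) = P l (c j \<otimes> c i)" if "l \<in> I" for l
    using P_c[of l i "c j"] P_c[of l j "c i"] P_c[of l i \<one>] P_c[of l j \<one>] assms that c_closed by simp
qed (use assms c_closed in auto)

text \<open>Since the \<open>c i\<close> commute, this conjugate depends on the coset of
  \<open>x\<close> only and takes finitely many values. This finiteness makes the constants of
  \<open>character_contraction\<close> uniform in the position.\<close>

lemma class_fun_conj: "i \<in> I \<Longrightarrow> class_fun (\<lambda>x. inv x \<otimes> c i \<otimes> x)"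
  unfolding class_fun_def
proof (intro ballI)
  fix j x assume i: "i \<in> I" "j \<in> I" and x: "x \<in> carrier G"
  note cc = c_closed[OF i(1)] c_closed[OF i(2)]
  have "inv (c j \<otimes> x) \<otimes> c i \<otimes> (c j \<otimes> x) = inv x \<otimes> (inv (c j) \<otimes> ((c i \<otimes> c j) \<otimes> x))"
    using cc x by (simp add: inv_mult_group m_assoc)
  also have "\<dots> = inv x \<otimes> ((inv (c j) \<otimes> c j) \<otimes> (c i \<otimes> x))"
    unfolding c_commute[OF i] using cc x by (simp only: m_assoc inv_closed m_closed)
  also have "\<dots> = inv x \<otimes> c i \<otimes> x" using cc x by (simp add: m_assoc)
  finally show "inv (c j \<otimes> x) \<otimes> c i \<otimes> (c j \<otimes> x) = inv x \<otimes> c i \<otimes> x" .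
qed

lemma c_translate_neq: "i \<in> I \<Longrightarrow> x \<in> carrier G \<Longrightarrow> c i \<otimes> x \<noteq> x"
  using P_c[of i i x] by auto

end

text \<open>\<open>spread\<close> is the form in which aperiodicity and generation are used. It is
  asked for all large times so that it passes to pairs, where both components have to be reached at
  a common time.\<close>

locale lattice_walk = lattice_group +
  fixes \<nu> :: "'a pmf"
  assumes supp: "set_pmf \<nu> \<subseteq> carrier G"
    and spread: "g \<in> carrier G \<Longrightarrow> \<exists>K. \<forall>k\<ge>K. g \<in> set_pmf (convolution_power G \<nu> k)"
begin

abbreviation pw :: "nat \<Rightarrow> 'a pmf" where "pw n \<equiv> convolution_power G \<nu> n"

text \<open>The \<open>n\<close>-step Markov operator. It acts from the right and so commutes with
  the left multiplications by the \<open>c i\<close>, which define class functions and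
  characters.\<close>

abbreviation U :: "nat \<Rightarrow> ('a \<Rightarrow> complex) \<Rightarrow> 'a \<Rightarrow> complex" where
  "U n f x \<equiv> \<E> (pw n) (\<lambda>h. f (x \<otimes> h))"

lemma pw_carrier: "h \<in> set_pmf (pw n) \<Longrightarrow> h \<in> carrier G"
  using convolution_power_carrier[OF supp] by auto

lemma pw_1: "pw (Suc 0) = \<nu>" using supp by (simp add: convolution_pmf_one)

lemma finite_minorization:
  assumes "finite W" "W \<subseteq> carrier G"
  shows "\<exists>k>0. \<exists>p>0. \<forall>g\<in>W. p \<le> pmf (pw k) g"
proof -
  have "\<exists>K. \<forall>g\<in>W. \<forall>k\<ge>K. g \<in> set_pmf (pw k)"
    using assms
  proof (induction W)
    case (insert g W)
    then obtain K K' where "\<forall>g\<in>W. \<forall>k\<ge>K. g \<in> set_pmf (pw k)" "\<forall>k\<ge>K'. g \<in> set_pmf (pw k)"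
      using spread[of g] by auto
    then show ?case by (intro exI[of _ "max K K'"]) auto
  qed simp
  then obtain K where K: "\<And>g k. g \<in> W \<Longrightarrow> k \<ge> K \<Longrightarrow> g \<in> set_pmf (pw k)" by blast
  define k where "k = Suc K"
  define p where "p = Min (insert 1 (pmf (pw k) ` W))"
  have "p > 0" unfolding p_def using assms K[of _ k] by (auto simp: pmf_positive_iff k_def)
  moreover have "\<forall>g\<in>W. p \<le> pmf (pw k) g" unfolding p_def using assms by auto
  ultimately show ?thesis by (intro exI[of _ k]) (auto simp: k_def)
qed

lemma norm_U_le:
  assumes "\<And>x. x \<in> carrier G \<Longrightarrow> norm (f x) \<le> B" "x \<in> carrier G"
  shows "norm (U n f x) \<le> B"
  using assms pw_carrier by (intro norm_expectation_le) auto

lemma U_add: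
  assumes f: "\<And>x. x \<in> carrier G \<Longrightarrow> norm (f x) \<le> B" and x: "x \<in> carrier G"
  shows "U (m + n) f x = U m (U n f) x"
proof -
  have "U (m + n) f x = \<E> (pw m) (\<lambda>h. \<E> (pw n) (\<lambda>h'. f (x \<otimes> (h \<otimes> h'))))"
    unfolding convolution_power_add[OF supp]
    by (rule expectation_convolution_pmf[where B = B]) (use f x pw_carrier in auto)
  also have "\<dots> = U m (U n f) x"
  proof (intro integral_cong_AE)
    show "AE h in pw m. \<E> (pw n) (\<lambda>h'. f (x \<otimes> (h \<otimes> h'))) = U n f (x \<otimes> h)"
      unfolding AE_measure_pmf_iff
    proof (intro ballI integral_cong_AE)
      fix h assume "h \<in> set_pmf (pw m)"
      then show "AE h' in pw n. f (x \<otimes> (h \<otimes> h')) = f (x \<otimes> h \<otimes> h')"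
        by (auto simp: AE_measure_pmf_iff m_assoc x pw_carrier)
    qed auto
  qed auto
  finally show ?thesis .
qed

lemma class_fun_U:
  assumes "class_fun f" shows "class_fun (U n f)"
  unfolding class_fun_def
proof (intro ballI integral_cong_AE)
  fix i x assume "i \<in> I" "x \<in> carrier G"
  then show "AE h in pw n. f (c i \<otimes> x \<otimes> h) = f (x \<otimes> h)"
    using assms pw_carrier by (auto simp: AE_measure_pmf_iff class_fun_def m_assoc c_closed)
qed auto

lemma sum_reps_U:
  assumes f: "class_fun f"
  shows "(\<Sum>t\<in>reps. U n f t) = (\<Sum>t\<in>reps. f t)"
proof -
  obtain B where B: "\<And>x. x \<in> carrier G \<Longrightarrow> norm (f x) \<le> B" using class_fun_bounded[OF f] by auto
  have "(\<Sum>t\<in>reps. U n f t) = \<E> (pw n) (\<lambda>h. \<Sum>t\<in>reps. f (t \<otimes> h))"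
    using pw_carrier reps_carrier by (intro Bochner_Integration.integral_sum[symmetric] integrable_pmf_bounded[where B = B] B) auto
  also have "\<dots> = \<E> (pw n) (\<lambda>h. \<Sum>t\<in>reps. f t)"
    by (intro integral_cong_AE) (auto simp: AE_measure_pmf_iff sum_reps_translate[OF f] pw_carrier)
  finally show ?thesis by simp
qed

text \<open>From any coset, \<open>k\<close> steps reach each coset with probability at least
  \<open>p\<close>, and a function of sum zero cancels on this common part. The constants
  \<open>k\<close> and \<open>r\<close> are independent of the function.\<close>

lemma mixing:
  "\<exists>k>0. \<exists>r\<ge>0. r < 1 \<and> (\<forall>f B. class_fun f \<longrightarrow> (\<Sum>t\<in>reps. f t) = 0 \<longrightarrow>
     (\<forall>x\<in>carrier G. norm (f x) \<le> B) \<longrightarrow> (\<forall>n. \<forall>x\<in>carrier G. norm (U n f x) \<le> r ^ (n div k) * B))"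
proof -
  define W where "W = (\<lambda>(s, t). inv s \<otimes> t) ` (reps \<times> reps)"
  have W: "finite W" "W \<subseteq> carrier G" unfolding W_def using finite_reps reps_carrier by auto
  obtain k p where k: "k > 0" and p: "p > 0" "\<forall>g\<in>W. p \<le> pmf (pw k) g"
    using finite_minorization[OF W] by (elim exE conjE)
  define r where "r = max 0 (1 - p * card reps)"
  have r: "r \<ge> 0" "r < 1" using p card_reps by (auto simp: r_def)
  have step: "norm (U k f x) \<le> r * B"
    if f: "class_fun f" "(\<Sum>t\<in>reps. f t) = 0" "\<And>x. x \<in> carrier G \<Longrightarrow> norm (f x) \<le> B"
      and x: "x \<in> carrier G" for f B x
  proof -
    \<comment> \<open>For a class function the move to the representative is free, and it keeps the
      points \<open>inv y \<otimes> t\<close> inside the finite set \<open>W\<close>.\<close>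
    define y where "y = rep x"
    have y: "y \<in> reps" "y \<in> carrier G" using x by (auto simp: y_def rep_in_reps rep_closed)
    have Uy: "U k f x = U k f y" using class_fun_rep[OF class_fun_U[OF f(1)] x] by (simp add: y_def)
    define V where "V = (\<lambda>t. inv y \<otimes> t) ` reps"
    have V: "V \<subseteq> W" "finite V" using y finite_reps by (auto simp: V_def W_def)
    have inj: "inj_on (\<lambda>t. inv y \<otimes> t) reps"
      using y reps_carrier by (intro inj_onI) (metis Units_eq Units_l_cancel inv_closed)
    have Vc: "h \<in> V \<Longrightarrow> h \<in> carrier G" for h using y reps_carrier by (auto simp: V_def)
    have sum0: "(\<Sum>h\<in>V. f (y \<otimes> h)) = 0"
    proof -
      have "(\<Sum>h\<in>V. f (y \<otimes> h)) = (\<Sum>t\<in>reps. f (y \<otimes> (inv y \<otimes> t)))"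
        unfolding V_def by (simp add: sum.reindex[OF inj])
      also have "\<dots> = (\<Sum>t\<in>reps. f t)"
        using y reps_carrier by (intro sum.cong refl) (simp add: m_assoc[symmetric])
      finally show ?thesis using f by simp
    qed
    have "norm (U k f y) \<le> p * norm (\<Sum>h\<in>V. f (y \<otimes> h)) + (1 - p * card V) * B"
      using p V f(3) y Vc pw_carrier by (intro norm_expectation_minorized_le) auto
    also have "\<dots> = (1 - p * card reps) * B" using sum0 inj by (simp add: V_def card_image)
    also have "\<dots> \<le> r * B" using order.trans[OF norm_ge_zero f(3)[OF x]] by (intro mult_right_mono) (auto simp: r_def)
    finally show ?thesis using Uy by simp
  qed
  have main: "norm (U (k * n + m) f x) \<le> r ^ n * B"
    if f: "class_fun f" "(\<Sum>t\<in>reps. f t) = 0" "\<And>x. x \<in> carrier G \<Longrightarrow> norm (f x) \<le> B"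
      and x: "x \<in> carrier G" for f B x n m
    using x
  proof (induction n arbitrary: x)
    case 0
    then show ?case using norm_U_le[of f B x m] f by simp
  next
    case (Suc n)
    have "U (k * Suc n + m) f x = U k (U (k * n + m) f) x"
      using U_add[where f = f, OF f(3) Suc.prems, where m = k and n = "k * n + m"] by (simp add: algebra_simps)
    also have "norm \<dots> \<le> r * (r ^ n * B)"
      by (rule step) (use f Suc in \<open>auto simp: sum_reps_U class_fun_U\<close>)
    finally show ?case by (simp add: algebra_simps)
  qed
  show ?thesis
  proof (intro exI conjI allI impI ballI)
    fix f :: "'a \<Rightarrow> complex" and B n x
    assume "class_fun f" "(\<Sum>t\<in>reps. f t) = 0" "\<forall>x\<in>carrier G. norm (f x) \<le> B" "x \<in> carrier G"
    then show "norm (U n f x) \<le> r ^ (n div k) * B" using main[of f B x "n div k" "n mod k"] by simp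
  qed (use k r in auto)
qed

text \<open>The functions treated are those that \<open>c j\<close> multiplies by a scalar
  \<open>\<zeta> j\<close>, as the characters of a torus do. \<open>k\<close> and \<open>p\<close>
  depend on the walk alone; this matters because the torus will grow with \<open>n\<close>.\<close>

lemma character_contraction:
  "\<exists>k>0. \<exists>p>0. p \<le> 1/2 \<and> (\<forall>f B \<zeta> i. i \<in> I \<longrightarrow> (\<forall>x\<in>carrier G. norm (f x) \<le> B) \<longrightarrow>
     (\<forall>j\<in>I. \<forall>x\<in>carrier G. f (c j \<otimes> x) = \<zeta> j * f x) \<longrightarrow>
     (\<forall>n. \<forall>x\<in>carrier G. norm (U n f x) \<le> (1 - p * (2 - norm (1 + \<zeta> i))) ^ (n div k) * B))"
proof -
  define W where "W = insert \<one> ((\<lambda>(i, t). inv t \<otimes> c i \<otimes> t) ` (I \<times> reps))"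
  have W: "finite W" "W \<subseteq> carrier G" unfolding W_def using finite_reps finite_I c_closed reps_carrier by auto
  obtain k p0 where k: "k > 0" and p0: "p0 > 0" "\<forall>g\<in>W. p0 \<le> pmf (pw k) g"
    using finite_minorization[OF W] by (elim exE conjE)
  \<comment> \<open>As \<open>2 - norm (1 + \<zeta> i)\<close> is at most 2, the bound
    \<open>1/2\<close> keeps the contraction factor nonnegative, so that its powers can later be
    compared.\<close>
  define p where "p = min p0 (1/2)"
  have p: "p > 0" "p \<le> 1/2" "\<And>g. g \<in> W \<Longrightarrow> p \<le> pmf (pw k) g" using p0 by (force simp: p_def)+
  have step: "norm (U k f x) \<le> (1 - p * (2 - norm (1 + \<zeta> i))) * B"
    if i: "i \<in> I" and f: "\<And>x. x \<in> carrier G \<Longrightarrow> norm (f x) \<le> B"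
      "\<And>j x. j \<in> I \<Longrightarrow> x \<in> carrier G \<Longrightarrow> f (c j \<otimes> x) = \<zeta> j * f x"
      and x: "x \<in> carrier G" for f B \<zeta> i x
  proof -
    \<comment> \<open>\<open>w\<close> ranges over the finite set \<open>W\<close>, so \<open>x\<close> and \<open>c i \<otimes> x\<close> are both reached from \<open>x\<close> with
      probability at least \<open>p\<close>, and \<open>f\<close> takes there values of ratio \<open>\<zeta> i\<close>\<close>
    define w where "w = inv x \<otimes> c i \<otimes> x"
    note ci = c_closed[OF i]
    have wc: "w \<in> carrier G" using x ci by (simp add: w_def)
    have xw: "x \<otimes> w = c i \<otimes> x" using x ci by (simp add: w_def m_assoc[symmetric])
    have "w = inv (rep x) \<otimes> c i \<otimes> rep x" using class_fun_rep[OF class_fun_conj[OF i] x] by (simp add: w_def)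
    then have wW: "w \<in> W" using i rep_in_reps[OF x] by (auto simp: W_def)
    have w1: "w \<noteq> \<one>" using xw c_translate_neq[OF i x] x by auto
    have "norm (U k f x) \<le> p * norm (\<Sum>h\<in>{\<one>, w}. f (x \<otimes> h)) + (1 - p * card {\<one>, w}) * B"
    proof (rule norm_expectation_minorized_le)
      show "p \<le> pmf (pw k) h" if "h \<in> {\<one>, w}" for h using that p wW by (auto simp: W_def)
    qed (use p f x wc pw_carrier in auto)
    also have "(\<Sum>h\<in>{\<one>, w}. f (x \<otimes> h)) = (1 + \<zeta> i) * f x"
      using w1 x xw f(2)[OF i x] by (simp add: algebra_simps)
    also have "p * norm ((1 + \<zeta> i) * f x) \<le> p * (norm (1 + \<zeta> i) * B)"
      using p f(1)[OF x] by (intro mult_left_mono) (auto simp: norm_mult intro: mult_left_mono)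
    finally show ?thesis using w1 by (simp add: algebra_simps)
  qed
  have equi: "U n f (c j \<otimes> x) = \<zeta> j * U n f x"
    if f: "\<And>j x. j \<in> I \<Longrightarrow> x \<in> carrier G \<Longrightarrow> f (c j \<otimes> x) = \<zeta> j * f x" and "j \<in> I" "x \<in> carrier G" for f \<zeta> n j x
  proof -
    have "U n f (c j \<otimes> x) = \<E> (pw n) (\<lambda>h. \<zeta> j * f (x \<otimes> h))"
      using that c_closed pw_carrier by (intro integral_cong_AE) (auto simp: AE_measure_pmf_iff m_assoc)
    then show ?thesis by simp
  qed
  have main: "norm (U (k * n + m) f x) \<le> (1 - p * (2 - norm (1 + \<zeta> i))) ^ n * B"
    if i: "i \<in> I" and f: "\<And>x. x \<in> carrier G \<Longrightarrow> norm (f x) \<le> B"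
      "\<And>j x. j \<in> I \<Longrightarrow> x \<in> carrier G \<Longrightarrow> f (c j \<otimes> x) = \<zeta> j * f x"
      and x: "x \<in> carrier G" for f B \<zeta> i x n m
    using x
  proof (induction n arbitrary: x)
    case 0
    then show ?case using norm_U_le[of f B x m] f by simp
  next
    case (Suc n)
    have "U (k * Suc n + m) f x = U k (U (k * n + m) f) x"
      using U_add[where f = f, OF f(1) Suc.prems, where m = k and n = "k * n + m"] by (simp add: algebra_simps)
    also have "norm \<dots> \<le> (1 - p * (2 - norm (1 + \<zeta> i))) * ((1 - p * (2 - norm (1 + \<zeta> i))) ^ n * B)"
      by (rule step) (use i Suc equi[OF f(2)] in auto)
    finally show ?case by (simp add: algebra_simps)
  qed
  show ?thesis
  proof (intro exI conjI allI impI ballI)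
    fix f :: "'a \<Rightarrow> complex" and B \<zeta> i n x
    assume "i \<in> I" "\<forall>x\<in>carrier G. norm (f x) \<le> B" "\<forall>j\<in>I. \<forall>x\<in>carrier G. f (c j \<otimes> x) = \<zeta> j * f x" "x \<in> carrier G"
    then show "norm (U n f x) \<le> (1 - p * (2 - norm (1 + \<zeta> i))) ^ (n div k) * B"
      using main[of i f B \<zeta> x "n div k" "n mod k"] by simp
  qed (use k p in auto)
qed

text \<open>The solution is the Neumann series of the iterates of \<open>\<psi>\<close>, which
  \<open>mixing\<close> makes geometrically convergent; applying one step shifts the series and
  drops its first term.\<close>

lemma poisson_equation:
  fixes \<psi> :: "'a \<Rightarrow> real"
  assumes \<psi>: "class_fun \<psi>" and mean: "(\<Sum>t\<in>reps. \<psi> t) = 0"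
  shows "\<exists>u::'a \<Rightarrow> real. class_fun u \<and>
    (\<forall>x\<in>carrier G. \<E> \<nu> (\<lambda>g. u (x \<otimes> g)) = u x - \<psi> x)"
proof -
  define f where "f = (\<lambda>x. complex_of_real (\<psi> x))"
  have f: "class_fun f" "(\<Sum>t\<in>reps. f t) = 0"
    using \<psi> mean by (auto simp: f_def class_fun_def simp flip: of_real_sum)
  obtain B where B: "B \<ge> 0" "\<And>x. x \<in> carrier G \<Longrightarrow> norm (f x) \<le> B" using class_fun_bounded[OF f(1)] by auto
  obtain k r where k: "k > 0" and r: "r \<ge> 0" "r < 1"
    and mix: "\<forall>f B. class_fun f \<longrightarrow> (\<Sum>t\<in>reps. f t) = 0 \<longrightarrow> (\<forall>x\<in>carrier G. norm (f x) \<le> B) \<longrightarrow>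
      (\<forall>n. \<forall>x\<in>carrier G. norm (U n f x) \<le> r ^ (n div k) * B)"
    using mixing by (elim exE conjE)
  have Uf: "norm (U n f x) \<le> r ^ (n div k) * B" if "x \<in> carrier G" for n x
    using mix[rule_format, OF f B(2) that] by simp
  have summ: "summable (\<lambda>n. r ^ (n div k) * B)" using summable_power_div[OF r k] by (rule summable_mult2)
  define S where "S = (\<lambda>N x. \<Sum>n<N. U n f x)"
  define v where "v = (\<lambda>x. \<Sum>n. U n f x)"
  have lim: "(\<lambda>N. S N x) \<longlonglongrightarrow> v x" if "x \<in> carrier G" for x
    unfolding S_def v_def using Uf[OF that]
    by (intro summable_LIMSEQ summable_comparison_test'[OF summ, of 0]) auto
  have bound: "norm (S N x) \<le> (\<Sum>n. r ^ (n div k) * B)" if "x \<in> carrier G" for N x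
  proof -
    have "norm (S N x) \<le> (\<Sum>n<N. r ^ (n div k) * B)"
      unfolding S_def using Uf[OF that] by (intro sum_norm_le) auto
    also have "\<dots> \<le> (\<Sum>n. r ^ (n div k) * B)"
      using r B by (intro sum_le_suminf summ) auto
    finally show ?thesis .
  qed
  have U1: "U 1 (S N) x = S N x - f x + U N f x" if x: "x \<in> carrier G" for N x
  proof -
    have "U 1 (S N) x = (\<Sum>n<N. U 1 (U n f) x)" unfolding S_def
      by (intro Bochner_Integration.integral_sum integrable_pmf_bounded[where B = B] norm_U_le[OF B(2)])
        (use x pw_carrier in blast)+
    also have "\<dots> = (\<Sum>n<N. U (Suc n) f x)" using U_add[where f = f, OF B(2) x, where m = 1] by (intro sum.cong refl) simp
    also have "\<dots> = (\<Sum>n<Suc N. U n f x) - U 0 f x" by (subst sum.lessThan_Suc_shift) simp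
    finally show ?thesis using x by (simp add: S_def)
  qed
  have "U 1 v x = v x - f x" if x: "x \<in> carrier G" for x
  proof -
    have "(\<lambda>N. U 1 (S N) x) \<longlonglongrightarrow> U 1 v x"
    proof (rule integral_dominated_convergence[where w = "\<lambda>_. \<Sum>n. r ^ (n div k) * B"])
      show "AE h in pw 1. (\<lambda>N. S N (x \<otimes> h)) \<longlonglongrightarrow> v (x \<otimes> h)"
        using lim x pw_carrier[of _ 1] unfolding AE_measure_pmf_iff by blast
      show "AE h in pw 1. norm (S N (x \<otimes> h)) \<le> (\<Sum>n. r ^ (n div k) * B)" for N
        using bound x pw_carrier[of _ 1] unfolding AE_measure_pmf_iff by blast
    qed auto
    moreover have "(\<lambda>N. U N f x) \<longlonglongrightarrow> 0"
      using Uf[OF x] by (intro Lim_null_comparison[OF _ summable_LIMSEQ_zero[OF summ]]) auto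
    then have "(\<lambda>N. S N x - f x + U N f x) \<longlonglongrightarrow> v x - f x + 0"
      by (intro tendsto_intros lim x)
    ultimately show ?thesis using U1[OF x] LIMSEQ_unique by fastforce
  qed
  then have main: "\<E> \<nu> (\<lambda>g. v (x \<otimes> g)) = v x - f x" if "x \<in> carrier G" for x
    using that pw_1 by (metis One_nat_def)
  have cv: "class_fun v" using class_fun_U[OF f(1)] by (auto simp: v_def class_fun_def)
  obtain Bv where Bv: "\<And>x. x \<in> carrier G \<Longrightarrow> norm (v x) \<le> Bv" using class_fun_bounded[OF cv] by auto
  show ?thesis
  proof (intro exI[of _ "\<lambda>x. Re (v x)"] conjI ballI)
    show "class_fun (\<lambda>x. Re (v x))" using cv by (auto simp: class_fun_def)
    fix x assume x: "x \<in> carrier G"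
    have "integrable \<nu> (\<lambda>g. v (x \<otimes> g))" using x supp by (intro integrable_pmf_bounded[where B = Bv] Bv) auto
    then have "\<E> \<nu> (\<lambda>g. Re (v (x \<otimes> g))) = Re (\<E> \<nu> (\<lambda>g. v (x \<otimes> g)))" by simp
    then show "\<E> \<nu> (\<lambda>g. Re (v (x \<otimes> g))) = Re (v x) - \<psi> x"
      using main[OF x] by (simp add: f_def)
  qed
qed

end

subsection \<open>Characteristic functions of martingales\<close>

lemma norm_iexp_diff_le: "norm (iexp a - iexp b) \<le> \<bar>a - b\<bar>"
proof -
  have "iexp a - iexp b = iexp b * (iexp (a - b) - 1)"
    by (simp add: algebra_simps flip: exp_add)
  then have "norm (iexp a - iexp b) = norm (iexp (a - b) - 1)" by (simp add: norm_mult)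
  also have "\<dots> \<le> \<bar>a - b\<bar>" using iexp_approx1[of "a - b" 0] by simp
  finally show ?thesis .
qed

text \<open>The integrand is the remainder of the second-order expansion of a characteristic
  function. The minimum makes a finite second moment sufficient: it is dominated by the square and
  tends to zero pointwise.\<close>

lemma tendsto_truncated_moment:
  assumes i: "integrable M (\<lambda>x. (X x)\<^sup>2)" and [measurable]: "X \<in> borel_measurable M"
  shows "(\<lambda>n. integral\<^sup>L M (\<lambda>x. min (6 * (X x)\<^sup>2) ((1 / real (Suc n)) * \<bar>X x\<bar> ^ 3))) \<longlonglongrightarrow> 0"
proof -
  have "(\<lambda>n. integral\<^sup>L M (\<lambda>x. min (6 * (X x)\<^sup>2) ((1 / real (Suc n)) * \<bar>X x\<bar> ^ 3))) \<longlonglongrightarrow> integral\<^sup>L M (\<lambda>x. 0)"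
  proof (rule integral_dominated_convergence[where w = "\<lambda>x. 6 * (X x)\<^sup>2"])
    show "AE x in M. (\<lambda>n. min (6 * (X x)\<^sup>2) ((1 / real (Suc n)) * \<bar>X x\<bar> ^ 3)) \<longlonglongrightarrow> 0"
    proof (intro AE_I2)
      fix x
      have "(\<lambda>n. min (6 * (X x)\<^sup>2) ((1 / real (Suc n)) * \<bar>X x\<bar> ^ 3)) \<longlonglongrightarrow> min (6 * (X x)\<^sup>2) (0 * \<bar>X x\<bar> ^ 3)"
        by (intro tendsto_min tendsto_const tendsto_mult LIMSEQ_Suc lim_1_over_n)
      then show "(\<lambda>n. min (6 * (X x)\<^sup>2) ((1 / real (Suc n)) * \<bar>X x\<bar> ^ 3)) \<longlonglongrightarrow> 0" by simp
    qed
  qed (use i in auto)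
  then show ?thesis by simp
qed

text \<open>\<open>m\<close> is the slope of \<open>M\<close> along the lattice. Since
  \<open>M\<close> is affine in these directions, its increment by a fixed step depends on the coset
  only.\<close>

locale lattice_martingale = lattice_walk +
  fixes M :: "'a \<Rightarrow> real" and m :: "'c \<Rightarrow> real"
  assumes M_c: "i \<in> I \<Longrightarrow> x \<in> carrier G \<Longrightarrow> M (c i \<otimes> x) = M x + m i"
    and M_square: "x \<in> carrier G \<Longrightarrow> integrable \<nu> (\<lambda>g. (M (x \<otimes> g) - M x)\<^sup>2)"
    and M_harmonic: "x \<in> carrier G \<Longrightarrow> \<E> \<nu> (\<lambda>g. M (x \<otimes> g) - M x) = 0"
begin

abbreviation increment :: "'a \<Rightarrow> 'a \<Rightarrow> real" ("\<Delta>") where "\<Delta> x g \<equiv> M (x \<otimes> g) - M x"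

definition V :: "'a \<Rightarrow> real" where
  "V x = \<E> \<nu> (\<lambda>g. (\<Delta> x g)\<^sup>2)"

text \<open>The conditional variance averaged over the stationary distribution of the coset chain,
  that is, the asymptotic variance per step.\<close>

definition Q :: real where "Q = (\<Sum>t\<in>reps. V t) / card reps"

lemma increment_class_fun: "g \<in> carrier G \<Longrightarrow> class_fun (\<lambda>x. \<Delta> x g)"
  by (auto simp: class_fun_def m_assoc c_closed M_c)

lemma increment_rep:
  assumes "x \<in> carrier G" "g \<in> carrier G"
  shows "M (rep x \<otimes> g) - M (rep x) = \<Delta> x g"
  using class_fun_rep[OF increment_class_fun[OF assms(2)] assms(1)] by simp

lemma class_fun_V: "class_fun V"
  unfolding class_fun_def V_def
proof (intro ballI integral_cong_AE)
  fix i x assume i: "i \<in> I" "x \<in> carrier G"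
  show "AE g in \<nu>. (M (c i \<otimes> x \<otimes> g) - M (c i \<otimes> x))\<^sup>2 = (\<Delta> x g)\<^sup>2"
    using increment_class_fun i supp by (auto simp: AE_measure_pmf_iff class_fun_def)
qed auto

lemma V_nonneg: "V x \<ge> 0" by (simp add: V_def)

lemma Q_nonneg: "Q \<ge> 0" by (simp add: Q_def V_nonneg sum_nonneg)

definition Vmax :: real where "Vmax = (SOME B. B \<ge> 0 \<and> (\<forall>x\<in>carrier G. V x \<le> B))"

lemma Vmax: "Vmax \<ge> 0" "x \<in> carrier G \<Longrightarrow> V x \<le> Vmax"
proof -
  obtain B where B: "B \<ge> 0" "\<forall>x\<in>carrier G. norm (V x) \<le> B" using class_fun_bounded[OF class_fun_V] by auto
  have "B \<ge> 0 \<and> (\<forall>x\<in>carrier G. V x \<le> B)" using B by fastforce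
  from someI[of "\<lambda>B. B \<ge> 0 \<and> (\<forall>x\<in>carrier G. V x \<le> B)", OF this]
  show "Vmax \<ge> 0" "x \<in> carrier G \<Longrightarrow> V x \<le> Vmax" by (auto simp: Vmax_def)
qed

lemma integrable_increment:
  "x \<in> carrier G \<Longrightarrow> integrable \<nu> (\<lambda>g. \<Delta> x g)"
  by (rule measure_pmf.square_integrable_imp_integrable[OF _ M_square]) auto

lemma nn_second_moment:
  assumes x: "x \<in> carrier G"
  shows "(\<integral>\<^sup>+h. ennreal ((\<Delta> x h)\<^sup>2) \<partial>pw n) \<le> ennreal (real n * Vmax)"
proof (induction n)
  case 0
  then show ?case using x by simp
next
  case (Suc n)
  have inner: "(\<integral>\<^sup>+g. ennreal ((M (x \<otimes> (h \<otimes> g)) - M x)\<^sup>2) \<partial>\<nu>) = ennreal ((\<Delta> x h)\<^sup>2 + V (x \<otimes> h))"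
    if h: "h \<in> set_pmf (pw n)" for h
  proof -
    have hc: "h \<in> carrier G" "x \<otimes> h \<in> carrier G" using h x pw_carrier by auto
    define a where "a = \<Delta> x h"
    define D where "D = (\<lambda>g. M (x \<otimes> h \<otimes> g) - M (x \<otimes> h))"
    have i: "integrable \<nu> (\<lambda>g. (D g)\<^sup>2)" "integrable \<nu> D"
      using M_square[OF hc(2)] integrable_increment[OF hc(2)] by (simp_all add: D_def)
    have eq: "(M (x \<otimes> (h \<otimes> g)) - M x)\<^sup>2 = a\<^sup>2 + (2 * a * D g + (D g)\<^sup>2)" if "g \<in> carrier G" for g
      using that hc x by (simp add: a_def D_def m_assoc power2_eq_square algebra_simps)
    have "(\<integral>\<^sup>+g. ennreal ((M (x \<otimes> (h \<otimes> g)) - M x)\<^sup>2) \<partial>\<nu>) = (\<integral>\<^sup>+g. ennreal (a\<^sup>2 + (2 * a * D g + (D g)\<^sup>2)) \<partial>\<nu>)"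
      using supp by (intro nn_integral_cong_AE) (auto simp: AE_measure_pmf_iff eq)
    also have "\<dots> = ennreal (\<E> \<nu> (\<lambda>g. a\<^sup>2 + (2 * a * D g + (D g)\<^sup>2)))"
    proof (rule nn_integral_eq_integral)
      show "integrable \<nu> (\<lambda>g. a\<^sup>2 + (2 * a * D g + (D g)\<^sup>2))" using i by auto
      have "a\<^sup>2 + (2 * a * D g + (D g)\<^sup>2) = (a + D g)\<^sup>2" for g by (simp add: power2_sum)
      then show "AE g in \<nu>. 0 \<le> a\<^sup>2 + (2 * a * D g + (D g)\<^sup>2)" by simp
    qed
    also have "\<E> \<nu> (\<lambda>g. a\<^sup>2 + (2 * a * D g + (D g)\<^sup>2)) =
        a\<^sup>2 + (2 * a * \<E> \<nu> D + \<E> \<nu> (\<lambda>g. (D g)\<^sup>2))"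
      using i by simp
    also have "\<dots> = a\<^sup>2 + V (x \<otimes> h)"
      using M_harmonic[OF hc(2)] by (simp add: D_def V_def)
    finally show ?thesis by (simp add: a_def)
  qed
  have "(\<integral>\<^sup>+h. ennreal ((\<Delta> x h)\<^sup>2) \<partial>pw (Suc n)) =
      (\<integral>\<^sup>+h. \<integral>\<^sup>+g. ennreal ((M (x \<otimes> (h \<otimes> g)) - M x)\<^sup>2) \<partial>\<nu> \<partial>pw n)"
    by (simp add: nn_integral_convolution_pmf)
  also have "\<dots> = (\<integral>\<^sup>+h. ennreal ((\<Delta> x h)\<^sup>2 + V (x \<otimes> h)) \<partial>pw n)"
    by (intro nn_integral_cong_AE) (auto simp: AE_measure_pmf_iff inner)
  also have "\<dots> \<le> (\<integral>\<^sup>+h. ennreal ((\<Delta> x h)\<^sup>2) + ennreal Vmax \<partial>pw n)"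
    using x pw_carrier Vmax V_nonneg
    by (intro nn_integral_mono_AE) (auto simp: AE_measure_pmf_iff simp flip: ennreal_plus intro!: ennreal_leI)
  also have "\<dots> = (\<integral>\<^sup>+h. ennreal ((\<Delta> x h)\<^sup>2) \<partial>pw n) + ennreal Vmax"
    by (subst nn_integral_add) (auto simp: measure_pmf.emeasure_space_1[simplified])
  also have "\<dots> \<le> ennreal (real n * Vmax) + ennreal Vmax" using Suc by (intro add_mono) auto
  also have "\<dots> = ennreal (real (Suc n) * Vmax)"
    using Vmax(1) by (simp add: algebra_simps flip: ennreal_plus)
  finally show ?case .
qed

lemma second_moment:
  assumes x: "x \<in> carrier G"
  shows "integrable (pw n) (\<lambda>h. (\<Delta> x h)\<^sup>2)"
    and "\<E> (pw n) (\<lambda>h. (\<Delta> x h)\<^sup>2) \<le> real n * Vmax"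
proof -
  show i: "integrable (pw n) (\<lambda>h. (\<Delta> x h)\<^sup>2)"
    using nn_second_moment[OF x, of n] by (intro integrableI_nonneg) (auto intro: le_less_trans)
  have "ennreal (\<E> (pw n) (\<lambda>h. (\<Delta> x h)\<^sup>2)) \<le> ennreal (real n * Vmax)"
    using nn_second_moment[OF x, of n] nn_integral_eq_integral[OF i] by simp
  then show "\<E> (pw n) (\<lambda>h. (\<Delta> x h)\<^sup>2) \<le> real n * Vmax"
    using Vmax(1) by (simp add: ennreal_le_iff)
qed

lemma first_moment:
  assumes x: "x \<in> carrier G"
  shows "integrable (pw n) (\<lambda>h. \<Delta> x h)"
    and "\<E> (pw n) (\<lambda>h. \<bar>\<Delta> x h\<bar>) \<le> 1 + real n * Vmax"
proof -
  note i2 = second_moment[OF x, of n]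
  show i: "integrable (pw n) (\<lambda>h. \<Delta> x h)"
    by (rule measure_pmf.square_integrable_imp_integrable[OF _ i2(1)]) auto
  have "\<bar>a\<bar> \<le> 1 + a\<^sup>2" for a :: real
    using sum_squares_ge_zero[of "\<bar>a\<bar> - 1/2" 0] by (simp add: power2_eq_square algebra_simps)
  then have "\<E> (pw n) (\<lambda>h. \<bar>\<Delta> x h\<bar>) \<le>
      \<E> (pw n) (\<lambda>h. 1 + (\<Delta> x h)\<^sup>2)"
    using i i2 by (intro integral_mono) auto
  also have "\<dots> \<le> 1 + real n * Vmax" using i2 by simp
  finally show "\<E> (pw n) (\<lambda>h. \<bar>\<Delta> x h\<bar>) \<le> 1 + real n * Vmax" .
qed

lemma tail_bound:
  assumes a: "a > 0"
  shows "measure_pmf.prob (pw n) {h. \<bar>M h - M \<one>\<bar> \<ge> a} \<le> real n * Vmax / a\<^sup>2"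
proof -
  have eq: "AE h in pw n. (M (\<one> \<otimes> h) - M \<one>)\<^sup>2 = (M h - M \<one>)\<^sup>2"
    using pw_carrier by (auto simp: AE_measure_pmf_iff)
  have i: "integrable (pw n) (\<lambda>h. (M h - M \<one>)\<^sup>2)"
    using second_moment(1)[OF one_closed, of n] by (subst (asm) integrable_cong_AE[OF _ _ eq]) auto
  have e: "\<E> (pw n) (\<lambda>h. (M h - M \<one>)\<^sup>2) \<le> real n * Vmax"
    using second_moment(2)[OF one_closed, of n] by (subst (asm) integral_cong_AE[OF _ _ eq]) auto
  have "measure_pmf.prob (pw n) {h. \<bar>M h - M \<one>\<bar> \<ge> a} = \<E> (pw n) (indicator {h. \<bar>M h - M \<one>\<bar> \<ge> a})"
    by simp
  also have "\<dots> \<le> \<E> (pw n) (\<lambda>h. (M h - M \<one>)\<^sup>2 / a\<^sup>2)"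
  proof (rule integral_mono)
    show "integrable (pw n) (indicator {h. \<bar>M h - M \<one>\<bar> \<ge> a} :: _ \<Rightarrow> real)"
      by (rule integrable_pmf_bounded[where B = 1]) (auto simp: indicator_def)
    show "indicator {h. \<bar>M h - M \<one>\<bar> \<ge> a} h \<le> (M h - M \<one>)\<^sup>2 / a\<^sup>2" for h
      using a power_mono[of a "\<bar>M h - M \<one>\<bar>" 2] by (auto simp: indicator_def)
  qed (use i in auto)
  also have "\<dots> \<le> real n * Vmax / a\<^sup>2" using e by (simp add: divide_right_mono)
  finally show ?thesis .
qed

text \<open>The expansion is uniform in \<open>x\<close> because the law of the increment depends on
  the coset only, and there are finitely many cosets.\<close>

lemma increment_expansion:
  assumes e: "e > 0"
  shows "\<exists>\<delta>>0. \<forall>t. \<bar>t\<bar> < \<delta> \<longrightarrow> (\<forall>x\<in>carrier G.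
    norm (\<E> \<nu> (\<lambda>g. iexp (t * (\<Delta> x g))) - (1 - t\<^sup>2 * V x / 2)) \<le> t\<^sup>2 * e)"
proof -
  define R where "R = (\<lambda>t x. \<E> \<nu> (\<lambda>g. min (6 * (\<Delta> x g)\<^sup>2) (\<bar>t\<bar> * \<bar>\<Delta> x g\<bar> ^ 3)))"
  have Rint: "integrable \<nu> (\<lambda>g. min (6 * (\<Delta> x g)\<^sup>2) (\<bar>t\<bar> * \<bar>\<Delta> x g\<bar> ^ 3))"
    if "x \<in> carrier G" for t x
    by (rule Bochner_Integration.integrable_bound[of _ "\<lambda>g. 6 * (\<Delta> x g)\<^sup>2"])
       (use M_square[OF that] in auto)
  have "\<forall>y\<in>reps. \<exists>N. \<forall>n\<ge>N. R (1 / real (Suc n)) y < e"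
  proof
    fix y assume "y \<in> reps"
    then have "y \<in> carrier G" by (rule reps_carrier)
    from tendsto_truncated_moment[OF M_square[OF this]]
    have "(\<lambda>n. R (1 / real (Suc n)) y) \<longlonglongrightarrow> 0" by (simp add: R_def)
    then have "\<forall>\<^sub>F n in sequentially. R (1 / real (Suc n)) y < e" using e by (rule order_tendstoD)
    then show "\<exists>N. \<forall>n\<ge>N. R (1 / real (Suc n)) y < e" by (simp add: eventually_sequentially)
  qed
  then obtain N where N: "\<And>y n. y \<in> reps \<Longrightarrow> n \<ge> N y \<Longrightarrow> R (1 / real (Suc n)) y < e" by metis
  define K where "K = Max (insert 0 (N ` reps))"
  have K: "N y \<le> K" if "y \<in> reps" for y unfolding K_def using that finite_reps by (intro Max_ge) auto
  show ?thesis
  \<comment> \<open>The truncated moment increases with \<open>\<bar>t\<bar>\<close>, so its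
    smallness at the one point \<open>1 / Suc K\<close>, common to all cosets, covers every smaller
    \<open>t\<close>.\<close>
  proof (intro exI[of _ "1 / real (Suc K)"] conjI allI impI ballI)
    fix t x assume t: "\<bar>t\<bar> < 1 / real (Suc K)" and x: "x \<in> carrier G"
    define y where "y = rep x"
    have y: "y \<in> reps" "y \<in> carrier G" using x by (auto simp: y_def rep_in_reps rep_closed)
    define X where "X = (\<lambda>g. \<Delta> y g)"
    have ch: "norm (char (distr \<nu> borel X) t - (1 - t\<^sup>2 * V y / 2)) \<le> t\<^sup>2 / 6 * R t y"
      unfolding R_def X_def
    proof (rule prob_space.char_approx3'[OF measure_pmf.prob_space_axioms _ _ _ _ _ refl])
      show "measure_pmf.variance \<nu> (\<lambda>g. \<Delta> y g) = V y"
        using M_harmonic[OF y(2)] by (simp add: V_def)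
    qed (use M_square integrable_increment M_harmonic y in auto)
    have "char (distr \<nu> borel X) t = \<E> \<nu> (\<lambda>g. iexp (t * X g))"
      unfolding char_def by (subst integral_distr) auto
    also have "\<dots> = \<E> \<nu> (\<lambda>g. iexp (t * (\<Delta> x g)))"
    proof (intro integral_cong_AE)
      have "X g = \<Delta> x g" if "g \<in> set_pmf \<nu>" for g
        using increment_rep[OF x, of g] supp that by (auto simp: X_def y_def)
      then show "AE g in \<nu>. iexp (t * X g) = iexp (t * (\<Delta> x g))"
        unfolding AE_measure_pmf_iff by metis
    qed auto
    finally have c: "char (distr \<nu> borel X) t = \<E> \<nu> (\<lambda>g. iexp (t * (\<Delta> x g)))" .
    have "R t y \<le> R (1 / real (Suc K)) y"
      unfolding R_def using t y by (intro integral_mono Rint min.mono mult_right_mono) auto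
    also have "\<dots> < e" using N K y by simp
    finally have "t\<^sup>2 / 6 * R t y \<le> t\<^sup>2 / 6 * e" by (intro mult_left_mono) auto
    also have "\<dots> \<le> t\<^sup>2 * e" using e by (simp add: field_simps mult_right_mono)
    finally have le: "t\<^sup>2 / 6 * R t y \<le> t\<^sup>2 * e" .
    have "V y = V x" using class_fun_rep[OF class_fun_V x] by (simp add: y_def)
    then show "norm (\<E> \<nu> (\<lambda>g. iexp (t * (\<Delta> x g))) - (1 - t\<^sup>2 * V x / 2)) \<le> t\<^sup>2 * e"
      using ch c le by simp
  qed simp
qed

text \<open>The coset of the walk is asymptotically uniform and independent of the slowly varying phase:
  the last \<open>j\<close> steps equidistribute the coset and move \<open>M\<close> by a bounded amount only.\<close>

lemma twisted_mixing:
  fixes f :: "'a \<Rightarrow> complex"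
  assumes f: "class_fun f" "(\<Sum>t\<in>reps. f t) = 0" and e: "e > 0"
  shows "\<exists>K. \<exists>\<delta>>0. \<forall>k\<ge>K. \<forall>t. \<bar>t\<bar> < \<delta> \<longrightarrow> norm (\<E> (pw k) (\<lambda>x. iexp (t * M x) * f x)) \<le> e"
proof -
  obtain B where B: "B \<ge> 0" "\<And>x. x \<in> carrier G \<Longrightarrow> norm (f x) \<le> B" using class_fun_bounded[OF f(1)] by auto
  obtain k0 r where k0: "k0 > 0" and r: "r \<ge> 0" "r < 1"
    and mix: "\<forall>f B. class_fun f \<longrightarrow> (\<Sum>t\<in>reps. f t) = 0 \<longrightarrow> (\<forall>x\<in>carrier G. norm (f x) \<le> B) \<longrightarrow>
      (\<forall>n. \<forall>x\<in>carrier G. norm (U n f x) \<le> r ^ (n div k0) * B)"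
    using mixing by (elim exE conjE)
  have Uf: "norm (U n f x) \<le> r ^ (n div k0) * B" if "x \<in> carrier G" for n x
    using mix[rule_format, OF f B(2) that] by simp
  have "summable (\<lambda>n. r ^ (n div k0) * B)" using summable_power_div[OF r k0] by (rule summable_mult2)
  then have "(\<lambda>n. r ^ (n div k0) * B) \<longlonglongrightarrow> 0" by (rule summable_LIMSEQ_zero)
  then have "\<forall>\<^sub>F n in sequentially. r ^ (n div k0) * B < e / 2" using e by (intro order_tendstoD) auto
  then obtain j where j: "r ^ (j div k0) * B < e / 2" by (auto simp: eventually_sequentially)
  define D where "D = 1 + real j * Vmax"
  have D: "D > 0" using Vmax(1) by (simp add: D_def add_pos_nonneg)
  \<comment> \<open>\<open>j\<close> steps average \<open>f\<close> down to \<open>e / 2\<close>.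
    The second half of \<open>e\<close> pays for freezing the phase during these steps, whose mean
    displacement is at most \<open>D\<close>. \<open>B + 1\<close> excludes a division by
    zero.\<close>
  define \<delta> where "\<delta> = e / (2 * D * (B + 1))"
  have \<delta>: "\<delta> > 0" using e D B by (simp add: \<delta>_def)
  have "norm (\<E> (pw k) (\<lambda>x. iexp (t * M x) * f x)) \<le> e"
    if k: "k \<ge> j" and t: "\<bar>t\<bar> < \<delta>" for k t
  proof -
    have "pw k = convolution_pmf G (pw (k - j)) (pw j)" using convolution_power_add[OF supp, of "k - j" j] k by simp
    then have "\<E> (pw k) (\<lambda>x. iexp (t * M x) * f x) =
      \<E> (pw (k - j)) (\<lambda>x. \<E> (pw j) (\<lambda>h. iexp (t * M (x \<otimes> h)) * f (x \<otimes> h)))"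
      using pw_carrier B by (simp add: expectation_convolution_pmf[where B = B] norm_mult)
    also have "norm \<dots> \<le> e"
    proof (rule norm_expectation_le)
      fix x assume "x \<in> set_pmf (pw (k - j))"
      then have x: "x \<in> carrier G" by (rule pw_carrier)
      have fb: "norm (f (x \<otimes> h)) \<le> B" if "h \<in> set_pmf (pw j)" for h using B x pw_carrier[OF that] by auto
      \<comment> \<open>\<open>g\<close> is the error of freezing the phase at its value before the
        last \<open>j\<close> steps; what remains is a constant phase times
        \<open>U j f x\<close>.\<close>
      define g where "g = (\<lambda>h. (iexp (t * M (x \<otimes> h)) - iexp (t * M x)) * f (x \<otimes> h))"
      have ib: "norm (g h) \<le> B * \<bar>t\<bar> * \<bar>\<Delta> x h\<bar>"
        if "h \<in> set_pmf (pw j)" for h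
      proof -
        have "norm (g h) \<le> \<bar>t * M (x \<otimes> h) - t * M x\<bar> * B"
          unfolding g_def norm_mult by (rule mult_mono[OF norm_iexp_diff_le fb[OF that]]) auto
        then show ?thesis by (simp add: abs_mult ac_simps flip: right_diff_distrib)
      qed
      have i1: "integrable (pw j) g"
      proof (rule Bochner_Integration.integrable_bound)
        show "integrable (pw j) (\<lambda>h. B * \<bar>t\<bar> * \<bar>\<Delta> x h\<bar>)"
          using first_moment(1)[OF x, of j] by simp
        show "AE h in pw j. norm (g h)
          \<le> norm (B * \<bar>t\<bar> * \<bar>\<Delta> x h\<bar>)"
          unfolding AE_measure_pmf_iff
        proof
          fix h assume "h \<in> set_pmf (pw j)"
          from order.trans[OF ib[OF this] abs_ge_self]
          show "norm (g h)
            \<le> norm (B * \<bar>t\<bar> * \<bar>\<Delta> x h\<bar>)" unfolding real_norm_def .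
        qed
      qed simp
      have i2: "integrable (pw j) (\<lambda>h. iexp (t * M x) * f (x \<otimes> h))"
        using fb by (intro integrable_pmf_bounded[where B = B]) (auto simp: norm_mult)
      have "norm (\<E> (pw j) g)
          \<le> \<E> (pw j) (\<lambda>h. norm (g h))"
        by (rule integral_norm_bound)
      also have "\<dots> \<le> \<E> (pw j) (\<lambda>h. B * \<bar>t\<bar> * \<bar>\<Delta> x h\<bar>)"
        using first_moment(1)[OF x, of j] ib by (intro integral_mono_AE integrable_norm i1) (simp_all add: AE_measure_pmf_iff)
      also have "\<dots> \<le> B * \<bar>t\<bar> * D"
        using first_moment(2)[OF x, of j] B by (auto simp: D_def intro!: mult_left_mono)
      also have "\<dots> \<le> (B + 1) * \<delta> * D" using t B D by (intro mult_right_mono mult_mono) auto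
      also have "\<dots> = e / 2" using B D by (simp add: \<delta>_def)
      finally have b1: "norm (\<E> (pw j) g) \<le> e / 2" .
      have "\<E> (pw j) (\<lambda>h. iexp (t * M x) * f (x \<otimes> h)) = iexp (t * M x) * U j f x" by simp
      then have b2: "norm (\<E> (pw j) (\<lambda>h. iexp (t * M x) * f (x \<otimes> h))) \<le> e / 2"
        using Uf[OF x, of j] j by (simp add: norm_mult)
      have "\<E> (pw j) (\<lambda>h. iexp (t * M (x \<otimes> h)) * f (x \<otimes> h)) =
        \<E> (pw j) (\<lambda>h. g h + iexp (t * M x) * f (x \<otimes> h))"
        by (simp add: g_def algebra_simps)
      also have "\<dots> = \<E> (pw j) g
        + \<E> (pw j) (\<lambda>h. iexp (t * M x) * f (x \<otimes> h))"
        by (rule Bochner_Integration.integral_add[OF i1 i2])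
      also have "norm \<dots> \<le> e / 2 + e / 2" by (rule norm_triangle_le) (use b1 b2 in simp)
      finally show "norm (\<E> (pw j) (\<lambda>h. iexp (t * M (x \<otimes> h)) * f (x \<otimes> h))) \<le> e" by simp
    qed
    finally show ?thesis .
  qed
  then show ?thesis using \<delta> by blast
qed

definition \<Phi> :: "nat \<Rightarrow> real \<Rightarrow> complex" where
  "\<Phi> n t = \<E> (pw n) (\<lambda>x. iexp (t * M x))"

text \<open>The factor of one step involves the local variance \<open>V\<close>. Replacing it by its
  mean \<open>Q\<close> costs an expectation of a class function of mean zero, twisted by the phase;
  \<open>twisted_mixing\<close> makes it small at late times.\<close>

lemma \<Phi>_step:
  assumes e: "e > 0"
  shows "\<exists>\<delta>>0. \<forall>t n. \<bar>t\<bar> < \<delta> \<longrightarrow> norm (\<Phi> (Suc n) t - (1 - t\<^sup>2 * Q / 2) * \<Phi> n t) \<le>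
    t\<^sup>2 * (e + norm (\<E> (pw n) (\<lambda>x. iexp (t * M x) * of_real (Q - V x))))"
proof -
  obtain \<delta> where \<delta>: "\<delta> > 0" and ex: "\<forall>t. \<bar>t\<bar> < \<delta> \<longrightarrow> (\<forall>x\<in>carrier G.
    norm (\<E> \<nu> (\<lambda>g. iexp (t * (\<Delta> x g))) - (1 - t\<^sup>2 * V x / 2)) \<le> t\<^sup>2 * e)"
    using increment_expansion[OF e] by (elim exE conjE)
  have "norm (\<Phi> (Suc n) t - (1 - t\<^sup>2 * Q / 2) * \<Phi> n t) \<le>
    t\<^sup>2 * (e + norm (\<E> (pw n) (\<lambda>x. iexp (t * M x) * of_real (Q - V x))))" if t: "\<bar>t\<bar> < \<delta>" for t n
  proof -
    let ?E = "\<E> (pw n)"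
    define A where "A = (\<lambda>x. \<E> \<nu> (\<lambda>g. iexp (t * (\<Delta> x g))) - of_real (1 - t\<^sup>2 * V x / 2))"
    have A: "norm (A x) \<le> t\<^sup>2 * e" if "x \<in> carrier G" for x using ex t that by (simp add: A_def)
    have iA: "integrable (pw n) (\<lambda>x. iexp (t * M x) * A x)"
      by (rule integrable_pmf_bounded[where B = "t\<^sup>2 * e"]) (use A pw_carrier in \<open>auto simp: norm_mult\<close>)
    have iM: "integrable (pw n) (\<lambda>x. iexp (t * M x))"
      by (rule integrable_pmf_bounded[where B = 1]) auto
    have QV: "norm (complex_of_real (Q - V x)) \<le> Q + Vmax" if "x \<in> carrier G" for x
      using Vmax(2)[OF that] V_nonneg[of x] Q_nonneg unfolding norm_of_real by (simp add: abs_if)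
    have iV: "integrable (pw n) (\<lambda>x. iexp (t * M x) * of_real (Q - V x))"
      by (rule integrable_pmf_bounded[where B = "Q + Vmax"]) (use QV pw_carrier in \<open>auto simp: norm_mult\<close>)
    have "\<Phi> (Suc n) t = ?E (\<lambda>x. \<E> \<nu> (\<lambda>g. iexp (t * M (x \<otimes> g))))"
      unfolding \<Phi>_def by (simp add: expectation_convolution_pmf[where B = 1])
    also have "\<dots> = ?E (\<lambda>x. iexp (t * M x) * A x + ((1 - t\<^sup>2 * Q / 2) * iexp (t * M x) + (t\<^sup>2 / 2) * (iexp (t * M x) * of_real (Q - V x))))"
    proof (intro Bochner_Integration.integral_cong refl)
      fix x
      have "\<E> \<nu> (\<lambda>g. iexp (t * M (x \<otimes> g))) = \<E> \<nu> (\<lambda>g. iexp (t * M x) * iexp (t * (\<Delta> x g)))"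
        by (simp add: algebra_simps flip: exp_add)
      also have "\<dots> = iexp (t * M x) * \<E> \<nu> (\<lambda>g. iexp (t * (\<Delta> x g)))" by simp
      also have "\<dots> = iexp (t * M x) * (A x + of_real (1 - t\<^sup>2 * V x / 2))" by (simp add: A_def)
      finally show "\<E> \<nu> (\<lambda>g. iexp (t * M (x \<otimes> g))) =
        iexp (t * M x) * A x + ((1 - t\<^sup>2 * Q / 2) * iexp (t * M x) + (t\<^sup>2 / 2) * (iexp (t * M x) * of_real (Q - V x)))"
        by (simp add: algebra_simps)
    qed
    also have "\<dots> = ?E (\<lambda>x. iexp (t * M x) * A x) + ((1 - t\<^sup>2 * Q / 2) * \<Phi> n t + (t\<^sup>2 / 2) * ?E (\<lambda>x. iexp (t * M x) * of_real (Q - V x)))"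
      unfolding \<Phi>_def using iA iM iV by simp
    finally have "\<Phi> (Suc n) t - (1 - t\<^sup>2 * Q / 2) * \<Phi> n t =
      ?E (\<lambda>x. iexp (t * M x) * A x) + (t\<^sup>2 / 2) * ?E (\<lambda>x. iexp (t * M x) * of_real (Q - V x))" by simp
    also have "norm \<dots> \<le> t\<^sup>2 * e + t\<^sup>2 * norm (?E (\<lambda>x. iexp (t * M x) * of_real (Q - V x)))"
    proof (intro norm_triangle_le add_mono)
      show "norm (?E (\<lambda>x. iexp (t * M x) * A x)) \<le> t\<^sup>2 * e"
        by (rule norm_expectation_le) (use A pw_carrier in \<open>auto simp: norm_mult\<close>)
      show "norm ((t\<^sup>2 / 2) * ?E (\<lambda>x. iexp (t * M x) * of_real (Q - V x))) \<le> t\<^sup>2 * norm (?E (\<lambda>x. iexp (t * M x) * of_real (Q - V x)))"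
        unfolding norm_mult by (intro mult_right_mono) (auto simp: norm_divide norm_power)
    qed
    finally show ?thesis by (simp add: algebra_simps)
  qed
  then show ?thesis using \<delta> by blast
qed

text \<open>An error of \<open>t\<^sup>2\<close> times a small number at each of \<open>n\<close>
  steps stays small because \<open>n * t\<^sup>2\<close> is bounded. The early steps, before the
  cosets have mixed, are bounded in number and contribute a multiple of
  \<open>t\<^sup>2\<close>.\<close>

lemma \<Phi>_tendsto:
  assumes t0: "t \<longlonglongrightarrow> 0" and s: "\<And>n. real n * (t n)\<^sup>2 \<le> s"
  shows "(\<lambda>n. \<Phi> n (t n) - of_real ((1 - (t n)\<^sup>2 * Q / 2) ^ n)) \<longlonglongrightarrow> 0"
proof (rule LIMSEQ_I)
  fix e :: real assume e: "0 < e"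
  have s0: "s \<ge> 0" using s[of 0] by simp
  define e' where "e' = e / (4 * (s + 1))"
  have e': "e' > 0" using e s0 by (simp add: e'_def)
  define f where "f = (\<lambda>x. complex_of_real (Q - V x))"
  have cf: "class_fun f" using class_fun_V by (auto simp: f_def class_fun_def)
  have sf: "(\<Sum>y\<in>reps. f y) = 0"
    using card_reps by (simp add: f_def sum_subtractf Q_def flip: of_real_sum of_real_diff)
  obtain \<delta>1 where \<delta>1: "\<delta>1 > 0" and st: "\<forall>t n. \<bar>t\<bar> < \<delta>1 \<longrightarrow> norm (\<Phi> (Suc n) t - (1 - t\<^sup>2 * Q / 2) * \<Phi> n t) \<le>
    t\<^sup>2 * (e' + norm (\<E> (pw n) (\<lambda>x. iexp (t * M x) * f x)))"
    using \<Phi>_step[OF e'] unfolding f_def by (elim exE conjE)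
  obtain K \<delta>2 where \<delta>2: "\<delta>2 > 0" and mx: "\<forall>k\<ge>K. \<forall>t. \<bar>t\<bar> < \<delta>2 \<longrightarrow> norm (\<E> (pw k) (\<lambda>x. iexp (t * M x) * f x)) \<le> e'"
    using twisted_mixing[OF cf sf e'] by (elim exE conjE)
  define B where "B = Q + Vmax"
  have B0: "B \<ge> 0" using Q_nonneg Vmax(1) by (simp add: B_def)
  have Bf: "norm (f x) \<le> B" if "x \<in> carrier G" for x
    using Vmax(2)[OF that] V_nonneg[of x] Q_nonneg unfolding f_def norm_of_real B_def by (simp add: abs_if)
  have b: "norm (\<E> (pw k) (\<lambda>x. iexp (t * M x) * f x)) \<le> B" for k t
    by (rule norm_expectation_le) (use Bf pw_carrier in \<open>auto simp: norm_mult\<close>)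
  \<comment> \<open>The first term is the error at time 0. \<open>min n K\<close> counts the steps
    before mixing, where only the trivial bound \<open>B\<close> holds. The condition
    \<open>\<tau>\<^sup>2 * Q \<le> 2\<close> puts the factor of one step into
    \<open>[0, 1]\<close>, so earlier errors do not grow.\<close>
  have bound: "norm (\<Phi> n \<tau> - of_real ((1 - \<tau>\<^sup>2 * Q / 2) ^ n)) \<le> \<bar>\<tau>\<bar> * \<bar>M \<one>\<bar> + (real n * (\<tau>\<^sup>2 * (2 * e')) + real (min n K) * (\<tau>\<^sup>2 * B))"
    if \<tau>: "\<bar>\<tau>\<bar> < \<delta>1" "\<bar>\<tau>\<bar> < \<delta>2" "\<tau>\<^sup>2 * Q \<le> 2" for n \<tau>
  proof (induction n)
    case 0
    have "norm (\<Phi> 0 \<tau> - 1) \<le> \<bar>\<tau> * M \<one>\<bar>" using norm_iexp_diff_le[of "\<tau> * M \<one>" 0] by (simp add: \<Phi>_def)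
    then show ?case using B0 by (simp add: abs_mult add_increasing2)
  next
    case (Suc n)
    let ?a = "1 - \<tau>\<^sup>2 * Q / 2"
    let ?r = "of_nat :: nat \<Rightarrow> real"
    have a: "0 \<le> ?a" "?a \<le> 1" using \<tau> Q_nonneg by auto
    have d: "norm (\<Phi> (Suc n) \<tau> - ?a * \<Phi> n \<tau>) \<le> \<tau>\<^sup>2 * (e' + norm (\<E> (pw n) (\<lambda>x. iexp (\<tau> * M x) * f x)))"
      using st \<tau> by auto
    define X where "X = \<bar>\<tau>\<bar> * \<bar>M \<one>\<bar>"
    have ge: "norm (?a * (\<Phi> n \<tau> - of_real (?a ^ n))) \<le> norm (\<Phi> n \<tau> - of_real (?a ^ n))"
    proof -
      have "norm (?a * (\<Phi> n \<tau> - of_real (?a ^ n))) = \<bar>?a\<bar> * norm (\<Phi> n \<tau> - of_real (?a ^ n))"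
        by (simp only: norm_mult norm_of_real)
      also have "\<dots> \<le> 1 * norm (\<Phi> n \<tau> - of_real (?a ^ n))" using a by (intro mult_right_mono) auto
      finally show ?thesis by simp
    qed
    have eq: "\<Phi> (Suc n) \<tau> - of_real (?a ^ Suc n) = (\<Phi> (Suc n) \<tau> - ?a * \<Phi> n \<tau>) + ?a * (\<Phi> n \<tau> - of_real (?a ^ n))"
      by (simp add: algebra_simps)
    have tri: "norm (\<Phi> (Suc n) \<tau> - of_real (?a ^ Suc n)) \<le> norm (\<Phi> (Suc n) \<tau> - ?a * \<Phi> n \<tau>) + norm (\<Phi> n \<tau> - of_real (?a ^ n))"
      unfolding eq by (rule order.trans[OF norm_triangle_ineq add_left_mono[OF ge]])
    have step: "norm (\<Phi> (Suc n) \<tau> - ?a * \<Phi> n \<tau>) \<le> \<tau>\<^sup>2 * (2 * e') + (real (min (Suc n) K) - real (min n K)) * (\<tau>\<^sup>2 * B)"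
    proof (cases "n < K")
      case True
      have "\<tau>\<^sup>2 * (e' + norm (\<E> (pw n) (\<lambda>x. iexp (\<tau> * M x) * f x))) \<le> \<tau>\<^sup>2 * (2 * e' + B)"
        using b[of n \<tau>] e' by (intro mult_left_mono) auto
      then show ?thesis using d True by (simp add: algebra_simps)
    next
      case False
      have "\<tau>\<^sup>2 * (e' + norm (\<E> (pw n) (\<lambda>x. iexp (\<tau> * M x) * f x))) \<le> \<tau>\<^sup>2 * (2 * e')"
        using mx \<tau> False by (intro mult_left_mono) auto
      then show ?thesis using d False by simp
    qed
    show ?case
      by (rule order.trans[OF order.trans[OF tri add_mono[OF step Suc]]]) (simp add: algebra_simps)
  qed
  have "(\<lambda>n. \<bar>t n\<bar>) \<longlonglongrightarrow> 0" using t0 by (simp add: tendsto_rabs_zero_iff)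
  moreover have "0 < min \<delta>1 \<delta>2" using \<delta>1 \<delta>2 by simp
  ultimately have ev1: "\<forall>\<^sub>F n in sequentially. \<bar>t n\<bar> < min \<delta>1 \<delta>2" by (rule order_tendstoD)
  have "(\<lambda>n. (t n)\<^sup>2 * Q) \<longlonglongrightarrow> 0\<^sup>2 * Q" by (intro tendsto_intros t0)
  then have ev2: "\<forall>\<^sub>F n in sequentially. (t n)\<^sup>2 * Q < 2" by (rule order_tendstoD) simp
  have "(\<lambda>n. \<bar>t n\<bar> * \<bar>M \<one>\<bar> + real K * ((t n)\<^sup>2 * B)) \<longlonglongrightarrow> \<bar>0\<bar> * \<bar>M \<one>\<bar> + real K * (0\<^sup>2 * B)"
    by (intro tendsto_intros t0)
  then have ev3: "\<forall>\<^sub>F n in sequentially. \<bar>t n\<bar> * \<bar>M \<one>\<bar> + real K * ((t n)\<^sup>2 * B) < e / 2"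
    by (rule order_tendstoD) (use e in simp)
  have "\<forall>\<^sub>F n in sequentially. norm (\<Phi> n (t n) - of_real ((1 - (t n)\<^sup>2 * Q / 2) ^ n)) < e"
    using ev1 ev2 ev3
  proof eventually_elim
    case (elim n)
    have "norm (\<Phi> n (t n) - of_real ((1 - (t n)\<^sup>2 * Q / 2) ^ n)) \<le>
      \<bar>t n\<bar> * \<bar>M \<one>\<bar> + (real n * ((t n)\<^sup>2 * (2 * e')) + real (min n K) * ((t n)\<^sup>2 * B))"
      using elim by (intro bound) auto
    also have "real n * ((t n)\<^sup>2 * (2 * e')) = (real n * (t n)\<^sup>2) * (2 * e')" by simp
    also have "\<dots> \<le> s * (2 * e')" using s e' by (intro mult_right_mono) auto
    also have "\<dots> \<le> e / 2" using s0 e by (simp add: e'_def field_simps)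
    also have "real (min n K) * ((t n)\<^sup>2 * B) \<le> real K * ((t n)\<^sup>2 * B)" using B0 by (intro mult_right_mono) auto
    finally show ?case using elim by simp
  qed
  then show "\<exists>no. \<forall>n\<ge>no. norm (\<Phi> n (t n) - of_real ((1 - (t n)\<^sup>2 * Q / 2) ^ n) - 0) < e"
    by (simp add: eventually_sequentially)
qed

text \<open>The indicator of a coset is \<open>1 / card reps\<close> plus a class function of mean
  zero. The latter is removed by \<open>twisted_mixing\<close> and the former leaves
  \<open>\<Phi>\<close>.\<close>

lemma class_characteristic_tendsto:
  assumes t0: "t \<longlonglongrightarrow> 0" and s: "\<And>n. real n * (t n)\<^sup>2 \<le> s" and w: "w \<in> reps"
  shows "(\<lambda>n. \<E> (pw n) (\<lambda>x. iexp (t n * M x) * (if rep x = w then 1 else 0))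
    - of_real ((1 - (t n)\<^sup>2 * Q / 2) ^ n / card reps)) \<longlonglongrightarrow> 0"
proof -
  define f where "f = (\<lambda>x. (if rep x = w then 1 else 0) - complex_of_real (1 / real (card reps)))"
  have cf: "class_fun f" by (auto simp: f_def class_fun_def rep_c)
  have "(\<Sum>y\<in>reps. f y) = (\<Sum>y\<in>reps. if y = w then 1 else 0) - 1"
    using card_reps by (simp add: f_def sum_subtractf rep_reps cong: sum.cong)
  then have sf: "(\<Sum>y\<in>reps. f y) = 0" using w finite_reps by simp
  have 1: "(\<lambda>n. \<E> (pw n) (\<lambda>x. iexp (t n * M x) * f x)) \<longlonglongrightarrow> 0"
  proof (rule LIMSEQ_I)
    fix e :: real assume e: "0 < e"
    then have "e / 2 > 0" by simp
    from twisted_mixing[OF cf sf this] obtain K \<delta> where \<delta>: "\<delta> > 0"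
      and mx: "\<forall>k\<ge>K. \<forall>t. \<bar>t\<bar> < \<delta> \<longrightarrow> norm (\<E> (pw k) (\<lambda>x. iexp (t * M x) * f x)) \<le> e / 2"
      by (elim exE conjE)
    have "(\<lambda>n. \<bar>t n\<bar>) \<longlonglongrightarrow> 0" using t0 by (simp add: tendsto_rabs_zero_iff)
    then have "\<forall>\<^sub>F n in sequentially. \<bar>t n\<bar> < \<delta>" using \<delta> by (rule order_tendstoD)
    then have "\<forall>\<^sub>F n in sequentially. norm (\<E> (pw n) (\<lambda>x. iexp (t n * M x) * f x)) < e"
      using eventually_ge_at_top[of K]
    proof eventually_elim
      case (elim n)
      then have "norm (\<E> (pw n) (\<lambda>x. iexp (t n * M x) * f x)) \<le> e / 2" using mx by blast
      then show ?case using e by simp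
    qed
    then show "\<exists>no. \<forall>n\<ge>no. norm (\<E> (pw n) (\<lambda>x. iexp (t n * M x) * f x) - 0) < e"
      by (simp add: eventually_sequentially)
  qed
  have split: "\<E> (pw n) (\<lambda>x. iexp (t n * M x) * (if rep x = w then 1 else 0)) =
    \<E> (pw n) (\<lambda>x. iexp (t n * M x) * f x) + of_real (1 / real (card reps)) * \<Phi> n (t n)" for n
  proof -
    have i: "integrable (pw n) (\<lambda>x. iexp (t n * M x) * f x)"
      by (rule integrable_pmf_bounded[where B = "norm (1 - complex_of_real (1 / real (card reps))) + norm (complex_of_real (1 / real (card reps)))"])
         (auto simp: norm_mult f_def)
    have j: "integrable (pw n) (\<lambda>x. of_real (1 / real (card reps)) * iexp (t n * M x))"
      by (rule integrable_pmf_bounded[where B = "norm (complex_of_real (1 / real (card reps)))"]) (simp add: norm_mult norm_divide)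
    have "\<E> (pw n) (\<lambda>x. iexp (t n * M x) * (if rep x = w then 1 else 0)) =
      \<E> (pw n) (\<lambda>x. iexp (t n * M x) * f x + of_real (1 / real (card reps)) * iexp (t n * M x))"
      by (intro Bochner_Integration.integral_cong) (auto simp: f_def algebra_simps)
    also have "\<dots> = \<E> (pw n) (\<lambda>x. iexp (t n * M x) * f x)
      + \<E> (pw n) (\<lambda>x. of_real (1 / real (card reps)) * iexp (t n * M x))"
      by (rule Bochner_Integration.integral_add[OF i j])
    finally show ?thesis by (simp add: \<Phi>_def)
  qed
  have "(\<lambda>n. \<E> (pw n) (\<lambda>x. iexp (t n * M x) * f x)
    + of_real (1 / real (card reps)) * (\<Phi> n (t n) - of_real ((1 - (t n)\<^sup>2 * Q / 2) ^ n))) \<longlonglongrightarrow> 0 + of_real (1 / real (card reps)) * 0"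
    by (intro tendsto_intros 1 \<Phi>_tendsto[OF t0 s])
  then show ?thesis unfolding split by (simp add: algebra_simps)
qed

end

subsection \<open>Fourier inversion on a finite torus\<close>

text \<open>The side is odd so that the frequencies form a range symmetric about 0, with
  \<open>\<bar>k / L\<bar> \<le> 1/2\<close>. The Gaussian bound on the coefficients relies on
  this.\<close>

lemma sum_int_iexp_orthogonal:
  fixes l :: nat and d :: int
  defines "L \<equiv> 2 * int l + 1"
  shows "(\<Sum>k\<in>{-int l..int l}. iexp (2 * pi / L * (k * d))) = (if L dvd d then of_int L else 0)"
proof -
  define z where "z = iexp (2 * pi * d / L)"
  have L: "L > 0" by (simp add: L_def)
  have shift: "(\<Sum>k\<in>{-int l..int l}. iexp (2 * pi / L * (k * d))) = (\<Sum>j<nat L. iexp (2 * pi / L * ((int j - int l) * d)))"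
    by (rule sum.reindex_bij_witness[of _ "\<lambda>j. int j - int l" "\<lambda>k. nat (k + int l)"]) (auto simp: L_def)
  also have "\<dots> = (\<Sum>j<nat L. iexp (2 * pi / L * (- int l * d)) * z ^ j)"
    by (intro sum.cong refl) (auto simp: z_def exp_of_nat_mult[symmetric] exp_add[symmetric] algebra_simps diff_divide_distrib)
  also have "\<dots> = iexp (2 * pi / L * (- int l * d)) * (\<Sum>j<nat L. z ^ j)" by (simp add: sum_distrib_left)
  finally have main: "(\<Sum>k\<in>{-int l..int l}. iexp (2 * pi / L * (k * d))) = iexp (2 * pi / L * (- int l * d)) * (\<Sum>j<nat L. z ^ j)" .
  show ?thesis
  proof (cases "L dvd d")
    case True
    then obtain q where q: "d = L * q" by auto
    have "iexp (2 * pi / L * (k * d)) = 1" for k :: int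
    proof -
      have "2 * pi / L * (k * d) = 2 * pi * of_int (k * q)" using L q by simp
      then show ?thesis by (metis exp_integer_2pi Ints_of_int mult.commute mult.assoc of_real_mult of_real_numeral of_real_of_int_eq)
    qed
    then show ?thesis using True L by (simp add: L_def)
  next
    case False
    have "z ^ nat L = 1"
    proof -
      have "z ^ nat L = iexp (2 * pi * d)" using L by (simp add: z_def exp_of_nat_mult[symmetric])
      also have "\<dots> = 1" using exp_integer_2pi[of "of_int d"] by (simp add: mult_ac)
      finally show ?thesis .
    qed
    moreover have "z \<noteq> 1"
    proof
      assume "z = 1"
      then obtain n :: int where "2 * pi * d / L = of_int (2 * n) * pi" unfolding z_def by (auto simp: exp_eq_1)
      then have "real_of_int d = real_of_int (n * L)" using L by (simp add: field_simps)
      then have "d = n * L" by linarith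
      then show False using False by simp
    qed
    ultimately have "(\<Sum>j<nat L. z ^ j) = 0" by (simp add: geometric_sum)
    then show ?thesis using main False by simp
  qed
qed

text \<open>By the half-angle formula it suffices that \<open>\<bar>x\<bar> \<le> sin t\<close> for
  \<open>t = pi * \<bar>x\<bar> / 2\<close>. The cubic Taylor bound yields
  \<open>5/6 * t \<le> sin t\<close>, and \<open>pi > 3\<close> yields
  \<open>3/2 * \<bar>x\<bar> \<le> t\<close>.\<close>

lemma one_minus_cos_ge:
  assumes "\<bar>x\<bar> \<le> 1/2"
  shows "2 * x\<^sup>2 \<le> 1 - cos (pi * x)"
proof -
  define t where "t = pi * \<bar>x\<bar> / 2"
  have t: "0 \<le> t" "3 / 2 * \<bar>x\<bar> \<le> t" "t \<le> 1"
  proof -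
    show "0 \<le> t" by (simp add: t_def)
    show "3 / 2 * \<bar>x\<bar> \<le> t" using mult_right_mono[of 3 pi "\<bar>x\<bar>"] pi_gt3 by (simp add: t_def)
    have "pi * \<bar>x\<bar> \<le> 4 * (1/2)" using assms pi_less_4 by (intro mult_mono) auto
    then show "t \<le> 1" by (simp add: t_def)
  qed
  have "\<bar>sin t - (\<Sum>m<3. sin_coeff m * t ^ m)\<bar> \<le> inverse (fact 3) * \<bar>t\<bar> ^ 3" by (rule Maclaurin_sin_bound)
  then have "\<bar>sin t - t\<bar> \<le> t ^ 3 / 6" using t by (simp add: eval_nat_numeral sin_coeff_def)
  from abs_le_D2[OF this] have "t - t ^ 3 / 6 \<le> sin t" by linarith
  moreover have "t ^ 3 \<le> t" using t power_decreasing[of 1 3 t] by simp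
  ultimately have "5 / 6 * t \<le> sin t" by simp
  then have "\<bar>x\<bar> \<le> sin t" using t by simp
  then have "\<bar>x\<bar>\<^sup>2 \<le> (sin t)\<^sup>2" by (intro power_mono) auto
  moreover have "cos (pi * x) = 1 - 2 * (sin t)\<^sup>2"
    using cos_double_sin[of t] by (cases "x \<ge> 0") (simp_all add: t_def)
  ultimately show ?thesis by simp
qed

lemma norm_one_plus_iexp_le:
  assumes "\<bar>x\<bar> \<le> 1/2"
  shows "norm (1 + iexp (2 * pi * x)) \<le> 2 - 4 * x\<^sup>2"
proof -
  have "1 + iexp (2 * pi * x) = iexp (pi * x) * (iexp (pi * x) + iexp (- (pi * x)))"
    by (simp add: algebra_simps flip: exp_add)
  also have "iexp (pi * x) + iexp (- (pi * x)) = of_real (2 * cos (pi * x))"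
    by (simp add: complex_eq_iff exp_eq_polar Re_exp Im_exp)
  finally have "norm (1 + iexp (2 * pi * x)) = \<bar>2 * cos (pi * x)\<bar>" by (simp only: norm_mult norm_exp_i_times norm_of_real)
  moreover have "\<bar>pi * x\<bar> \<le> pi / 2" using mult_left_mono[OF assms, of pi] by (simp add: abs_mult)
  from abs_le_D1[OF this] abs_le_D2[OF this] have "cos (pi * x) \<ge> 0" by (intro cos_ge_zero) auto
  ultimately show ?thesis using one_minus_cos_ge[OF assms] by simp
qed

lemma abs_summable_exp_square_int:
  assumes "\<beta> > 0"
  shows "Infinite_Set_Sum.abs_summable_on (\<lambda>k::int. exp (- \<beta> * (real_of_int k)\<^sup>2)) UNIV"
proof -
  have s: "summable (\<lambda>n::nat. exp (- \<beta> * (real n)\<^sup>2))"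
  proof (rule summable_comparison_test')
    show "summable (\<lambda>n. exp (- \<beta>) ^ n)" using assms by (intro summable_geometric) simp
    fix n :: nat
    have "real n \<le> (real n)\<^sup>2" by (cases n) (auto simp: power2_eq_square)
    then have "exp (- \<beta> * (real n)\<^sup>2) \<le> exp (- \<beta> * real n)" using assms by simp
    then show "norm (exp (- \<beta> * (real n)\<^sup>2)) \<le> exp (- \<beta>) ^ n" by (simp add: mult.commute flip: exp_of_nat_mult)
  qed
  have 1: "Infinite_Set_Sum.abs_summable_on (\<lambda>k::int. exp (- \<beta> * (real_of_int k)\<^sup>2)) (range int)"
    by (rule abs_summable_on_reindex) (use s in \<open>simp add: abs_summable_on_nat_iff'\<close>)
  have 2: "Infinite_Set_Sum.abs_summable_on (\<lambda>k::int. exp (- \<beta> * (real_of_int k)\<^sup>2)) (range (\<lambda>n. - int n))"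
    by (rule abs_summable_on_reindex) (use s in \<open>simp add: abs_summable_on_nat_iff'\<close>)
  have "(UNIV :: int set) = range int \<union> range (\<lambda>n. - int n)"
  proof (rule UNIV_eq_I)
    show "k \<in> range int \<union> range (\<lambda>n. - int n)" for k by (cases k rule: int_cases2) auto
  qed
  then show ?thesis using abs_summable_on_union[OF 1 2] by simp
qed

lemma (in lattice_group) finite_box: "finite {x\<in>carrier G. \<forall>i\<in>I. \<bar>P i x\<bar> \<le> int l}"
  and card_box: "w \<in> reps \<Longrightarrow> card {x\<in>carrier G. rep x = w \<and> (\<forall>i\<in>I. \<bar>P i x\<bar> \<le> int l)} \<le> (2 * l + 1) ^ card I"
proof -
  define f where "f = (\<lambda>x. restrict (\<lambda>i. P i x) I)"
  have fb: "f x \<in> PiE I (\<lambda>_. {-int l..int l})" if "\<forall>i\<in>I. \<bar>P i x\<bar> \<le> int l" for x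
    using that by (auto simp: f_def abs_le_iff)
  have eq: "x = y" if "x \<in> carrier G" "y \<in> carrier G" "rep x = rep y" "f x = f y" for x y
  proof (rule coord_inj[OF that(1-3)])
    fix i assume "i \<in> I"
    then show "P i x = P i y" using that(4) by (metis f_def restrict_apply')
  qed
  have fin: "finite (PiE I (\<lambda>_. {-int l..int l}))" by (intro finite_PiE finite_I) auto
  show "finite {x\<in>carrier G. \<forall>i\<in>I. \<bar>P i x\<bar> \<le> int l}"
  proof (rule finite_imageD)
    show "finite ((\<lambda>x. (rep x, f x)) ` {x\<in>carrier G. \<forall>i\<in>I. \<bar>P i x\<bar> \<le> int l})"
      by (rule finite_subset[of _ "reps \<times> PiE I (\<lambda>_. {-int l..int l})"])
         (use fin finite_reps fb rep_in_reps in \<open>auto simp del: PiE_iff\<close>)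
    show "inj_on (\<lambda>x. (rep x, f x)) {x\<in>carrier G. \<forall>i\<in>I. \<bar>P i x\<bar> \<le> int l}"
      using eq by (intro inj_onI) auto
  qed
  show "card {x\<in>carrier G. rep x = w \<and> (\<forall>i\<in>I. \<bar>P i x\<bar> \<le> int l)} \<le> (2 * l + 1) ^ card I" if "w \<in> reps"
  proof -
    have "card {x\<in>carrier G. rep x = w \<and> (\<forall>i\<in>I. \<bar>P i x\<bar> \<le> int l)} \<le> card (PiE I (\<lambda>_. {-int l..int l}))"
      by (rule card_inj_on_le[where f = f]) (use fin fb eq in \<open>auto intro!: inj_onI simp del: PiE_iff\<close>)
    also have "\<dots> = card {-int l..int l} ^ card I" using finite_I by (simp add: card_PiE)
    also have "card {-int l..int l} = 2 * l + 1" by (simp add: nat_eq_iff)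
    finally show ?thesis .
  qed
qed

context lattice_group
begin

abbreviation box :: "nat \<Rightarrow> ('i \<Rightarrow> int) set" where "box l \<equiv> PiE I (\<lambda>_. {-int l..int l})"

abbreviation outside :: "nat \<Rightarrow> 'a set" where "outside l \<equiv> {x. \<exists>i\<in>I. \<bar>P i x\<bar> > int l}"

abbreviation sqnorm :: "('i \<Rightarrow> int) \<Rightarrow> real" where "sqnorm k \<equiv> (\<Sum>i\<in>I. (real_of_int (k i))\<^sup>2)"

text \<open>A character of the torus of side \<open>2 * l + 1\<close>, carried to one coset by the
  coordinates and extended by zero. It is not a character of \<open>G\<close>; it is only multiplied
  by scalars under the \<open>c i\<close>.\<close>

definition character :: "nat \<Rightarrow> ('i \<Rightarrow> int) \<Rightarrow> 'a \<Rightarrow> 'a \<Rightarrow> complex" where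
  "character l k w x = iexp (2 * pi / (2 * real l + 1) * real_of_int (\<Sum>i\<in>I. k i * P i x)) * (if rep x = w then 1 else 0)"

lemma norm_character: "norm (character l k w x) \<le> 1"
  by (simp add: character_def norm_mult)

text \<open>The part of \<open>A\<close> in the box is made periodic. The resulting function
  \<open>H\<close> has values 0 and 1 and agrees with the indicator of \<open>A\<close> on the box,
  so the replacement costs only the mass outside. \<open>H\<close> is a finite combination of
  characters.\<close>

lemma finite_fourier_bound:
  fixes p q :: "'a pmf"
  assumes p: "set_pmf p \<subseteq> carrier G" and q: "set_pmf q \<subseteq> carrier G"
  shows "\<bar>measure_pmf.prob p A - measure_pmf.prob q A\<bar> \<le>
    (\<Sum>w\<in>reps. \<Sum>k\<in>box l.
      norm (\<E> p (character l k w) - \<E> q (character l k w)))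
    + measure_pmf.prob p (outside l) + measure_pmf.prob q (outside l)"
proof -
  define L where "L = 2 * int l + 1"
  have Lr: "2 * real l + 1 = real_of_int L" and L0: "L > 0" by (simp_all add: L_def)
  define K where "K = box l"
  have finK: "finite K" unfolding K_def by (intro finite_PiE finite_I) auto
  define X where "X = {x\<in>carrier G. \<forall>i\<in>I. \<bar>P i x\<bar> \<le> int l}"
  have finX: "finite X" unfolding X_def by (rule finite_box)
  \<comment> \<open>\<open>F y\<close> is the indicator of \<open>y\<close> modulo \<open>L\<close>, and \<open>L\<close> exceeds the diameter of \<open>X\<close>\<close>
  define F where "F = (\<lambda>y x. if rep x = rep y \<and> (\<forall>i\<in>I. L dvd P i x - P i y) then 1 else 0 :: complex)"
  define C where "C = (\<lambda>y k. iexp (- (2 * pi / L * real_of_int (\<Sum>i\<in>I. k i * P i y))) / of_int L ^ card I)"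
  have normC: "norm (C y k) = 1 / real_of_int L ^ card I" for y k
    using L0 by (simp add: C_def norm_divide norm_power)
  have F: "F y x = (\<Sum>k\<in>K. C y k * character l k (rep y) x)" for x y
  proof (cases "rep x = rep y")
    case True
    have "(\<Sum>k\<in>K. C y k * character l k (rep y) x) = (\<Sum>k\<in>K. (\<Prod>i\<in>I. iexp (2 * pi / L * (k i * (P i x - P i y))))) / of_int L ^ card I"
      unfolding sum_divide_distrib
    proof (intro sum.cong refl)
      fix k assume "k \<in> K"
      have "(\<Prod>i\<in>I. iexp (2 * pi / L * (k i * (P i x - P i y)))) = exp (\<Sum>i\<in>I. \<i> * complex_of_real (2 * pi / L * (k i * (P i x - P i y))))"
        using finite_I by (simp add: exp_sum)
      also have "(\<Sum>i\<in>I. \<i> * complex_of_real (2 * pi / L * (k i * (P i x - P i y)))) =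
          \<i> * complex_of_real (- (2 * pi / L * real_of_int (\<Sum>i\<in>I. k i * P i y))) + \<i> * complex_of_real (2 * pi / L * real_of_int (\<Sum>i\<in>I. k i * P i x))"
        by (simp add: sum_distrib_left sum_subtractf algebra_simps sum_divide_distrib flip: sum.distrib)
      finally show "C y k * character l k (rep y) x = (\<Prod>i\<in>I. iexp (2 * pi / L * (k i * (P i x - P i y)))) / of_int L ^ card I"
        using True unfolding C_def character_def Lr exp_add by simp
    qed
    also have "(\<Sum>k\<in>K. (\<Prod>i\<in>I. iexp (2 * pi / L * (k i * (P i x - P i y))))) =
        (\<Prod>i\<in>I. \<Sum>k\<in>{-int l..int l}. iexp (2 * pi / L * (k * (P i x - P i y))))"
      unfolding K_def using finite_I by (subst prod_sum_PiE) auto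
    also have "\<dots> = (\<Prod>i\<in>I. if L dvd P i x - P i y then of_int L else 0)"
      unfolding L_def by (intro prod.cong refl) (rule sum_int_iexp_orthogonal)
    also have "\<dots> = (if \<forall>i\<in>I. L dvd P i x - P i y then of_int L ^ card I else 0)"
      using finite_I by (auto simp: prod_constant)
    finally show ?thesis using True L0 by (simp add: F_def)
  qed (simp add: F_def character_def)
  have uniq: "y = y'" if "y \<in> X" "y' \<in> X" "F y x \<noteq> 0" "F y' x \<noteq> 0" for x y y'
  proof (rule coord_inj)
    show "y \<in> carrier G" "y' \<in> carrier G" using that by (auto simp: X_def)
    show "rep y = rep y'" using that by (auto simp: F_def split: if_splits)
    fix i assume i: "i \<in> I"
    have "L dvd P i x - P i y'" "L dvd P i x - P i y" using that i by (auto simp: F_def split: if_splits)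
    then have "L dvd (P i x - P i y') - (P i x - P i y)" by (rule dvd_diff)
    moreover have "\<bar>(P i x - P i y') - (P i x - P i y)\<bar> < L" using that i by (force simp: X_def L_def abs_le_iff)
    ultimately show "P i y = P i y'" using zdvd_not_zless[of "\<bar>(P i x - P i y') - (P i x - P i y)\<bar>" L]
      by (cases "P i y = P i y'") auto
  qed
  define H where "H = (\<lambda>x. \<Sum>y\<in>A \<inter> X. F y x)"
  have H01: "H x = 0 \<or> H x = 1" for x
  proof (cases "\<exists>y\<in>A\<inter>X. F y x \<noteq> 0")
    case True
    then obtain y where y: "y \<in> A \<inter> X" "F y x \<noteq> 0" by blast
    have "H x = (\<Sum>z\<in>{y}. F z x)" unfolding H_def
      by (rule sum.mono_neutral_right) (use y uniq finX in auto)
    then show ?thesis using y by (auto simp: F_def split: if_splits)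
  qed (simp add: H_def)
  have HX: "H x = indicator A x" if x: "x \<in> X" for x
  proof -
    have Fx: "F x x = 1" by (simp add: F_def)
    have "H x = (\<Sum>z\<in>A \<inter> X. if z = x then 1 else 0)" unfolding H_def
    proof (intro sum.cong refl)
      fix z assume "z \<in> A \<inter> X"
      then show "F z x = (if z = x then 1 else 0)" using uniq[of z x x] Fx x by (auto simp: F_def)
    qed
    then show ?thesis using x finX by (auto simp: indicator_def)
  qed
  have iH: "integrable (measure_pmf r) H" for r
    by (rule integrable_pmf_bounded[where B = 1]) (use H01 in \<open>metis norm_one norm_zero order_refl zero_le_one\<close>)
  have close: "norm (of_real (measure_pmf.prob r A) - \<E> r H) \<le> measure_pmf.prob r (outside l)"
    if r: "set_pmf r \<subseteq> carrier G" for r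
  proof -
    have iA: "integrable (measure_pmf r) (\<lambda>x. indicator A x :: complex)"
      by (rule integrable_pmf_bounded[where B = 1]) (auto simp: indicator_def)
    have "complex_of_real (measure_pmf.prob r A) = \<E> r (\<lambda>x. complex_of_real (indicator A x))" by simp
    also have "\<dots> = \<E> r (\<lambda>x. indicator A x)"
      by (intro Bochner_Integration.integral_cong) (auto simp: indicator_def)
    finally have "of_real (measure_pmf.prob r A) - \<E> r H = \<E> r (\<lambda>x. indicator A x - H x)"
      using iA iH by simp
    also have "norm \<dots> \<le> \<E> r (\<lambda>x. norm (indicator A x - H x))" by (rule integral_norm_bound)
    also have "\<dots> \<le> \<E> r (indicator (outside l))"
    proof (rule integral_mono_AE)
      show "AE x in r. norm (indicator A x - H x) \<le> (indicator (outside l) x :: real)"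
        unfolding AE_measure_pmf_iff
      proof
        fix x assume "x \<in> set_pmf r"
        then have x: "x \<in> carrier G" using r by auto
        show "norm (indicator A x - H x) \<le> (indicator (outside l) x :: real)"
        proof (cases "x \<in> X")
          case True then show ?thesis using HX by simp
        next
          case False
          then have "x \<in> (outside l)" using x by (auto simp: X_def not_le)
          then show ?thesis using H01[of x] by (auto simp: indicator_def)
        qed
      qed
      show "integrable r (\<lambda>x. norm (indicator A x - H x))" using iA iH by (intro integrable_norm Bochner_Integration.integrable_diff)
    qed (rule integrable_pmf_bounded[where B = 1], auto simp: indicator_def)
    finally show ?thesis by simp
  qed
  have EF: "\<E> r (F y) = (\<Sum>k\<in>K. C y k * \<E> r (character l k (rep y)))" for r y
  proof -
    have i: "integrable (measure_pmf r) (character l k (rep y))" for k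
      by (rule integrable_pmf_bounded[where B = 1]) (rule norm_character)
    have "F y = (\<lambda>x. \<Sum>k\<in>K. C y k * character l k (rep y) x)" using F by auto
    then show ?thesis using i by simp
  qed
  define S where "S = (\<lambda>w. \<Sum>k\<in>K. norm (\<E> p (character l k w) - \<E> q (character l k w)))"
  have S0: "S w \<ge> 0" for w by (simp add: S_def sum_nonneg)
  have dF: "norm (\<E> p (F y) - \<E> q (F y)) \<le> S (rep y) / real_of_int L ^ card I" for y
  proof -
    define D where "D = (\<lambda>k. \<E> p (character l k (rep y)) - \<E> q (character l k (rep y)))"
    have eq: "\<E> p (F y) - \<E> q (F y) = (\<Sum>k\<in>K. C y k * D k)"
      by (simp add: EF right_diff_distrib sum_subtractf D_def)
    have "norm (\<Sum>k\<in>K. C y k * D k) \<le> (\<Sum>k\<in>K. norm (C y k * D k))" by (rule norm_sum)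
    also have "\<dots> = S (rep y) / real_of_int L ^ card I"
      by (simp add: norm_mult normC S_def sum_divide_distrib D_def)
    finally show ?thesis unfolding eq .
  qed
  have iF: "integrable (measure_pmf r) (F y)" for r y
    by (rule integrable_pmf_bounded[where B = 1]) (auto simp: F_def)
  have eqH: "\<E> p H - \<E> q H = (\<Sum>y\<in>A\<inter>X. \<E> p (F y) - \<E> q (F y))"
    unfolding H_def using iF by (simp add: sum_subtractf)
  have "norm (\<E> p H - \<E> q H) \<le> (\<Sum>y\<in>A\<inter>X. S (rep y) / real_of_int L ^ card I)"
    unfolding eqH by (rule order.trans[OF norm_sum]) (intro sum_mono dF)
  also have "\<dots> \<le> (\<Sum>y\<in>X. S (rep y) / real_of_int L ^ card I)"
    using finX S0 L0 by (intro sum_mono2) auto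
  also have "\<dots> = (\<Sum>w\<in>reps. \<Sum>y\<in>{y\<in>X. rep y = w}. S (rep y) / real_of_int L ^ card I)"
    by (rule sum.group[symmetric]) (use finX finite_reps rep_in_reps in \<open>auto simp: X_def\<close>)
  also have "\<dots> = (\<Sum>w\<in>reps. real (card {y\<in>X. rep y = w}) * (S w / real_of_int L ^ card I))"
    by (intro sum.cong refl) simp
  \<comment> \<open>A coset has at most \<open>L ^ card I\<close> points in the box, which offsets
    the normalization \<open>1 / L ^ card I\<close> of the Fourier coefficients: summing over points
    loses nothing.\<close>
  also have "\<dots> \<le> (\<Sum>w\<in>reps. S w)"
  proof (rule sum_mono)
    fix w assume w: "w \<in> reps"
    have "{y\<in>X. rep y = w} = {x\<in>carrier G. rep x = w \<and> (\<forall>i\<in>I. \<bar>P i x\<bar> \<le> int l)}" by (auto simp: X_def)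
    then have "card {y\<in>X. rep y = w} \<le> (2 * l + 1) ^ card I" using card_box[OF w] by simp
    then have "real (card {y\<in>X. rep y = w}) \<le> real ((2 * l + 1) ^ card I)" by (rule of_nat_mono)
    also have "\<dots> = real_of_int L ^ card I" by (simp add: L_def algebra_simps)
    finally have "real (card {y\<in>X. rep y = w}) * (S w / real_of_int L ^ card I) \<le> real_of_int L ^ card I * (S w / real_of_int L ^ card I)"
      using S0 L0 by (intro mult_right_mono) auto
    then show "real (card {y\<in>X. rep y = w}) * (S w / real_of_int L ^ card I) \<le> S w" using L0 by simp
  qed
  finally have d: "norm (\<E> p H - \<E> q H) \<le> (\<Sum>w\<in>reps. S w)" .
  have "\<bar>measure_pmf.prob p A - measure_pmf.prob q A\<bar> = norm (complex_of_real (measure_pmf.prob p A) - of_real (measure_pmf.prob q A))"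
    by (simp flip: of_real_diff)
  also have "\<dots> = norm ((of_real (measure_pmf.prob p A) - \<E> p H) +
      ((\<E> p H - \<E> q H) - (of_real (measure_pmf.prob q A) - \<E> q H)))"
    by simp
  also have "\<dots> \<le> measure_pmf.prob p (outside l) + ((\<Sum>w\<in>reps. S w) + measure_pmf.prob q (outside l))"
    by (intro norm_triangle_le add_mono close p q order.trans[OF norm_triangle_ineq4] d)
  finally show ?thesis by (simp add: S_def K_def)
qed

end

text \<open>With \<open>x = k i / L\<close> the ratio \<open>\<zeta> i\<close> is
  \<open>iexp (2 * pi * x)\<close>, so \<open>K\<close> steps contract by at least
  \<open>1 - 4 * p * x\<^sup>2\<close>, which is at most
  \<open>exp (- 4 * p * x\<^sup>2)\<close>.\<close>

lemma (in lattice_walk) character_domination: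
  "\<exists>K>0. \<exists>a>0. \<forall>l w n. \<forall>k\<in>box l.
     norm (\<E> (pw n) (character l k w)) \<le>
       exp (- (a * real (n div K) / (2 * real l + 1)\<^sup>2) * sqnorm k)"
proof -
  obtain K p where K: "K > 0" and p: "p > 0" "p \<le> 1/2"
    and contr: "\<forall>f B \<zeta> i. i \<in> I \<longrightarrow> (\<forall>x\<in>carrier G. norm (f x) \<le> B) \<longrightarrow>
     (\<forall>j\<in>I. \<forall>x\<in>carrier G. f (c j \<otimes> x) = \<zeta> j * f x) \<longrightarrow>
     (\<forall>n. \<forall>x\<in>carrier G. norm (U n f x) \<le> (1 - p * (2 - norm (1 + \<zeta> i))) ^ (n div K) * B)"
    using character_contraction by (elim exE conjE)
  \<comment> \<open>The divisor passes from the largest coordinate to the sum over all of them;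
    \<open>max 1\<close> keeps \<open>a\<close> positive when \<open>I\<close> is empty.\<close>
  define a where "a = 4 * p / max 1 (real (card I))"
  have a: "a > 0" using p by (simp add: a_def)
  have "norm (\<E> (pw n) (character l k w)) \<le>
       exp (- (a * real (n div K) / (2 * real l + 1)\<^sup>2) * sqnorm k)"
    if k: "k \<in> box l" for l w n k
  proof (cases "I = {}")
    case True
    then show ?thesis using norm_character[of l k w] by (simp add: norm_expectation_le)
  next
    case False
    define L where "L = 2 * real l + 1"
    have L: "L > 0" by (simp add: L_def)
    define \<zeta> where "\<zeta> = (\<lambda>j. iexp (2 * pi / L * k j))"
    have eqv: "character l k w (c j \<otimes> x) = \<zeta> j * character l k w x" if "j \<in> I" "x \<in> carrier G" for j x
    proof -
      have "(\<Sum>i\<in>I. k i * P i (c j \<otimes> x)) = (\<Sum>i\<in>I. k i * P i x + (if i = j then k j else 0))"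
        using that by (intro sum.cong refl) (auto simp: P_c algebra_simps)
      also have "\<dots> = (\<Sum>i\<in>I. k i * P i x) + k j"
        using that finite_I by (simp add: sum.distrib)
      finally have "(\<Sum>i\<in>I. k i * P i (c j \<otimes> x)) = (\<Sum>i\<in>I. k i * P i x) + k j" .
      then show ?thesis using that
        by (simp add: character_def \<zeta>_def rep_c L_def ring_distribs add_divide_distrib exp_add)
    qed
    have one: "norm (\<E> (pw n) (character l k w)) \<le> exp (- (4 * p * real (n div K) / L\<^sup>2) * (real_of_int (k i))\<^sup>2)"
      if i: "i \<in> I" for i
    proof -
      define x where "x = real_of_int (k i) / L"
      have "\<bar>real_of_int (k i)\<bar> \<le> real l" using PiE_mem[OF k i] by (auto simp: abs_le_iff)
      then have x: "\<bar>x\<bar> \<le> 1/2" by (simp add: x_def L_def field_simps)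
      have "\<zeta> i = iexp (2 * pi * x)" by (simp add: \<zeta>_def x_def)
      then have z: "norm (1 + \<zeta> i) \<le> 2 - 4 * x\<^sup>2" using norm_one_plus_iexp_le[OF x] by simp
      have "\<E> (pw n) (character l k w) = U n (character l k w) \<one>"
        by (intro integral_cong_AE) (auto simp: AE_measure_pmf_iff pw_carrier)
      then have "norm (\<E> (pw n) (character l k w)) \<le> (1 - p * (2 - norm (1 + \<zeta> i))) ^ (n div K) * 1"
        using contr i eqv norm_character one_closed by presburger
      also have "\<dots> \<le> (1 - p * (4 * x\<^sup>2)) ^ (n div K) * 1"
      proof (intro mult_right_mono power_mono)
        have "p * (2 - norm (1 + \<zeta> i)) \<le> 1/2 * 2" using p order_trans[OF z, of 2] by (intro mult_mono) auto
        then show "0 \<le> 1 - p * (2 - norm (1 + \<zeta> i))" by simp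
        have "p * (4 * x\<^sup>2) \<le> p * (2 - norm (1 + \<zeta> i))" using p z by (intro mult_left_mono) auto
        then show "1 - p * (2 - norm (1 + \<zeta> i)) \<le> 1 - p * (4 * x\<^sup>2)" by simp
      qed auto
      also have "\<dots> \<le> exp (- (p * (4 * x\<^sup>2))) ^ (n div K) * 1"
      proof (intro mult_right_mono power_mono)
        have "x\<^sup>2 \<le> (1/2)\<^sup>2" using power_mono[OF x, of 2] by simp
        then have "p * (4 * x\<^sup>2) \<le> 1/2 * 1" using p by (intro mult_mono) (auto simp: power2_eq_square)
        then show "0 \<le> 1 - p * (4 * x\<^sup>2)" by simp
        show "1 - p * (4 * x\<^sup>2) \<le> exp (- (p * (4 * x\<^sup>2)))" using exp_ge_add_one_self[of "- (p * (4 * x\<^sup>2))"] by simp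
      qed auto
      also have "\<dots> = exp (- (4 * p * real (n div K) / L\<^sup>2) * (real_of_int (k i))\<^sup>2)"
        by (simp add: exp_of_nat_mult[symmetric] x_def power_divide algebra_simps)
      finally show ?thesis .
    qed
    \<comment> \<open>each coordinate yields one exponential bound; the largest coordinate dominates the average\<close>
    define N where "N = Max ((\<lambda>i. (real_of_int (k i))\<^sup>2) ` I)"
    have "N \<in> (\<lambda>i. (real_of_int (k i))\<^sup>2) ` I" unfolding N_def using finite_I False by (intro Max_in) auto
    then obtain i where i: "i \<in> I" "N = (real_of_int (k i))\<^sup>2" by auto
    have "sqnorm k \<le> (\<Sum>i\<in>I. N)"
      unfolding N_def using finite_I by (intro sum_mono Max_ge) auto
    also have "\<dots> = max 1 (real (card I)) * N" using False finite_I by (simp add: card_gt_0_iff Suc_le_eq max_def)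
    finally have "a * sqnorm k \<le> a * (max 1 (real (card I)) * N)"
      using a by (intro mult_left_mono) auto
    also have "\<dots> = 4 * p * N" by (simp add: a_def)
    finally have "a * sqnorm k * (real (n div K) / L\<^sup>2) \<le> 4 * p * N * (real (n div K) / L\<^sup>2)"
      by (intro mult_right_mono) auto
    then have "exp (- (4 * p * real (n div K) / L\<^sup>2) * (real_of_int (k i))\<^sup>2) \<le>
        exp (- (a * real (n div K) / L\<^sup>2) * sqnorm k)"
      by (simp add: i(2) mult_ac)
    then show ?thesis using one[OF i(1)] unfolding L_def by linarith
  qed
  then show ?thesis using K a by blast
qed

text \<open>A martingale whose slope is the \<open>i\<close>-th unit vector differs from
  \<open>P i\<close> by a class function, hence by a bounded amount, and obeys Chebyshev's
  inequality.\<close>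

lemma (in lattice_martingale) coordinate_tail:
  assumes i: "i \<in> I" and m: "\<And>j. j \<in> I \<Longrightarrow> m j = (if i = j then 1 else 0)"
  shows "\<exists>C\<ge>0. \<exists>l0. \<forall>l\<ge>l0. \<forall>n. measure_pmf.prob (pw n) {x. \<bar>P i x\<bar> > int l} \<le> C * real n / (real l)\<^sup>2"
proof -
  have "class_fun (\<lambda>x. real_of_int (P i x) - M x)"
    using i m by (auto simp: class_fun_def P_c M_c)
  then obtain D where D: "D \<ge> 0" "\<And>x. x \<in> carrier G \<Longrightarrow> \<bar>real_of_int (P i x) - M x\<bar> \<le> D"
    using class_fun_bounded by fastforce
  \<comment> \<open>From \<open>l0\<close> on, the discrepancy and the starting value together
    amount to at most \<open>l / 2\<close>; \<open>Suc\<close> makes \<open>l\<close>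
    positive.\<close>
  define l0 where "l0 = Suc (nat \<lceil>2 * (D + \<bar>M \<one>\<bar>)\<rceil>)"
  have "measure_pmf.prob (pw n) {x. \<bar>P i x\<bar> > int l} \<le> 4 * Vmax * real n / (real l)\<^sup>2" if l: "l \<ge> l0" for l n
  proof -
    have l': "2 * (D + \<bar>M \<one>\<bar>) \<le> real l" "real l > 0"
      using l real_nat_ceiling_ge[of "2 * (D + \<bar>M \<one>\<bar>)"] by (auto simp: l0_def)
    have "measure_pmf.prob (pw n) {x. \<bar>P i x\<bar> > int l} \<le> measure_pmf.prob (pw n) {h. \<bar>M h - M \<one>\<bar> \<ge> real l / 2}"
    proof (intro measure_pmf.finite_measure_mono_AE)
      show "AE x in pw n. x \<in> {x. \<bar>P i x\<bar> > int l} \<longrightarrow> x \<in> {h. \<bar>M h - M \<one>\<bar> \<ge> real l / 2}"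
        unfolding AE_measure_pmf_iff
      proof (intro ballI impI)
        fix x assume x: "x \<in> set_pmf (pw n)" "x \<in> {x. \<bar>P i x\<bar> > int l}"
        have "\<bar>real_of_int (P i x) - M x\<bar> \<le> D" using D(2) pw_carrier x(1) by blast
        moreover have "\<bar>real_of_int (P i x)\<bar> > real l" using x(2)
          by (metis mem_Collect_eq of_int_abs of_int_less_iff of_int_of_nat_eq)
        ultimately have "real l - D - \<bar>M \<one>\<bar> \<le> \<bar>M x - M \<one>\<bar>" by linarith
        then show "x \<in> {h. \<bar>M h - M \<one>\<bar> \<ge> real l / 2}" using l' by auto
      qed
    qed simp
    also have "\<dots> \<le> real n * Vmax / (real l / 2)\<^sup>2" using l' by (intro tail_bound) auto
    also have "\<dots> = 4 * Vmax * real n / (real l)\<^sup>2" by (simp add: power_divide)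
    finally show ?thesis .
  qed
  then show ?thesis using Vmax(1) by (intro exI[of _ "4 * Vmax"]) auto
qed

text \<open>If \<open>M\<close> has slope \<open>k\<close>, the linear form with coefficients
  \<open>k\<close> minus \<open>M\<close> is constant on the coset \<open>w\<close>. It contributes
  a phase of modulus 1 that does not involve the walk and so drops out when two walks are
  compared.\<close>

lemma (in lattice_martingale) character_eq:
  assumes k: "\<And>i. i \<in> I \<Longrightarrow> m i = real_of_int (k i)" and w: "w \<in> reps"
  shows "\<E> (pw n) (character l k w) =
    iexp (2 * pi / (2 * real l + 1) * (real_of_int (\<Sum>i\<in>I. k i * P i w) - M w)) *
      \<E> (pw n) (\<lambda>x. iexp (2 * pi / (2 * real l + 1) * M x) * (if rep x = w then 1 else 0))"
proof -
  define f where "f = (\<lambda>x. real_of_int (\<Sum>i\<in>I. k i * P i x) - M x)"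
  have cf: "class_fun f"
    unfolding class_fun_def
  proof (intro ballI)
    fix j x assume j: "j \<in> I" "x \<in> carrier G"
    have "(\<Sum>i\<in>I. k i * P i (c j \<otimes> x)) = (\<Sum>i\<in>I. k i * P i x + (if i = j then k j else 0))"
      using j by (intro sum.cong refl) (auto simp: P_c algebra_simps)
    also have "\<dots> = (\<Sum>i\<in>I. k i * P i x) + k j" using j finite_I by (simp add: sum.distrib)
    finally have "(\<Sum>i\<in>I. k i * P i (c j \<otimes> x)) = (\<Sum>i\<in>I. k i * P i x) + k j" .
    then show "f (c j \<otimes> x) = f x"
      by (simp only: f_def M_c[OF j] k[OF j(1)] of_int_add)
  qed
  have f: "f x = f w" if "x \<in> carrier G" "rep x = w" for x
    using class_fun_rep[OF cf that(1)] that(2) by simp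
  let ?t = "2 * pi / (2 * real l + 1)"
  have "\<E> (pw n) (character l k w) =
    \<E> (pw n) (\<lambda>x. iexp (?t * f w) * (iexp (?t * M x) * (if rep x = w then 1 else 0)))"
  proof (intro integral_cong_AE)
    show "AE x in pw n. character l k w x = iexp (?t * f w) * (iexp (?t * M x) * (if rep x = w then 1 else 0))"
      unfolding AE_measure_pmf_iff
    proof
      fix x assume "x \<in> set_pmf (pw n)"
      then have x: "x \<in> carrier G" by (rule pw_carrier)
      show "character l k w x = iexp (?t * f w) * (iexp (?t * M x) * (if rep x = w then 1 else 0))"
      proof (cases "rep x = w")
        case True
        have "real_of_int (\<Sum>i\<in>I. k i * P i x) = f w + M x" using f[OF x True] by (simp add: f_def)
        then have "?t * real_of_int (\<Sum>i\<in>I. k i * P i x) = ?t * f w + ?t * M x" by (simp only: distrib_left)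
        then have "iexp (?t * real_of_int (\<Sum>i\<in>I. k i * P i x)) = iexp (?t * f w) * iexp (?t * M x)"
          by (simp only: of_real_add distrib_left exp_add)
        then show ?thesis using True by (simp only: character_def if_True mult_1_right refl)
      qed (simp add: character_def)
    qed
  qed auto
  then show ?thesis by (simp add: f_def)
qed

section \<open>Total variation distance of two walks with the same limiting variances\<close>

lemma tv_dist_le:
  assumes "\<And>A. \<bar>measure_pmf.prob p A - measure_pmf.prob q A\<bar> \<le> e"
  shows "tv_dist p q \<le> e"
  unfolding tv_dist_def using assms by (intro cSUP_least) auto

lemma prob_diff_le_tv_dist: "\<bar>measure_pmf.prob p A - measure_pmf.prob q A\<bar> \<le> tv_dist p q"
  unfolding tv_dist_def
proof (rule cSUP_upper)
  have "\<bar>measure_pmf.prob p A - measure_pmf.prob q A\<bar> \<le> 1" for A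
    using measure_pmf.prob_le_1[of p A] measure_pmf.prob_le_1[of q A]
      measure_nonneg[of "measure_pmf p" A] measure_nonneg[of "measure_pmf q" A] by linarith
  then show "bdd_above (range (\<lambda>A. \<bar>measure_pmf.prob p A - measure_pmf.prob q A\<bar>))" by (intro bdd_aboveI2)
qed simp

lemma tv_dist_nonneg: "0 \<le> tv_dist p q"
  using prob_diff_le_tv_dist[of p "{}" q] by simp

text \<open>The dominating function. The extensional functions on \<open>I\<close> contain the
  frequency boxes of all sizes, so sums over growing boxes become integrals over one space.\<close>

lemma integrable_exp_square_PiE:
  assumes "finite I" "\<beta> > 0"
  shows "integrable (count_space (PiE I (\<lambda>_. UNIV))) (\<lambda>k. exp (- \<beta> * (\<Sum>i\<in>I. (real_of_int (k i))\<^sup>2)))"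
proof -
  have "Infinite_Set_Sum.abs_summable_on (\<lambda>k. \<Prod>i\<in>I. exp (- \<beta> * (real_of_int (k i))\<^sup>2)) (PiE I (\<lambda>_. UNIV))"
    using assms by (intro abs_summable_on_prod_PiE abs_summable_exp_square_int) auto
  moreover have "(\<Prod>i\<in>I. exp (- \<beta> * (real_of_int (k i))\<^sup>2)) = exp (- \<beta> * (\<Sum>i\<in>I. (real_of_int (k i))\<^sup>2))" for k :: "'a \<Rightarrow> int"
    using assms by (simp add: exp_sum sum_distrib_left)
  ultimately show ?thesis by (simp add: abs_summable_on_def)
qed

lemma div_ge_half:
  assumes "0 < (K::nat)" "K \<le> n"
  shows "real n / (2 * real K) \<le> real (n div K)"
proof -
  have "n < K * (n div K) + K"
    using mod_less_divisor[OF assms(1), of n] mult_div_mod_eq[of K n] by linarith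
  moreover have "K \<le> K * (n div K)"
    using div_le_mono[OF assms(2), of K] assms(1) by simp
  ultimately have "n \<le> 2 * (K * (n div K))" by linarith
  then have "real n \<le> 2 * (real K * real (n div K))" by (simp flip: of_nat_mult)
  then show ?thesis using assms(1) by (simp add: field_simps)
qed

context lattice_group
begin

text \<open>For a side of order \<open>sqrt n\<close> the exponent in
  \<open>character_domination\<close> is bounded below, so the Gaussian bound no longer depends on
  \<open>n\<close>.\<close>

lemma walk_character_uniform_bound:
  assumes "lattice_walk G I c P rep \<nu>" and R: "R > 0"
  shows "\<exists>\<beta>>0. \<exists>N. \<forall>n\<ge>N. \<forall>w. \<forall>k\<in>box (nat \<lceil>R * sqrt n\<rceil>).
     norm (\<E> (convolution_power G \<nu> n) (character (nat \<lceil>R * sqrt n\<rceil>) k w)) \<le>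
       exp (- \<beta> * sqnorm k)"
proof -
  interpret lattice_walk G I c P rep \<nu> by fact
  obtain K a where K: "K > 0" and a: "a > 0" and dom: "\<forall>l w n. \<forall>k\<in>box l.
     norm (\<E> (pw n) (character l k w)) \<le>
       exp (- (a * real (n div K) / (2 * real l + 1)\<^sup>2) * sqnorm k)"
    using character_domination by (elim exE conjE)
  \<comment> \<open>\<open>2 * K\<close> comes from \<open>n div K \<ge> n / (2 * K)\<close> and
    \<open>2 * R + 3\<close> from \<open>2 * l + 1 \<le> (2 * R + 3) * sqrt n\<close>.\<close>
  define \<beta> where "\<beta> = a / (2 * K * (2 * R + 3)\<^sup>2)"
  have \<beta>: "\<beta> > 0" using a K R by (simp add: \<beta>_def)
  have "norm (\<E> (pw n) (character l k w)) \<le> exp (- \<beta> * sqnorm k)"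
    if n: "n \<ge> K" and l: "l = nat \<lceil>R * sqrt n\<rceil>" and k: "k \<in> box l" for n w l k
  proof -
    have n1: "n \<ge> 1" using n K by simp
    have "real l \<le> R * sqrt n + 1" unfolding l using R by (simp add: of_nat_nat)
    then have "2 * real l + 1 \<le> 2 * R * sqrt n + 3 * 1" by simp
    also have "\<dots> \<le> 2 * R * sqrt n + 3 * sqrt n" using n1 by (intro add_left_mono mult_left_mono) auto
    finally have "(2 * real l + 1)\<^sup>2 \<le> ((2 * R + 3) * sqrt n)\<^sup>2" by (intro power_mono) (auto simp: algebra_simps)
    also have "\<dots> = (2 * R + 3)\<^sup>2 * n" by (simp add: power_mult_distrib)
    finally have L: "(2 * real l + 1)\<^sup>2 \<le> (2 * R + 3)\<^sup>2 * n" .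
    have "\<beta> = a * (real n / (2 * real K)) / ((2 * R + 3)\<^sup>2 * n)" using n1 by (simp add: \<beta>_def)
    also have "\<dots> \<le> a * real (n div K) / ((2 * R + 3)\<^sup>2 * n)"
      using div_ge_half[OF K n] a by (intro divide_right_mono mult_left_mono) auto
    also have "\<dots> \<le> a * real (n div K) / (2 * real l + 1)\<^sup>2"
      using L a n1 R by (intro divide_left_mono) (auto intro!: mult_pos_pos)
    finally have "\<beta> * sqnorm k \<le> a * real (n div K) / (2 * real l + 1)\<^sup>2 * sqnorm k"
      by (intro mult_right_mono sum_nonneg) auto
    then have "exp (- (a * real (n div K) / (2 * real l + 1)\<^sup>2) * sqnorm k) \<le> exp (- \<beta> * sqnorm k)"
      by simp
    with dom[rule_format, OF k] show ?thesis by (rule order.trans)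
  qed
  then show ?thesis using \<beta> by (intro exI[of _ \<beta>] conjI exI[of _ K]) auto
qed

lemma walk_tail:
  assumes mart: "\<And>k. k \<in> PiE I (\<lambda>_. UNIV) \<Longrightarrow> \<exists>M. lattice_martingale G I c P rep \<nu> M (\<lambda>i. real_of_int (k i))"
  shows "\<exists>C\<ge>0. \<exists>l0. \<forall>l\<ge>l0. \<forall>n. measure_pmf.prob (convolution_power G \<nu> n) (outside l) \<le> C * real n / (real l)\<^sup>2"
proof -
  have "\<exists>C\<ge>0. \<exists>l0. \<forall>l\<ge>l0. \<forall>n. measure_pmf.prob (convolution_power G \<nu> n) {x. \<bar>P i x\<bar> > int l} \<le> C * real n / (real l)\<^sup>2"
    if i: "i \<in> I" for i
  proof -
    have "restrict (\<lambda>j. if i = j then 1 else 0) I \<in> PiE I (\<lambda>_. UNIV)" by auto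
    then obtain M where "lattice_martingale G I c P rep \<nu> M (\<lambda>j. real_of_int (restrict (\<lambda>j. if i = j then 1 else 0) I j))"
      using mart by blast
    then interpret lattice_martingale G I c P rep \<nu> M "\<lambda>j. real_of_int (restrict (\<lambda>j. if i = j then 1 else 0) I j)" .
    show ?thesis by (rule coordinate_tail[OF i]) auto
  qed
  then obtain C l0 where C: "\<And>i. i \<in> I \<Longrightarrow> C i \<ge> 0"
    and t: "\<And>i l n. i \<in> I \<Longrightarrow> l \<ge> l0 i \<Longrightarrow> measure_pmf.prob (convolution_power G \<nu> n) {x. \<bar>P i x\<bar> > int l} \<le> C i * real n / (real l)\<^sup>2"
    by metis
  define m where "m = Max (insert 0 (l0 ` I))"
  have m: "l0 i \<le> m" if "i \<in> I" for i unfolding m_def using finite_I that by (intro Max_ge) auto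
  have "measure_pmf.prob (convolution_power G \<nu> n) (outside l) \<le> (\<Sum>i\<in>I. C i) * real n / (real l)\<^sup>2"
    if l: "l \<ge> m" for l n
  proof -
    have "outside l = (\<Union>i\<in>I. {x. \<bar>P i x\<bar> > int l})" by auto
    then have "measure_pmf.prob (convolution_power G \<nu> n) (outside l) \<le>
        (\<Sum>i\<in>I. measure_pmf.prob (convolution_power G \<nu> n) {x. \<bar>P i x\<bar> > int l})"
      using finite_I by (simp add: measure_pmf.finite_measure_subadditive_finite)
    also have "\<dots> \<le> (\<Sum>i\<in>I. C i * real n / (real l)\<^sup>2)"
      using t m l order.trans by (intro sum_mono) blast
    finally show ?thesis by (simp add: sum_distrib_right sum_divide_distrib)
  qed
  then show ?thesis using C by (intro exI[of _ "\<Sum>i\<in>I. C i"] conjI sum_nonneg exI[of _ m]) auto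
qed

text \<open>For a fixed \<open>k\<close> the phase speed \<open>2 * pi / L\<close> is of order
  \<open>1 / sqrt n\<close>, the range of \<open>class_characteristic_tendsto\<close>. Equal
  \<open>Q\<close> gives both walks the same comparison sequence, and no limit of that sequence is
  required.\<close>

lemma character_difference_tendsto:
  assumes M1: "lattice_martingale G I c P rep \<nu>\<^sub>1 M (\<lambda>i. real_of_int (k i))"
    and M2: "lattice_martingale G I c P rep \<nu>\<^sub>2 M (\<lambda>i. real_of_int (k i))"
    and QQ: "lattice_martingale.Q G rep \<nu>\<^sub>1 M = lattice_martingale.Q G rep \<nu>\<^sub>2 M"
    and w: "w \<in> reps" and R: "R \<ge> 1"
  shows "(\<lambda>n. norm (\<E> (convolution_power G \<nu>\<^sub>1 n) (character (nat \<lceil>R * sqrt n\<rceil>) k w)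
     - \<E> (convolution_power G \<nu>\<^sub>2 n) (character (nat \<lceil>R * sqrt n\<rceil>) k w))) \<longlonglongrightarrow> 0"
proof -
  interpret a: lattice_martingale G I c P rep \<nu>\<^sub>1 M "\<lambda>i. real_of_int (k i)" by (rule M1)
  interpret b: lattice_martingale G I c P rep \<nu>\<^sub>2 M "\<lambda>i. real_of_int (k i)" by (rule M2)
  define l where "l = (\<lambda>n::nat. nat \<lceil>R * sqrt n\<rceil>)"
  define t where "t = (\<lambda>n. 2 * pi / (2 * real (l n) + 1))"
  have l: "sqrt n \<le> real (l n)" for n
  proof -
    have "1 * sqrt n \<le> R * sqrt n" using R by (intro mult_right_mono) auto
    then show ?thesis using real_nat_ceiling_ge[of "R * sqrt n"] unfolding l_def by linarith
  qed
  have t_le: "t n \<le> pi / sqrt n" if "n > 0" for n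
  proof -
    have "t n \<le> 2 * pi / (2 * sqrt n)" unfolding t_def using l[of n] that by (intro divide_left_mono) auto
    then show ?thesis by simp
  qed
  have t0: "t n \<ge> 0" for n by (simp add: t_def)
  have "t \<longlonglongrightarrow> 0"
  proof (rule tendsto_sandwich[where f = "\<lambda>_. 0" and h = "\<lambda>n. pi / sqrt (real n)"])
    show "(\<lambda>n. pi / sqrt (real n)) \<longlonglongrightarrow> 0"
      by (intro real_tendsto_divide_at_top[OF tendsto_const] filterlim_compose[OF sqrt_at_top filterlim_real_sequentially])
    show "\<forall>\<^sub>F n in sequentially. t n \<le> pi / sqrt (real n)"
      using eventually_gt_at_top[of 0] by eventually_elim (rule t_le)
  qed (use t0 in auto)
  moreover have "real n * (t n)\<^sup>2 \<le> pi\<^sup>2" for n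
  proof (cases "n = 0")
    case False
    then have "(t n)\<^sup>2 \<le> (pi / sqrt n)\<^sup>2" using t_le[of n] t0 by (intro power_mono) auto
    then show ?thesis using False by (simp add: power_divide field_simps)
  qed simp
  ultimately have lim: "(\<lambda>n. \<E> (a.pw n) (\<lambda>x. iexp (t n * M x) * (if rep x = w then 1 else 0))
    - of_real ((1 - (t n)\<^sup>2 * a.Q / 2) ^ n / card reps)) \<longlonglongrightarrow> 0"
    "(\<lambda>n. \<E> (b.pw n) (\<lambda>x. iexp (t n * M x) * (if rep x = w then 1 else 0))
    - of_real ((1 - (t n)\<^sup>2 * b.Q / 2) ^ n / card reps)) \<longlonglongrightarrow> 0"
    using a.class_characteristic_tendsto b.class_characteristic_tendsto w by blast+
  have "(\<lambda>n. \<E> (a.pw n) (\<lambda>x. iexp (t n * M x) * (if rep x = w then 1 else 0))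
    - \<E> (b.pw n) (\<lambda>x. iexp (t n * M x) * (if rep x = w then 1 else 0))) \<longlonglongrightarrow> 0"
    using tendsto_diff[OF lim] QQ by simp
  from tendsto_norm_zero[OF this]
  show ?thesis
    unfolding a.character_eq[OF refl w] b.character_eq[OF refl w] right_diff_distrib[symmetric] norm_mult norm_exp_i_times mult_1
    by (simp add: t_def l_def)
qed

text \<open>The tails are controlled by \<open>R\<close> alone, and the Fourier sum tends to zero by
  dominated convergence over all frequencies. One \<open>M\<close> has to serve both walks, since
  the phase in \<open>character_eq\<close> depends on it.\<close>

lemma walks_tv_tendsto_0:
  assumes w1: "lattice_walk G I c P rep \<nu>\<^sub>1" and w2: "lattice_walk G I c P rep \<nu>\<^sub>2"
    and mart: "\<And>k. k \<in> PiE I (\<lambda>_. UNIV) \<Longrightarrow> \<exists>M. lattice_martingale G I c P rep \<nu>\<^sub>1 M (\<lambda>i. real_of_int (k i))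
      \<and> lattice_martingale G I c P rep \<nu>\<^sub>2 M (\<lambda>i. real_of_int (k i))
      \<and> lattice_martingale.Q G rep \<nu>\<^sub>1 M = lattice_martingale.Q G rep \<nu>\<^sub>2 M"
  shows "(\<lambda>n. tv_dist (convolution_power G \<nu>\<^sub>1 n) (convolution_power G \<nu>\<^sub>2 n)) \<longlonglongrightarrow> 0"
proof (rule LIMSEQ_I)
  fix e :: real assume e: "0 < e"
  interpret a: lattice_walk G I c P rep \<nu>\<^sub>1 by (rule w1)
  interpret b: lattice_walk G I c P rep \<nu>\<^sub>2 by (rule w2)
  have mart1: "\<exists>M. lattice_martingale G I c P rep \<nu>\<^sub>1 M (\<lambda>i. real_of_int (k i))"
    and mart2: "\<exists>M. lattice_martingale G I c P rep \<nu>\<^sub>2 M (\<lambda>i. real_of_int (k i))"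
    if "k \<in> PiE I (\<lambda>_. UNIV)" for k using mart[OF that] by blast+
  have tail1: "\<exists>C\<ge>0. \<exists>l0. \<forall>l\<ge>l0. \<forall>n. measure_pmf.prob (a.pw n) (outside l) \<le> C * real n / (real l)\<^sup>2"
    by (rule walk_tail) (rule mart1)
  obtain C1 m1 where C1: "C1 \<ge> 0" and t1: "\<forall>l\<ge>m1. \<forall>n. measure_pmf.prob (a.pw n) (outside l) \<le> C1 * real n / (real l)\<^sup>2"
    using tail1 by (elim exE conjE)
  have tail2: "\<exists>C\<ge>0. \<exists>l0. \<forall>l\<ge>l0. \<forall>n. measure_pmf.prob (b.pw n) (outside l) \<le> C * real n / (real l)\<^sup>2"
    by (rule walk_tail) (rule mart2)
  obtain C2 m2 where C2: "C2 \<ge> 0" and t2: "\<forall>l\<ge>m2. \<forall>n. measure_pmf.prob (b.pw n) (outside l) \<le> C2 * real n / (real l)\<^sup>2"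
    using tail2 by (elim exE conjE)
  \<comment> \<open>As \<open>R \<ge> 1\<close>, also
    \<open>R\<^sup>2 \<ge> R \<ge> 4 * (C1 + C2) / e\<close>, so the two tails add up to at most
    \<open>e / 4\<close>.\<close>
  define R where "R = 1 + 4 * (C1 + C2) / e"
  have R: "R \<ge> 1" using C1 C2 e by (simp add: R_def)
  have "R \<le> R\<^sup>2" using R by (simp add: power2_eq_square)
  then have CR: "(C1 + C2) / R\<^sup>2 \<le> e / 4"
  proof -
    have "4 * (C1 + C2) / e \<le> R\<^sup>2" using \<open>R \<le> R\<^sup>2\<close> by (simp add: R_def)
    then have "4 * (C1 + C2) \<le> R\<^sup>2 * e" using e by (simp add: field_simps)
    then show ?thesis using R by (simp add: field_simps)
  qed
  define l where "l = (\<lambda>n::nat. nat \<lceil>R * sqrt n\<rceil>)"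
  obtain \<beta>1 N1 where \<beta>1: "\<beta>1 > 0" and N1: "\<forall>n\<ge>N1. \<forall>w. \<forall>k\<in>box (l n). norm (\<E> (a.pw n) (character (l n) k w)) \<le> exp (- \<beta>1 * sqnorm k)"
    using walk_character_uniform_bound[OF w1, of R] R unfolding l_def by auto
  obtain \<beta>2 N2 where \<beta>2: "\<beta>2 > 0" and N2: "\<forall>n\<ge>N2. \<forall>w. \<forall>k\<in>box (l n). norm (\<E> (b.pw n) (character (l n) k w)) \<le> exp (- \<beta>2 * sqnorm k)"
    using walk_character_uniform_bound[OF w2, of R] R unfolding l_def by auto
  define d where "d = (\<lambda>n k. \<Sum>w\<in>reps. norm (\<E> (a.pw n) (character (l n) k w) - \<E> (b.pw n) (character (l n) k w)))"
  define S where "S = (\<lambda>n. \<Sum>k\<in>box (l n). d n k)"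
  have finbox: "finite (box (l n))" for n by (intro finite_PiE finite_I) auto
  let ?Z = "PiE I (\<lambda>_. UNIV :: int set)"
  define N where "N = max N1 N2"
  define W where "W = (\<lambda>k. real (card reps) * (exp (- \<beta>1 * sqnorm k) + exp (- \<beta>2 * sqnorm k)))"
  define D where "D = (\<lambda>n k. if n \<ge> N \<and> k \<in> box (l n) then d n k else 0)"
  have D0: "0 \<le> D n k" for n k by (simp add: D_def d_def sum_nonneg)
  have DW: "D n k \<le> W k" for n k
  proof (cases "n \<ge> N \<and> k \<in> box (l n)")
    case True
    have "norm (\<E> (a.pw n) (character (l n) k w) - \<E> (b.pw n) (character (l n) k w)) \<le>
      exp (- \<beta>1 * sqnorm k) + exp (- \<beta>2 * sqnorm k)" for w
      using True N1 N2 by (intro order.trans[OF norm_triangle_ineq4] add_mono) (auto simp: N_def)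
    then show ?thesis using True by (auto simp: D_def d_def W_def intro!: order.trans[OF sum_bounded_above])
  qed (auto simp: D_def W_def)
  have "(\<lambda>n. integral\<^sup>L (count_space ?Z) (D n)) \<longlonglongrightarrow> integral\<^sup>L (count_space ?Z) (\<lambda>_. 0)"
  proof (rule integral_dominated_convergence[where w = W])
    show "integrable (count_space ?Z) W"
      unfolding W_def using integrable_exp_square_PiE[OF finite_I] \<beta>1 \<beta>2 by auto
    show "AE k in count_space ?Z. norm (D n k) \<le> W k" for n using D0 DW by simp
    show "AE k in count_space ?Z. (\<lambda>n. D n k) \<longlonglongrightarrow> 0"
    proof (rule AE_I2)
      fix k assume "k \<in> space (count_space ?Z)"
      then have "k \<in> ?Z" by simp
      from mart[OF this] obtain M where M: "lattice_martingale G I c P rep \<nu>\<^sub>1 M (\<lambda>i. real_of_int (k i))"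
        "lattice_martingale G I c P rep \<nu>\<^sub>2 M (\<lambda>i. real_of_int (k i))"
        "lattice_martingale.Q G rep \<nu>\<^sub>1 M = lattice_martingale.Q G rep \<nu>\<^sub>2 M" by blast
      have dlim: "(\<lambda>n. d n k) \<longlonglongrightarrow> 0" unfolding d_def l_def
        by (intro tendsto_null_sum character_difference_tendsto[OF M _ R])
      have Dd: "D n k \<le> d n k" for n by (simp add: D_def d_def sum_nonneg)
      show "(\<lambda>n. D n k) \<longlonglongrightarrow> 0"
      proof (rule tendsto_sandwich[OF _ _ tendsto_const dlim])
        show "\<forall>\<^sub>F n in sequentially. 0 \<le> D n k" by (rule always_eventually) (rule allI, rule D0)
        show "\<forall>\<^sub>F n in sequentially. D n k \<le> d n k" by (rule always_eventually) (rule allI, rule Dd)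
      qed
    qed
  qed auto
  then have "(\<lambda>n. integral\<^sup>L (count_space ?Z) (D n)) \<longlonglongrightarrow> 0" by simp
  then have ev1: "\<forall>\<^sub>F n in sequentially. integral\<^sup>L (count_space ?Z) (D n) < e / 4"
    by (rule order_tendstoD) (use e in simp)
  have SD: "integral\<^sup>L (count_space ?Z) (D n) = S n" if "n \<ge> N" for n
  proof -
    have sub: "box (l n) \<subseteq> ?Z" by (auto simp: PiE_def)
    have "{k \<in> ?Z. D n k \<noteq> 0} \<subseteq> box (l n)" by (auto simp: D_def)
    then have "integral\<^sup>L (count_space ?Z) (D n) = (\<Sum>k | k \<in> ?Z \<and> D n k \<noteq> 0. D n k)"
      by (intro lebesgue_integral_count_space_finite_support) (rule finite_subset[OF _ finbox])
    also have "\<dots> = (\<Sum>k\<in>box (l n). D n k)"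
      using finbox sub by (intro sum.mono_neutral_left) (auto simp: D_def)
    also have "\<dots> = S n" using that by (simp add: S_def D_def)
    finally show ?thesis .
  qed
  \<comment> \<open>The squares ensure \<open>l n \<ge> sqrt n \<ge> m1\<close> and likewise for
    \<open>m2\<close>, so both tail bounds apply.\<close>
  have ev2: "\<forall>\<^sub>F n in sequentially. n \<ge> max N (max 1 (max (m1\<^sup>2) (m2\<^sup>2)))" by (rule eventually_ge_at_top)
  have "\<forall>\<^sub>F n in sequentially. tv_dist (a.pw n) (b.pw n) < e"
    using ev1 ev2
  proof eventually_elim
    case (elim n)
    have lR: "R * sqrt n \<le> real (l n)" unfolding l_def by (rule real_nat_ceiling_ge)
    have "1 * sqrt n \<le> R * sqrt n" using R by (intro mult_right_mono) auto
    then have ls: "sqrt n \<le> real (l n)" using lR by simp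
    have lm: "m \<le> l n" if "m\<^sup>2 \<le> n" for m
    proof -
      have "real m \<le> sqrt n" using that by (intro real_le_rsqrt) (simp flip: of_nat_power)
      then show ?thesis using ls by linarith
    qed
    have n1: "n \<ge> 1" using elim by simp
    have "1 \<le> sqrt n" using n1 by simp
    then have l1: "real (l n) > 0" using ls by linarith
    have frac: "C * real n / (real (l n))\<^sup>2 \<le> C / R\<^sup>2" if "C \<ge> 0" for C
    proof -
      have "(R * sqrt n)\<^sup>2 \<le> (real (l n))\<^sup>2" using lR R by (intro power_mono) auto
      then have "R\<^sup>2 * real n \<le> (real (l n))\<^sup>2" by (simp add: power_mult_distrib)
      then have "C * real n / (real (l n))\<^sup>2 \<le> C * real n / (R\<^sup>2 * real n)"
        using that n1 R l1 by (intro divide_left_mono) (auto intro!: mult_pos_pos)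
      also have "\<dots> = C / R\<^sup>2" using n1 by simp
      finally show ?thesis .
    qed
    have p1: "measure_pmf.prob (a.pw n) (outside (l n)) \<le> C1 / R\<^sup>2"
      using t1 lm[of m1] elim frac[OF C1] order.trans by fastforce
    have p2: "measure_pmf.prob (b.pw n) (outside (l n)) \<le> C2 / R\<^sup>2"
      using t2 lm[of m2] elim frac[OF C2] order.trans by fastforce
    have Sn: "S n = (\<Sum>w\<in>reps. \<Sum>k\<in>box (l n). norm (\<E> (a.pw n) (character (l n) k w) - \<E> (b.pw n) (character (l n) k w)))"
      unfolding S_def d_def by (rule sum.swap)
    have "tv_dist (a.pw n) (b.pw n) \<le> S n + measure_pmf.prob (a.pw n) (outside (l n))
        + measure_pmf.prob (b.pw n) (outside (l n))"
      unfolding Sn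
      by (intro tv_dist_le finite_fourier_bound convolution_power_carrier a.supp b.supp)
    also have "\<dots> \<le> e / 4 + C1 / R\<^sup>2 + C2 / R\<^sup>2" using elim SD[of n] p1 p2 by (intro add_mono) auto
    also have "\<dots> \<le> e / 2" using CR unfolding add_divide_distrib by linarith
    finally show ?case using e by simp
  qed
  then show "\<exists>no. \<forall>n\<ge>no. norm (tv_dist (a.pw n) (b.pw n) - 0) < e"
    by (simp add: eventually_sequentially abs_of_nonneg[OF tv_dist_nonneg])
qed

end

subsection \<open>The transfer and harmonic coordinates\<close>

text \<open>The image is generated by its least positive element, and dividing by that element makes
  the homomorphism surjective.\<close>

lemma (in group) nonzero_hom_imp_epi:
  assumes \<phi>: "\<phi> \<in> hom G integer_group" and g: "g \<in> carrier G" "\<phi> g \<noteq> 0"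
  shows "\<exists>\<psi>. \<psi> \<in> epi G integer_group"
proof -
  interpret \<phi>: group_hom G integer_group \<phi>
    using \<phi> by (simp add: group_hom_def group_hom_axioms_def)
  have mult: "\<phi> (x \<otimes> y) = \<phi> x + \<phi> y" if "x \<in> carrier G" "y \<in> carrier G" for x y
    using \<phi>.hom_mult[OF that] by simp
  have pow: "\<phi> (x [^] (n::int)) = n * \<phi> x" if "x \<in> carrier G" for x n
    using \<phi>.hom_int_pow[OF that] by simp
  define D where "D = (\<lambda>n. n > 0 \<and> (\<exists>x\<in>carrier G. \<phi> x = int n))"
  define d where "d = (LEAST n. D n)"
  have "D (nat \<bar>\<phi> g\<bar>)"
  proof (cases "\<phi> g > 0")
    case True
    then show ?thesis using g by (auto simp: D_def)
  next
    case False
    then have "\<phi> (g [^] (-1::int)) = int (nat \<bar>\<phi> g\<bar>)" using pow[OF g(1), of "-1"] by simp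
    moreover have "g [^] (-1::int) \<in> carrier G" using g by simp
    ultimately show ?thesis using g(2) unfolding D_def by auto
  qed
  then have "D d" and least: "\<And>n. D n \<Longrightarrow> d \<le> n" unfolding d_def by (auto intro: LeastI Least_le)
  then obtain h where h: "d > 0" "h \<in> carrier G" "\<phi> h = int d" by (auto simp: D_def)
  have dvd: "int d dvd \<phi> x" if x: "x \<in> carrier G" for x
  proof (rule ccontr)
    assume nd: "\<not> int d dvd \<phi> x"
    define r where "r = \<phi> x mod int d"
    have r: "0 \<le> r" "r < int d" using h by (auto simp: r_def)
    have "r \<noteq> 0" using nd by (auto simp: r_def dvd_eq_mod_eq_0)
    have "\<phi> (x \<otimes> h [^] (- (\<phi> x div int d))) = \<phi> x - (\<phi> x div int d) * int d"
      using mult[OF x, of "h [^] (- (\<phi> x div int d))"] h pow[OF h(2), of "- (\<phi> x div int d)"] by simp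
    also have "\<dots> = r" by (simp add: r_def minus_div_mult_eq_mod)
    finally have "D (nat r)" unfolding D_def using r \<open>r \<noteq> 0\<close> x h
      by (auto intro!: bexI[of _ "x \<otimes> h [^] (- (\<phi> x div int d))"])
    then show False using least[of "nat r"] r \<open>r \<noteq> 0\<close> by linarith
  qed
  have "(\<lambda>x. \<phi> x div int d) \<in> epi G integer_group"
    unfolding epi_def
  proof (intro CollectI conjI homI)
    show "(\<lambda>x. \<phi> x div int d) ` carrier G = carrier integer_group"
    proof -
      have "n \<in> (\<lambda>x. \<phi> x div int d) ` carrier G" for n
        using h pow[OF h(2), of n] by (intro image_eqI[of _ _ "h [^] n"]) auto
      then show ?thesis by auto
    qed
    show "\<phi> (x \<otimes> y) div int d = (\<phi> x div int d) \<otimes>\<^bsub>integer_group\<^esub> (\<phi> y div int d)"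
      if "x \<in> carrier G" "y \<in> carrier G" for x y
      using mult[OF that] dvd[OF that(1)] by (simp add: div_plus_div_distrib_dvd_left)
  qed auto
  then show ?thesis by blast
qed

lemma (in group) word_product_closed: "set ws \<subseteq> carrier G \<Longrightarrow> word_product G ws \<in> carrier G"
  by (induction ws) (auto simp: word_product_def)

context lattice_group
begin

lemma class_fun_compose: "class_fun f \<Longrightarrow> class_fun (\<lambda>x. h (f x))"
  by (simp add: class_fun_def)

lemma coordinate_increment_class_fun:
  "i \<in> I \<Longrightarrow> g \<in> carrier G \<Longrightarrow> class_fun (\<lambda>x. P i (x \<otimes> g) - P i x)"
  by (auto simp: class_fun_def m_assoc c_closed P_c)

text \<open>The sum below is the \<open>i\<close>-th coordinate of the transfer homomorphism of \<open>G\<close> into the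
  free abelian subgroup generated by the \<open>c i\<close>.\<close>

lemma transfer_hom:
  assumes i: "i \<in> I"
  shows "(\<lambda>g. \<Sum>t\<in>reps. P i (t \<otimes> g) - P i t) \<in> hom G integer_group"
proof (rule homI)
  fix g h assume g: "g \<in> carrier G" and h: "h \<in> carrier G"
  have "(\<Sum>t\<in>reps. P i (t \<otimes> (g \<otimes> h)) - P i t) =
    (\<Sum>t\<in>reps. P i ((t \<otimes> g) \<otimes> h) - P i (t \<otimes> g)) + (\<Sum>t\<in>reps. P i (t \<otimes> g) - P i t)"
    using g h by (simp add: m_assoc reps_carrier flip: sum.distrib)
  also have "(\<Sum>t\<in>reps. P i ((t \<otimes> g) \<otimes> h) - P i (t \<otimes> g)) = (\<Sum>t\<in>reps. P i (t \<otimes> h) - P i t)"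
    by (rule sum_reps_translate[OF coordinate_increment_class_fun[OF i h] g])
  finally show "(\<Sum>t\<in>reps. P i (t \<otimes> (g \<otimes> h)) - P i t) =
    (\<Sum>t\<in>reps. P i (t \<otimes> g) - P i t) \<otimes>\<^bsub>integer_group\<^esub> (\<Sum>t\<in>reps. P i (t \<otimes> h) - P i t)" by simp
qed simp

lemma transfer_eq_0:
  assumes "\<not> (\<exists>\<phi>. \<phi> \<in> epi G integer_group)" "i \<in> I" "g \<in> carrier G"
  shows "(\<Sum>t\<in>reps. P i (t \<otimes> g) - P i t) = 0"
  using nonzero_hom_imp_epi[OF transfer_hom[OF assms(2)] assms(3)] assms(1) by blast

text \<open>The increment by one letter is a class function, hence bounded in \<open>x\<close>, and
  there are finitely many letters; along a word the increments telescope. This transfers the second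
  moment of the word length to the coordinates.\<close>

lemma coordinate_increment_le_word_length:
  assumes i: "i \<in> I" and S: "finite_generating_set G S"
  shows "\<exists>C\<ge>0. \<forall>x\<in>carrier G. \<forall>g\<in>carrier G. \<bar>real_of_int (P i (x \<otimes> g) - P i x)\<bar> \<le> C * real (word_length G S g)"
proof -
  define A where "A = S \<union> m_inv G ` S"
  have A: "finite A" "A \<subseteq> carrier G" using S by (auto simp: A_def finite_generating_set_def)
  have "\<exists>B\<ge>0. \<forall>x\<in>carrier G. \<bar>real_of_int (P i (x \<otimes> s) - P i x)\<bar> \<le> B" if "s \<in> A" for s
  proof -
    have "class_fun (\<lambda>x. real_of_int (P i (x \<otimes> s) - P i x))"
      by (rule class_fun_compose[where h = real_of_int, OF coordinate_increment_class_fun[OF i]]) (use A that in auto)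
    from class_fun_bounded[OF this] show ?thesis by simp
  qed
  then obtain B where B: "\<And>s. s \<in> A \<Longrightarrow> B s \<ge> 0"
    "\<And>s x. s \<in> A \<Longrightarrow> x \<in> carrier G \<Longrightarrow> \<bar>real_of_int (P i (x \<otimes> s) - P i x)\<bar> \<le> B s" by metis
  define C where "C = (\<Sum>s\<in>A. B s)"
  have C: "B s \<le> C" if "s \<in> A" for s unfolding C_def using A B that by (intro member_le_sum) auto
  have words: "\<bar>real_of_int (P i (x \<otimes> word_product G ws) - P i x)\<bar> \<le> C * real (length ws)"
    if "set ws \<subseteq> A" "x \<in> carrier G" for ws x
    using that
  proof (induction ws arbitrary: x)
    case Nil
    then show ?case by (simp add: word_product_def)
  next
    case (Cons s ws)
    have s: "s \<in> A" "s \<in> carrier G" "set ws \<subseteq> A" using Cons.prems A by auto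
    have wc: "word_product G ws \<in> carrier G" using s A by (intro word_product_closed) auto
    have "x \<otimes> word_product G (s # ws) = (x \<otimes> s) \<otimes> word_product G ws"
      using wc s Cons.prems by (simp add: word_product_def m_assoc)
    then have "\<bar>real_of_int (P i (x \<otimes> word_product G (s # ws)) - P i x)\<bar> \<le>
      \<bar>real_of_int (P i ((x \<otimes> s) \<otimes> word_product G ws) - P i (x \<otimes> s))\<bar> + \<bar>real_of_int (P i (x \<otimes> s) - P i x)\<bar>"
      by simp
    also have "\<dots> \<le> C * real (length ws) + C"
      using Cons.IH[of "x \<otimes> s"] s Cons.prems B(2)[of s x] C[of s] by (intro add_mono) auto
    finally show ?case by (simp add: algebra_simps)
  qed
  have append: "word_product G (ws @ vs) = word_product G ws \<otimes> word_product G vs"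
    if "set ws \<subseteq> carrier G" "set vs \<subseteq> carrier G" for ws vs
    using that word_product_closed[of vs]
  proof (induction ws)
    case (Cons a ws)
    then show ?case using word_product_closed[of ws] by (simp add: word_product_def m_assoc)
  qed (simp add: word_product_def)
  have ex: "\<exists>ws. set ws \<subseteq> A \<and> word_product G ws = g" if "g \<in> generate G S" for g
    using that
  proof induction
    case one
    show ?case by (rule exI[of _ "[]"]) (simp add: word_product_def)
  next
    case (incl h)
    then show ?case using A by (intro exI[of _ "[h]"]) (auto simp: word_product_def A_def)
  next
    case (inv h)
    then show ?case using A by (intro exI[of _ "[inv h]"]) (auto simp: word_product_def A_def)
  next
    case (eng h1 h2)
    then obtain ws vs where "set ws \<subseteq> A" "word_product G ws = h1" "set vs \<subseteq> A" "word_product G vs = h2" by blast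
    then show ?case using append[of ws vs] A by (intro exI[of _ "ws @ vs"]) auto
  qed
  have "\<bar>real_of_int (P i (x \<otimes> g) - P i x)\<bar> \<le> C * real (word_length G S g)"
    if x: "x \<in> carrier G" and g: "g \<in> carrier G" for x g
  proof -
    have "\<exists>n. \<exists>ws. set ws \<subseteq> S \<union> m_inv G ` S \<and> length ws = n \<and> word_product G ws = g"
      using ex[of g] g S by (auto simp: finite_generating_set_def A_def)
    from LeastI_ex[OF this] obtain ws where "set ws \<subseteq> A" "length ws = word_length G S g" "word_product G ws = g"
      unfolding word_length_def A_def by blast
    then show ?thesis using words[of ws x] x by simp
  qed
  moreover have "C \<ge> 0" unfolding C_def by (intro sum_nonneg B)
  ultimately show ?thesis by blast
qed

lemma coordinate_second_moment:
  assumes i: "i \<in> I" and fm: "finite_second_moment G \<mu>" and supp: "set_pmf \<mu> \<subseteq> carrier G" and x: "x \<in> carrier G"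
  shows "integrable \<mu> (\<lambda>g. (real_of_int (P i (x \<otimes> g) - P i x))\<^sup>2)"
proof -
  obtain S where S: "finite_generating_set G S"
    and sm: "(\<lambda>g. (real (word_length G S g))\<^sup>2 * pmf \<mu> g) summable_on carrier G"
    using fm by (auto simp: finite_second_moment_def)
  obtain C where C: "C \<ge> 0" "\<And>g. g \<in> carrier G \<Longrightarrow> \<bar>real_of_int (P i (x \<otimes> g) - P i x)\<bar> \<le> C * real (word_length G S g)"
    using coordinate_increment_le_word_length[OF i S] x by blast
  have "(\<lambda>g. (real (word_length G S g))\<^sup>2 * pmf \<mu> g) summable_on UNIV"
    by (subst summable_on_cong_neutral[where T = "carrier G" and g = "\<lambda>g. (real (word_length G S g))\<^sup>2 * pmf \<mu> g"])
       (use supp sm in \<open>auto simp: set_pmf_iff\<close>)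
  then have "Infinite_Sum.abs_summable_on (\<lambda>g. (real (word_length G S g))\<^sup>2 * pmf \<mu> g) UNIV"
    by (rule summable_on_iff_abs_summable_on_real[THEN iffD1])
  then have "Infinite_Set_Sum.abs_summable_on (\<lambda>g. (real (word_length G S g))\<^sup>2 * pmf \<mu> g) UNIV"
    by (rule abs_summable_equivalent[THEN iffD1])
  then have "integrable (count_space UNIV) (\<lambda>g. pmf \<mu> g *\<^sub>R (real (word_length G S g))\<^sup>2)"
    by (simp add: abs_summable_on_def mult.commute)
  then have int: "integrable \<mu> (\<lambda>g. (real (word_length G S g))\<^sup>2)"
    unfolding measure_pmf_eq_density by (subst integrable_density) auto
  show ?thesis
  proof (rule Bochner_Integration.integrable_bound)
    show "integrable \<mu> (\<lambda>g. C\<^sup>2 * (real (word_length G S g))\<^sup>2)" using int by simp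
    show "AE g in \<mu>. norm ((real_of_int (P i (x \<otimes> g) - P i x))\<^sup>2) \<le> norm (C\<^sup>2 * (real (word_length G S g))\<^sup>2)"
      unfolding AE_measure_pmf_iff
    proof
      fix g assume "g \<in> set_pmf \<mu>"
      then have "\<bar>real_of_int (P i (x \<otimes> g) - P i x)\<bar>\<^sup>2 \<le> (C * real (word_length G S g))\<^sup>2"
        using C supp by (intro power_mono) auto
      then show "norm ((real_of_int (P i (x \<otimes> g) - P i x))\<^sup>2) \<le> norm (C\<^sup>2 * (real (word_length G S g))\<^sup>2)"
        unfolding power2_abs by (simp only: power_mult_distrib real_norm_def abs_of_nonneg zero_le_power2 zero_le_mult_iff simp_thms)
    qed
  qed simp
qed

end

context lattice_walk
begin

text \<open>The drift of \<open>P i\<close> is a class function, and its sum over the cosets is the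
  expected value of the transfer. So the drift can be cancelled by a class function \<open>v\<close>
  from the Poisson equation. The last clause holds for \<open>P i\<close> by the transfer and for
  \<open>v\<close> by translation invariance.\<close>

lemma harmonic_coordinate:
  assumes i: "i \<in> I" and no: "\<not> (\<exists>\<phi>. \<phi> \<in> epi G integer_group)"
    and sq: "\<And>x. x \<in> carrier G \<Longrightarrow> integrable \<nu> (\<lambda>g. (real_of_int (P i (x \<otimes> g) - P i x))\<^sup>2)"
  shows "\<exists>u. (\<forall>j\<in>I. \<forall>x\<in>carrier G. u (c j \<otimes> x) = u x + (if i = j then 1 else 0))
    \<and> (\<forall>x\<in>carrier G. integrable \<nu> (\<lambda>g. (u (x \<otimes> g) - u x)\<^sup>2))
    \<and> (\<forall>x\<in>carrier G. \<E> \<nu> (\<lambda>g. u (x \<otimes> g) - u x) = 0)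
    \<and> (\<forall>g\<in>carrier G. (\<Sum>t\<in>reps. u (t \<otimes> g) - u t) = (0::real))"
proof -
  define D where "D = (\<lambda>x g. real_of_int (P i (x \<otimes> g) - P i x))"
  have cD: "class_fun (\<lambda>x. D x g)" if "g \<in> carrier G" for g
    unfolding D_def by (rule class_fun_compose[where h = real_of_int, OF coordinate_increment_class_fun[OF i that]])
  have iD: "integrable \<nu> (D x)" if "x \<in> carrier G" for x
    unfolding D_def by (rule measure_pmf.square_integrable_imp_integrable[OF _ sq[OF that]]) simp
  define \<psi> where "\<psi> = (\<lambda>x. \<E> \<nu> (D x))"
  have c\<psi>: "class_fun \<psi>"
    unfolding class_fun_def \<psi>_def using cD supp
    by (intro ballI integral_cong_AE) (auto simp: AE_measure_pmf_iff class_fun_def)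
  have Dsum: "(\<Sum>t\<in>reps. D t g) = 0" if "g \<in> carrier G" for g
    using transfer_eq_0[OF no i that] unfolding D_def of_int_sum[symmetric] by simp
  have "(\<Sum>t\<in>reps. \<psi> t) = \<E> \<nu> (\<lambda>g. \<Sum>t\<in>reps. D t g)"
    unfolding \<psi>_def by (rule Bochner_Integration.integral_sum[symmetric]) (rule iD, rule reps_carrier)
  also have "\<dots> = \<E> \<nu> (\<lambda>g. 0)"
    using supp Dsum by (intro integral_cong_AE) (auto simp: AE_measure_pmf_iff)
  finally have "(\<Sum>t\<in>reps. \<psi> t) = 0" by simp
  from poisson_equation[OF c\<psi> this] obtain v where cv: "class_fun v"
    and v: "\<And>x. x \<in> carrier G \<Longrightarrow> \<E> \<nu> (\<lambda>g. v (x \<otimes> g)) = v x - \<psi> x" by blast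
  obtain B where B: "B \<ge> 0" "\<And>x. x \<in> carrier G \<Longrightarrow> \<bar>v x\<bar> \<le> B" using class_fun_bounded[OF cv] by auto
  define u where "u = (\<lambda>x. real_of_int (P i x) + v x)"
  have ud: "u (x \<otimes> g) - u x = D x g + (v (x \<otimes> g) - v x)" for x g by (simp add: u_def D_def)
  have iv: "integrable \<nu> (\<lambda>g. v (x \<otimes> g))" if "x \<in> carrier G" for x
    using B supp that by (intro integrable_pmf_bounded[where B = B]) auto
  show ?thesis
  proof (intro exI[of _ u] conjI ballI)
    fix j x assume "j \<in> I" "x \<in> carrier G"
    then show "u (c j \<otimes> x) = u x + (if i = j then 1 else 0)"
      using i cv by (auto simp: u_def P_c class_fun_def)
  next
    fix x assume x: "x \<in> carrier G"
    show "integrable \<nu> (\<lambda>g. (u (x \<otimes> g) - u x)\<^sup>2)"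
    proof (rule Bochner_Integration.integrable_bound)
      show "integrable \<nu> (\<lambda>g. 2 * (D x g)\<^sup>2 + 2 * (2 * B)\<^sup>2)" using sq[OF x] by (simp add: D_def)
      show "AE g in \<nu>. norm ((u (x \<otimes> g) - u x)\<^sup>2) \<le> norm (2 * (D x g)\<^sup>2 + 2 * (2 * B)\<^sup>2)"
        unfolding AE_measure_pmf_iff
      proof
        fix g assume "g \<in> set_pmf \<nu>"
        then have "\<bar>v (x \<otimes> g) - v x\<bar> \<le> 2 * B" using B(2)[OF x] B(2)[of "x \<otimes> g"] x supp by auto
        then have b: "(v (x \<otimes> g) - v x)\<^sup>2 \<le> (2 * B)\<^sup>2" using power_mono[of "\<bar>v (x \<otimes> g) - v x\<bar>" "2 * B" 2] by simp
        have "(a + b)\<^sup>2 \<le> 2 * a\<^sup>2 + 2 * b\<^sup>2" for a b :: real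
          using zero_le_power2[of "a - b"] by (simp add: power2_eq_square algebra_simps)
        from this[of "D x g" "v (x \<otimes> g) - v x"] b
        have "(u (x \<otimes> g) - u x)\<^sup>2 \<le> 2 * (D x g)\<^sup>2 + 2 * (2 * B)\<^sup>2" unfolding ud by linarith
        then show "norm ((u (x \<otimes> g) - u x)\<^sup>2) \<le> norm (2 * (D x g)\<^sup>2 + 2 * (2 * B)\<^sup>2)" by simp
      qed
    qed simp
    have "\<E> \<nu> (\<lambda>g. u (x \<otimes> g) - u x) = \<psi> x + ((v x - \<psi> x) - v x)"
      unfolding ud \<psi>_def using iD[OF x] iv[OF x] v[OF x] by (simp add: \<psi>_def)
    then show "\<E> \<nu> (\<lambda>g. u (x \<otimes> g) - u x) = 0" by simp
  next
    fix g assume g: "g \<in> carrier G"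
    have "(\<Sum>t\<in>reps. v (t \<otimes> g) - v t) = 0"
      using sum_reps_translate[OF cv g] by (simp add: sum_subtractf)
    then show "(\<Sum>t\<in>reps. u (t \<otimes> g) - u t) = 0"
      unfolding ud sum.distrib Dsum[OF g] by simp
  qed
qed

end

subsection \<open>The noisy walk\<close>

text \<open>Each component is a \<open>\<mu>\<close>-walk for every \<open>\<rho>\<close>, so
  quantities of a single component do not involve \<open>\<rho>\<close>; only mixed ones
  can.\<close>

lemma map_fst_noise_pmf: "map_pmf fst (noise_pmf \<rho> \<mu>) = \<mu>"
  and map_snd_noise_pmf: "map_pmf snd (noise_pmf \<rho> \<mu>) = \<mu>"
proof -
  have "map_pmf fst (if b then pair_pmf \<mu> \<mu> else diag_pmf \<mu>) = \<mu>"
    "map_pmf snd (if b then pair_pmf \<mu> \<mu> else diag_pmf \<mu>) = \<mu>" for b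
    by (simp_all add: map_fst_pair_pmf map_snd_pair_pmf diag_pmf_def pmf.map_comp o_def)
  then show "map_pmf fst (noise_pmf \<rho> \<mu>) = \<mu>" "map_pmf snd (noise_pmf \<rho> \<mu>) = \<mu>"
    by (simp_all add: noise_pmf_def map_bind_pmf bind_pmf_const)
qed

lemma set_noise_pmf_subset: "set_pmf (noise_pmf \<rho> \<mu>) \<subseteq> set_pmf \<mu> \<times> set_pmf \<mu>"
  using map_fst_noise_pmf[of \<rho> \<mu>] map_snd_noise_pmf[of \<rho> \<mu>]
  by (metis fst_conv image_eqI mem_Sigma_iff pmf.set_map snd_conv subrelI)

lemma set_noise_pmf_supset:
  assumes "0 < \<rho>" "\<rho> \<le> 1"
  shows "set_pmf \<mu> \<times> set_pmf \<mu> \<subseteq> set_pmf (noise_pmf \<rho> \<mu>)"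
proof
  fix z assume z: "z \<in> set_pmf \<mu> \<times> set_pmf \<mu>"
  have "True \<in> set_pmf (bernoulli_pmf \<rho>)" using assms by (simp add: set_pmf_iff)
  then show "z \<in> set_pmf (noise_pmf \<rho> \<mu>)" using z by (auto simp: noise_pmf_def intro!: bexI[of _ True])
qed

lemma noise_pmf_1: "noise_pmf 1 \<mu> = pair_pmf \<mu> \<mu>"
  by (rule pmf_eqI) (simp add: pmf_noise_pmf)

lemma convolution_pmf_pair:
  "convolution_pmf (G \<times>\<times> H) (pair_pmf p q) (pair_pmf r s) =
    pair_pmf (convolution_pmf G p r) (convolution_pmf H q s)"
proof -
  have "convolution_pmf (G \<times>\<times> H) (pair_pmf p q) (pair_pmf r s) =
    bind_pmf p (\<lambda>x. bind_pmf q (\<lambda>y. bind_pmf r (\<lambda>z. bind_pmf s (\<lambda>w. return_pmf (x \<otimes>\<^bsub>G\<^esub> z, y \<otimes>\<^bsub>H\<^esub> w)))))"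
    by (simp add: convolution_pmf_def pair_pmf_def map_pmf_def bind_assoc_pmf bind_return_pmf)
  also have "\<dots> = bind_pmf p (\<lambda>x. bind_pmf r (\<lambda>z. bind_pmf q (\<lambda>y. bind_pmf s (\<lambda>w. return_pmf (x \<otimes>\<^bsub>G\<^esub> z, y \<otimes>\<^bsub>H\<^esub> w)))))"
    by (subst bind_commute_pmf) simp
  also have "\<dots> = pair_pmf (convolution_pmf G p r) (convolution_pmf H q s)"
    by (simp add: convolution_pmf_def pair_pmf_def map_pmf_def bind_assoc_pmf bind_return_pmf)
  finally show ?thesis .
qed

lemma convolution_power_pair:
  "convolution_power (G \<times>\<times> H) (pair_pmf p q) n = pair_pmf (convolution_power G p n) (convolution_power H q n)"
  by (induction n) (simp_all add: convolution_pmf_pair)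

lemma convolution_power_noise_1:
  "convolution_power (G \<times>\<times> G) (noise_pmf 1 \<mu>) n = pair_pmf (convolution_power G \<mu> n) (convolution_power G \<mu> n)"
  by (simp add: noise_pmf_1 convolution_power_pair)

text \<open>As \<open>\<rho>\<close> is positive, every step can be an independent one, so any pair
  reachable by two independent walks at time \<open>n\<close> stays reachable.\<close>

lemma set_convolution_power_noise_supset:
  assumes "0 < \<rho>" "\<rho> \<le> 1"
  shows "set_pmf (convolution_power G \<mu> n) \<times> set_pmf (convolution_power G \<mu> n)
    \<subseteq> set_pmf (convolution_power (G \<times>\<times> G) (noise_pmf \<rho> \<mu>) n)"
proof (induction n)
  case (Suc n)
  show ?case
  proof (intro subsetI, elim SigmaE)
    fix z x y assume z: "z = (x, y)" "x \<in> set_pmf (convolution_power G \<mu> (Suc n))" "y \<in> set_pmf (convolution_power G \<mu> (Suc n))"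
    then obtain x1 x2 y1 y2 where xy: "x = x1 \<otimes>\<^bsub>G\<^esub> x2" "y = y1 \<otimes>\<^bsub>G\<^esub> y2"
      "x1 \<in> set_pmf (convolution_power G \<mu> n)" "y1 \<in> set_pmf (convolution_power G \<mu> n)"
      "x2 \<in> set_pmf \<mu>" "y2 \<in> set_pmf \<mu>"
      by (auto simp: set_convolution_pmf)
    then have "(x1, y1) \<in> set_pmf (convolution_power (G \<times>\<times> G) (noise_pmf \<rho> \<mu>) n)" "(x2, y2) \<in> set_pmf (noise_pmf \<rho> \<mu>)"
      using Suc set_noise_pmf_supset[OF assms] by auto
    then show "z \<in> set_pmf (convolution_power (G \<times>\<times> G) (noise_pmf \<rho> \<mu>) (Suc n))"
      using xy z by (force simp: set_convolution_pmf)
  qed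
qed simp

lemma expectation_noise_fst:
  fixes f :: "'a \<Rightarrow> real"
  shows "\<E> (noise_pmf \<rho> \<mu>) (\<lambda>z. f (fst z)) = \<E> \<mu> f"
    and "integrable (noise_pmf \<rho> \<mu>) (\<lambda>z. f (fst z)) \<longleftrightarrow> integrable \<mu> f"
  by (subst (2) map_fst_noise_pmf[of \<rho> \<mu>, symmetric], simp)+

lemma expectation_noise_snd:
  fixes f :: "'a \<Rightarrow> real"
  shows "\<E> (noise_pmf \<rho> \<mu>) (\<lambda>z. f (snd z)) = \<E> \<mu> f"
    and "integrable (noise_pmf \<rho> \<mu>) (\<lambda>z. f (snd z)) \<longleftrightarrow> integrable \<mu> f"
  by (subst (2) map_snd_noise_pmf[of \<rho> \<mu>, symmetric], simp)+

section \<open>The direct square and its harmonic functions\<close>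

context lattice_group
begin

definition prod_c :: "bool \<times> 'i \<Rightarrow> 'a \<times> 'a" where
  "prod_c = (\<lambda>(b, i). if b then (\<one>, c i) else (c i, \<one>))"

definition prod_P :: "bool \<times> 'i \<Rightarrow> 'a \<times> 'a \<Rightarrow> int" where
  "prod_P = (\<lambda>(b, i) (x, y). if b then P i y else P i x)"

definition prod_rep :: "'a \<times> 'a \<Rightarrow> 'a \<times> 'a" where
  "prod_rep = (\<lambda>(x, y). (rep x, rep y))"

lemma lattice_group_prod: "lattice_group (G \<times>\<times> G) (UNIV \<times> I) prod_c prod_P prod_rep"
proof -
  interpret GG: group "G \<times>\<times> G" by (rule DirProd_group) (rule is_group)+
  show ?thesis
  proof
    show "finite ((UNIV :: bool set) \<times> I)" using finite_I by simp
    have "prod_rep ` carrier (G \<times>\<times> G) = rep ` carrier G \<times> rep ` carrier G"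
      by (auto simp: prod_rep_def DirProd_def image_iff)
    then show "finite (prod_rep ` carrier (G \<times>\<times> G))" using finite_rep by simp
    show "x = y" if xy: "x \<in> carrier (G \<times>\<times> G)" "y \<in> carrier (G \<times>\<times> G)" "prod_rep x = prod_rep y"
      and P: "\<And>i. i \<in> UNIV \<times> I \<Longrightarrow> prod_P i x = prod_P i y" for x y
    proof (cases x; cases y)
      fix x1 x2 y1 y2 assume eq: "x = (x1, x2)" "y = (y1, y2)"
      have "x1 = y1" by (rule coord_inj) (use xy P[of "(False, _)"] eq in \<open>auto simp: prod_rep_def prod_P_def DirProd_def\<close>)
      moreover have "x2 = y2" by (rule coord_inj) (use xy P[of "(True, _)"] eq in \<open>auto simp: prod_rep_def prod_P_def DirProd_def\<close>)
      ultimately show "x = y" using eq by simp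
    qed
    fix i j and x assume "i \<in> (UNIV :: bool set) \<times> I" "j \<in> (UNIV :: bool set) \<times> I" "x \<in> carrier (G \<times>\<times> G)"
    then obtain b i' b' j' x1 x2 where eq: "i = (b, i')" "j = (b', j')" "x = (x1, x2)"
      and m: "i' \<in> I" "j' \<in> I" "x1 \<in> carrier G" "x2 \<in> carrier G" by (auto simp: DirProd_def)
    show "prod_rep (prod_c i \<otimes>\<^bsub>G \<times>\<times> G\<^esub> x) = prod_rep x"
      using m rep_c by (cases b) (simp_all add: eq prod_rep_def prod_c_def)
    show "prod_P i (prod_c j \<otimes>\<^bsub>G \<times>\<times> G\<^esub> x) = prod_P i x + (if i = j then 1 else 0)"
      using m P_c by (cases b; cases b') (simp_all add: eq prod_P_def prod_c_def)
  qed (auto simp: prod_c_def prod_rep_def DirProd_def c_closed rep_closed rep_rep)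
qed

lemma reps_prod: "lattice_group.reps (G \<times>\<times> G) prod_rep = reps \<times> reps"
proof -
  interpret p: lattice_group "G \<times>\<times> G" "UNIV \<times> I" prod_c prod_P prod_rep by (rule lattice_group_prod)
  show ?thesis unfolding p.reps_def unfolding reps_def by (auto simp: prod_rep_def DirProd_def image_iff)
qed

end

context lattice_walk
begin

lemma lattice_walk_noise:
  assumes "0 < \<rho>" "\<rho> \<le> 1"
  shows "lattice_walk (G \<times>\<times> G) (UNIV \<times> I) prod_c prod_P prod_rep (noise_pmf \<rho> \<nu>)"
proof -
  interpret p: lattice_group "G \<times>\<times> G" "UNIV \<times> I" prod_c prod_P prod_rep by (rule lattice_group_prod)
  show ?thesis
  proof
    show "set_pmf (noise_pmf \<rho> \<nu>) \<subseteq> carrier (G \<times>\<times> G)"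
      using set_noise_pmf_subset[of \<rho> \<nu>] supp by (auto simp: DirProd_def)
    fix g assume "g \<in> carrier (G \<times>\<times> G)"
    then obtain x y where g: "g = (x, y)" "x \<in> carrier G" "y \<in> carrier G" by (auto simp: DirProd_def)
    obtain K1 K2 where "\<forall>k\<ge>K1. x \<in> set_pmf (pw k)" "\<forall>k\<ge>K2. y \<in> set_pmf (pw k)"
      using spread[OF g(2)] spread[OF g(3)] by blast
    then have "\<forall>k\<ge>max K1 K2. g \<in> set_pmf (pw k) \<times> set_pmf (pw k)" using g by auto
    then have "\<forall>k\<ge>max K1 K2. g \<in> set_pmf (convolution_power (G \<times>\<times> G) (noise_pmf \<rho> \<nu>) k)"
      using set_convolution_power_noise_supset[OF assms, of G \<nu>] by blast
    then show "\<exists>K. \<forall>k\<ge>K. g \<in> set_pmf (convolution_power (G \<times>\<times> G) (noise_pmf \<rho> \<nu>) k)" by blast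
  qed
qed

text \<open>The last clause is separate from the martingale property: it concerns each single step
  \<open>g\<close>, averaged over the cosets. It records the vanishing of the transfer for use in
  the cross term.\<close>

definition harmonic_fun :: "('c \<Rightarrow> real) \<Rightarrow> ('a \<Rightarrow> real) \<Rightarrow> bool" where
  "harmonic_fun m A \<longleftrightarrow>
    (\<forall>j\<in>I. \<forall>x\<in>carrier G. A (c j \<otimes> x) = A x + m j)
    \<and> (\<forall>x\<in>carrier G. integrable \<nu> (\<lambda>g. (A (x \<otimes> g) - A x)\<^sup>2))
    \<and> (\<forall>x\<in>carrier G. \<E> \<nu> (\<lambda>g. A (x \<otimes> g) - A x) = 0)
    \<and> (\<forall>g\<in>carrier G. (\<Sum>t\<in>reps. A (t \<otimes> g) - A t) = 0)"

lemma harmonic_fun_0: "harmonic_fun (\<lambda>_. 0) (\<lambda>_. 0)"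
  by (simp add: harmonic_fun_def)

lemma harmonic_fun_integrable:
  "harmonic_fun m A \<Longrightarrow> x \<in> carrier G \<Longrightarrow> integrable \<nu> (\<lambda>g. A (x \<otimes> g) - A x)"
  by (rule measure_pmf.square_integrable_imp_integrable) (auto simp: harmonic_fun_def)

lemma harmonic_fun_add_scaled:
  assumes A: "harmonic_fun m A" and B: "harmonic_fun m' B"
  shows "harmonic_fun (\<lambda>j. m j + a * m' j) (\<lambda>x. A x + a * B x)"
  unfolding harmonic_fun_def
proof (intro conjI ballI)
  fix j x assume "j \<in> I" "x \<in> carrier G"
  then show "A (c j \<otimes> x) + a * B (c j \<otimes> x) = A x + a * B x + (m j + a * m' j)"
    using A B by (simp add: harmonic_fun_def algebra_simps)
next
  fix x assume x: "x \<in> carrier G"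
  have d: "A (x \<otimes> g) + a * B (x \<otimes> g) - (A x + a * B x) = (A (x \<otimes> g) - A x) + a * (B (x \<otimes> g) - B x)" for g
    by (simp add: algebra_simps)
  have sq: "integrable \<nu> (\<lambda>g. (A (x \<otimes> g) - A x)\<^sup>2)" "integrable \<nu> (\<lambda>g. (B (x \<otimes> g) - B x)\<^sup>2)"
    using A B x by (auto simp: harmonic_fun_def)
  show "integrable \<nu> (\<lambda>g. (A (x \<otimes> g) + a * B (x \<otimes> g) - (A x + a * B x))\<^sup>2)"
    unfolding d
  proof (rule Bochner_Integration.integrable_bound)
    show "integrable \<nu> (\<lambda>g. 2 * (A (x \<otimes> g) - A x)\<^sup>2 + 2 * a\<^sup>2 * (B (x \<otimes> g) - B x)\<^sup>2)" using sq by simp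
    have "(y + a * z)\<^sup>2 \<le> 2 * y\<^sup>2 + 2 * a\<^sup>2 * z\<^sup>2" for y z :: real
      using zero_le_power2[of "y - a * z"] by (simp add: power2_eq_square algebra_simps)
    then show "AE g in \<nu>. norm (((A (x \<otimes> g) - A x) + a * (B (x \<otimes> g) - B x))\<^sup>2)
      \<le> norm (2 * (A (x \<otimes> g) - A x)\<^sup>2 + 2 * a\<^sup>2 * (B (x \<otimes> g) - B x)\<^sup>2)" by simp
  qed simp
  show "\<E> \<nu> (\<lambda>g. A (x \<otimes> g) + a * B (x \<otimes> g) - (A x + a * B x)) = 0"
    unfolding d using harmonic_fun_integrable[OF A x] harmonic_fun_integrable[OF B x] A B x
    by (simp add: harmonic_fun_def del: Bochner_Integration.integral_diff)
next
  fix g assume g: "g \<in> carrier G"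
  have "A (t \<otimes> g) + a * B (t \<otimes> g) - (A t + a * B t) = (A (t \<otimes> g) - A t) + a * (B (t \<otimes> g) - B t)" for t
    by (simp add: algebra_simps)
  then have "(\<Sum>t\<in>reps. A (t \<otimes> g) + a * B (t \<otimes> g) - (A t + a * B t)) =
    (\<Sum>t\<in>reps. A (t \<otimes> g) - A t) + a * (\<Sum>t\<in>reps. B (t \<otimes> g) - B t)"
    by (simp only: sum.distrib sum_distrib_left)
  also have "\<dots> = 0" using A B g by (simp only: harmonic_fun_def mult_zero_right add_0_left)
  finally show "(\<Sum>t\<in>reps. A (t \<otimes> g) + a * B (t \<otimes> g) - (A t + a * B t)) = 0" .
qed

lemma harmonic_fun_exists:
  assumes no: "\<not> (\<exists>\<phi>. \<phi> \<in> epi G integer_group)"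
    and sq: "\<And>i x. i \<in> I \<Longrightarrow> x \<in> carrier G \<Longrightarrow> integrable \<nu> (\<lambda>g. (real_of_int (P i (x \<otimes> g) - P i x))\<^sup>2)"
  shows "\<exists>A. harmonic_fun k A"
proof -
  have "\<exists>A. harmonic_fun (\<lambda>j. if j \<in> J then k j else 0) A" if "finite J" "J \<subseteq> I" for J
    using that
  proof (induction J)
    case empty
    then show ?case using harmonic_fun_0 by auto
  next
    case (insert i J)
    then obtain A where A: "harmonic_fun (\<lambda>j. if j \<in> J then k j else 0) A" by auto
    obtain u where u: "harmonic_fun (\<lambda>j. if i = j then 1 else 0) u"
      using harmonic_coordinate[OF _ no sq, of i] insert.prems unfolding harmonic_fun_def by auto
    have "(\<lambda>j. (if j \<in> J then k j else 0) + k i * (if i = j then 1 else 0)) = (\<lambda>j. if j \<in> insert i J then k j else 0)"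
      using insert.hyps by auto
    then show ?case using harmonic_fun_add_scaled[OF A u, of "k i"] by auto
  qed
  from this[OF finite_I] obtain A where "harmonic_fun (\<lambda>j. if j \<in> I then k j else 0) A" by blast
  then have "harmonic_fun k A" by (simp add: harmonic_fun_def)
  then show ?thesis by blast
qed

text \<open>The cross terms of the quadratic variation average to zero over the classes, which is why
  the limiting variance does not see \<open>\<rho>\<close>.\<close>

lemma lattice_martingale_noise:
  assumes \<rho>: "0 < \<rho>" "\<rho> \<le> 1"
    and A: "harmonic_fun (\<lambda>i. m (False, i)) A" and B: "harmonic_fun (\<lambda>i. m (True, i)) B"
  defines "M \<equiv> \<lambda>(x, y). A x + B y"
  shows "lattice_martingale (G \<times>\<times> G) (UNIV \<times> I) prod_c prod_P prod_rep (noise_pmf \<rho> \<nu>) M m"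
    and "lattice_martingale.Q (G \<times>\<times> G) prod_rep (noise_pmf \<rho> \<nu>) M =
      (\<Sum>(s, t)\<in>reps \<times> reps. \<E> \<nu> (\<lambda>g. (A (s \<otimes> g) - A s)\<^sup>2) + \<E> \<nu> (\<lambda>g. (B (t \<otimes> g) - B t)\<^sup>2))
      / real (card (reps \<times> reps))"
proof -
  interpret p: lattice_walk "G \<times>\<times> G" "UNIV \<times> I" prod_c prod_P prod_rep "noise_pmf \<rho> \<nu>"
    by (rule lattice_walk_noise[OF \<rho>])
  define a where "a = (\<lambda>s g. A (s \<otimes> g) - A s)"
  define b where "b = (\<lambda>t g. B (t \<otimes> g) - B t)"
  note expn = expectation_noise_fst[of \<rho> \<nu>] expectation_noise_snd[of \<rho> \<nu>]
  have inc: "M ((s, t) \<otimes>\<^bsub>G \<times>\<times> G\<^esub> z) - M (s, t) = a s (fst z) + b t (snd z)" for s t z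
    by (cases z) (simp add: M_def a_def b_def)
  have ab: "integrable \<nu> (\<lambda>g. (a s g)\<^sup>2)" "integrable \<nu> (\<lambda>g. (b s g)\<^sup>2)" "integrable \<nu> (a s)" "integrable \<nu> (b s)"
    "\<E> \<nu> (a s) = 0" "\<E> \<nu> (b s) = 0" if "s \<in> carrier G" for s
    unfolding a_def b_def using A B that harmonic_fun_integrable[OF A that] harmonic_fun_integrable[OF B that]
    by (auto simp only: harmonic_fun_def)
  have sq: "integrable (noise_pmf \<rho> \<nu>) (\<lambda>z. (a s (fst z))\<^sup>2)" "integrable (noise_pmf \<rho> \<nu>) (\<lambda>z. (b s (snd z))\<^sup>2)"
    "integrable (noise_pmf \<rho> \<nu>) (\<lambda>z. a s (fst z))" "integrable (noise_pmf \<rho> \<nu>) (\<lambda>z. b s (snd z))" if "s \<in> carrier G" for s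
    using ab(1-4)[OF that] by (simp_all add: expn(2)[of "\<lambda>g. (a s g)\<^sup>2"] expn(4)[of "\<lambda>g. (b s g)\<^sup>2"] expn(2)[of "a s"] expn(4)[of "b s"])
  have cross: "integrable (noise_pmf \<rho> \<nu>) (\<lambda>z. a s (fst z) * b t (snd z))" if "s \<in> carrier G" "t \<in> carrier G" for s t
  proof (rule Bochner_Integration.integrable_bound)
    show "integrable (noise_pmf \<rho> \<nu>) (\<lambda>z. (a s (fst z))\<^sup>2 + (b t (snd z))\<^sup>2)" using sq that by auto
    have "\<bar>y * z\<bar> \<le> y\<^sup>2 + z\<^sup>2" for y z :: real
    proof -
      have "2 * \<bar>y * z\<bar> \<le> y\<^sup>2 + z\<^sup>2" using sum_squares_bound[of "\<bar>y\<bar>" "\<bar>z\<bar>"] by (simp add: abs_mult)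
      then show ?thesis using abs_ge_zero[of "y * z"] by linarith
    qed
    then show "AE z in noise_pmf \<rho> \<nu>. norm (a s (fst z) * b t (snd z)) \<le> norm ((a s (fst z))\<^sup>2 + (b t (snd z))\<^sup>2)" by simp
  qed simp
  have exp0: "\<E> (noise_pmf \<rho> \<nu>) (\<lambda>z. a s (fst z)) = 0"
    "\<E> (noise_pmf \<rho> \<nu>) (\<lambda>z. b s (snd z)) = 0" if "s \<in> carrier G" for s
    using ab(5,6)[OF that] by (simp_all add: expn(1)[of "a s"] expn(3)[of "b s"])
  have sqeq: "(a s (fst z) + b t (snd z))\<^sup>2 = (a s (fst z))\<^sup>2 + (b t (snd z))\<^sup>2 + 2 * (a s (fst z) * b t (snd z))" for s t z
    by (simp add: power2_eq_square algebra_simps)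
  show mart: "lattice_martingale (G \<times>\<times> G) (UNIV \<times> I) prod_c prod_P prod_rep (noise_pmf \<rho> \<nu>) M m"
  proof
    fix i x assume "i \<in> (UNIV :: bool set) \<times> I" "x \<in> carrier (G \<times>\<times> G)"
    then show "M (prod_c i \<otimes>\<^bsub>G \<times>\<times> G\<^esub> x) = M x + m i"
      using A B by (auto simp: M_def prod_c_def harmonic_fun_def DirProd_def split: if_splits)
  next
    fix x assume "x \<in> carrier (G \<times>\<times> G)"
    then obtain s t where x: "x = (s, t)" "s \<in> carrier G" "t \<in> carrier G" by (auto simp: DirProd_def)
    show "integrable (noise_pmf \<rho> \<nu>) (\<lambda>g. (M (x \<otimes>\<^bsub>G \<times>\<times> G\<^esub> g) - M x)\<^sup>2)"
      unfolding x(1) inc sqeq using sq x cross by auto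
    show "\<E> (noise_pmf \<rho> \<nu>) (\<lambda>g. M (x \<otimes>\<^bsub>G \<times>\<times> G\<^esub> g) - M x) = 0"
      unfolding x(1) inc using sq x exp0 by auto
  qed
  interpret q: lattice_martingale "G \<times>\<times> G" "UNIV \<times> I" prod_c prod_P prod_rep "noise_pmf \<rho> \<nu>" M m by (rule mart)
  have V: "q.V (s, t) = \<E> \<nu> (\<lambda>g. (a s g)\<^sup>2) + \<E> \<nu> (\<lambda>g. (b t g)\<^sup>2)
      + 2 * \<E> (noise_pmf \<rho> \<nu>) (\<lambda>z. a s (fst z) * b t (snd z))"
    if "s \<in> carrier G" "t \<in> carrier G" for s t
    unfolding q.V_def inc sqeq using sq that cross
    by (simp add: expn(1)[of "\<lambda>g. (a s g)\<^sup>2"] expn(3)[of "\<lambda>g. (b t g)\<^sup>2"])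
  \<comment> \<open>The sum over cosets is taken inside the expectation. For a fixed step the double
    sum is a product, and its first factor vanishes however the two components of the step are
    correlated.\<close>
  have "(\<Sum>(s, t)\<in>reps \<times> reps. \<E> (noise_pmf \<rho> \<nu>) (\<lambda>z. a s (fst z) * b t (snd z))) =
    \<E> (noise_pmf \<rho> \<nu>) (\<lambda>z. \<Sum>(s, t)\<in>reps \<times> reps. a s (fst z) * b t (snd z))"
    unfolding split_def using cross reps_carrier by (intro Bochner_Integration.integral_sum[symmetric]) auto
  also have "\<dots> = \<E> (noise_pmf \<rho> \<nu>) (\<lambda>z. 0)"
  proof (intro integral_cong_AE)
    show "AE z in noise_pmf \<rho> \<nu>. (\<Sum>(s, t)\<in>reps \<times> reps. a s (fst z) * b t (snd z)) = 0"
      unfolding AE_measure_pmf_iff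
    proof
      fix z assume "z \<in> set_pmf (noise_pmf \<rho> \<nu>)"
      then have "z \<in> carrier G \<times> carrier G" using set_noise_pmf_subset[of \<rho> \<nu>] supp by blast
      then have "fst z \<in> carrier G" by auto
      then have "(\<Sum>s\<in>reps. a s (fst z)) = 0" using A by (simp add: harmonic_fun_def a_def)
      then show "(\<Sum>(s, t)\<in>reps \<times> reps. a s (fst z) * b t (snd z)) = 0"
        by (simp add: sum_product[symmetric] sum.cartesian_product[symmetric])
    qed
  qed auto
  finally have c0: "(\<Sum>(s, t)\<in>reps \<times> reps. \<E> (noise_pmf \<rho> \<nu>) (\<lambda>z. a s (fst z) * b t (snd z))) = 0" by simp
  have "(\<Sum>z\<in>reps \<times> reps. q.V z) = (\<Sum>(s, t)\<in>reps \<times> reps. \<E> \<nu> (\<lambda>g. (a s g)\<^sup>2) + \<E> \<nu> (\<lambda>g. (b t g)\<^sup>2)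
      + 2 * \<E> (noise_pmf \<rho> \<nu>) (\<lambda>z. a s (fst z) * b t (snd z)))"
    using V reps_carrier by (intro sum.cong refl) auto
  also have "\<dots> = (\<Sum>(s, t)\<in>reps \<times> reps. \<E> \<nu> (\<lambda>g. (a s g)\<^sup>2) + \<E> \<nu> (\<lambda>g. (b t g)\<^sup>2))
      + 2 * (\<Sum>(s, t)\<in>reps \<times> reps. \<E> (noise_pmf \<rho> \<nu>) (\<lambda>z. a s (fst z) * b t (snd z)))"
    by (simp add: split_def sum.distrib sum_distrib_left)
  finally have "(\<Sum>z\<in>reps \<times> reps. q.V z) = (\<Sum>(s, t)\<in>reps \<times> reps. \<E> \<nu> (\<lambda>g. (a s g)\<^sup>2) + \<E> \<nu> (\<lambda>g. (b t g)\<^sup>2))"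
    unfolding c0 by simp
  then show "lattice_martingale.Q (G \<times>\<times> G) prod_rep (noise_pmf \<rho> \<nu>) M =
      (\<Sum>(s, t)\<in>reps \<times> reps. \<E> \<nu> (\<lambda>g. (A (s \<otimes> g) - A s)\<^sup>2) + \<E> \<nu> (\<lambda>g. (B (t \<otimes> g) - B t)\<^sup>2))
      / real (card (reps \<times> reps))"
    unfolding q.Q_def reps_prod a_def b_def by simp
qed

text \<open>The harmonic functions are built from \<open>\<nu>\<close> and do not involve the noise
  parameter, so the same \<open>M\<close> serves the values \<open>\<rho>\<close> and 1.\<close>

lemma noise_sensitive_if_no_epi:
  assumes no: "\<not> (\<exists>\<phi>. \<phi> \<in> epi G integer_group)"
    and sq: "\<And>i x. i \<in> I \<Longrightarrow> x \<in> carrier G \<Longrightarrow> integrable \<nu> (\<lambda>g. (real_of_int (P i (x \<otimes> g) - P i x))\<^sup>2)"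
  shows "noise_sensitive_tv G \<nu>"
  unfolding noise_sensitive_tv_def
proof
  fix \<rho> :: real assume "\<rho> \<in> {0<..1}"
  then have \<rho>: "0 < \<rho>" "\<rho> \<le> 1" by auto
  have one: "0 < (1::real)" "(1::real) \<le> 1" by auto
  interpret p: lattice_group "G \<times>\<times> G" "UNIV \<times> I" prod_c prod_P prod_rep by (rule lattice_group_prod)
  have "(\<lambda>n. tv_dist (convolution_power (G \<times>\<times> G) (noise_pmf \<rho> \<nu>) n) (convolution_power (G \<times>\<times> G) (noise_pmf 1 \<nu>) n)) \<longlonglongrightarrow> 0"
  proof (rule p.walks_tv_tendsto_0[OF lattice_walk_noise[OF \<rho>] lattice_walk_noise[OF one]])
    fix k :: "bool \<times> 'c \<Rightarrow> int"
    obtain A where A: "harmonic_fun (\<lambda>i. real_of_int (k (False, i))) A"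
      using harmonic_fun_exists[OF no sq] by blast
    obtain B where B: "harmonic_fun (\<lambda>i. real_of_int (k (True, i))) B"
      using harmonic_fun_exists[OF no sq] by blast
    show "\<exists>M. lattice_martingale (G \<times>\<times> G) (UNIV \<times> I) prod_c prod_P prod_rep (noise_pmf \<rho> \<nu>) M (\<lambda>i. real_of_int (k i))
      \<and> lattice_martingale (G \<times>\<times> G) (UNIV \<times> I) prod_c prod_P prod_rep (noise_pmf 1 \<nu>) M (\<lambda>i. real_of_int (k i))
      \<and> lattice_martingale.Q (G \<times>\<times> G) prod_rep (noise_pmf \<rho> \<nu>) M = lattice_martingale.Q (G \<times>\<times> G) prod_rep (noise_pmf 1 \<nu>) M"
      using lattice_martingale_noise[where m = "\<lambda>i. real_of_int (k i)", OF \<rho> A B]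
        lattice_martingale_noise[where m = "\<lambda>i. real_of_int (k i)", OF one A B]
      by (intro exI[of _ "\<lambda>(x, y). A x + B y"]) simp
  qed
  then show "(\<lambda>n. tv_dist (convolution_power (G \<times>\<times> G) (noise_pmf \<rho> \<nu>) n)
      (pair_pmf (convolution_power G \<nu> n) (convolution_power G \<nu> n))) \<longlonglongrightarrow> 0"
    by (simp add: convolution_power_noise_1)
qed

end

subsection \<open>Epimorphisms onto the integers\<close>

text \<open>The left side is at most the l1 distance, which splits over the Hahn set
  \<open>A\<close> and its complement; each half is at most the total variation distance.\<close>

lemma norm_expectation_diff_le_tv_dist:
  fixes f :: "'a \<Rightarrow> complex"
  assumes f: "\<And>x. norm (f x) \<le> 1"
  shows "norm (\<E> p f - \<E> q f) \<le> 2 * tv_dist p q"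
proof -
  let ?C = "count_space (UNIV :: 'a set)"
  have density: "integral\<^sup>L (measure_pmf r) g = integral\<^sup>L ?C (\<lambda>x. pmf r x *\<^sub>R g x)"
    and idensity: "integrable (measure_pmf r) g \<longleftrightarrow> integrable ?C (\<lambda>x. pmf r x *\<^sub>R g x)"
    for r and g :: "'a \<Rightarrow> 'z::{banach, second_countable_topology}"
    unfolding measure_pmf_eq_density by (simp_all add: integral_density integrable_density)
  have if': "integrable ?C (\<lambda>x. pmf r x *\<^sub>R f x)" for r
    using idensity[of r f] integrable_pmf_bounded[of r f 1] f by simp
  have ip: "integrable ?C (\<lambda>x. pmf r x * indicator A x)" for r and A :: "'a set"
    using idensity[of r "indicator A :: 'a \<Rightarrow> real"] integrable_pmf_bounded[of r "indicator A :: 'a \<Rightarrow> real" 1]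
    by (auto simp: indicator_def)
  have prob: "measure_pmf.prob r A = integral\<^sup>L ?C (\<lambda>x. pmf r x * indicator A x)" for r A
    using density[of r "indicator A :: 'a \<Rightarrow> real"] by simp
  define A where "A = {x. pmf p x \<ge> pmf q x}"
  have abs: "\<bar>pmf p x - pmf q x\<bar> = (pmf p x * indicator A x - pmf q x * indicator A x) + (pmf q x * indicator (-A) x - pmf p x * indicator (-A) x)" for x
    by (auto simp: A_def indicator_def)
  have "norm (\<E> p f - \<E> q f) = norm (integral\<^sup>L ?C (\<lambda>x. (pmf p x - pmf q x) *\<^sub>R f x))"
    unfolding density using if' by (simp add: scaleR_diff_left)
  also have "\<dots> \<le> integral\<^sup>L ?C (\<lambda>x. norm ((pmf p x - pmf q x) *\<^sub>R f x))" by (rule integral_norm_bound)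
  also have "\<dots> \<le> integral\<^sup>L ?C (\<lambda>x. \<bar>pmf p x - pmf q x\<bar>)"
  proof (rule integral_mono)
    show "integrable ?C (\<lambda>x. norm ((pmf p x - pmf q x) *\<^sub>R f x))"
      using if' by (intro integrable_norm) (simp add: scaleR_diff_left)
    show "integrable ?C (\<lambda>x. \<bar>pmf p x - pmf q x\<bar>)" unfolding abs using ip by simp
    show "norm ((pmf p x - pmf q x) *\<^sub>R f x) \<le> \<bar>pmf p x - pmf q x\<bar>" for x
      using mult_left_mono[OF f[of x], of "\<bar>pmf p x - pmf q x\<bar>"] by simp
  qed
  also have "\<dots> = (measure_pmf.prob p A - measure_pmf.prob q A) + (measure_pmf.prob q (-A) - measure_pmf.prob p (-A))"
    unfolding abs prob using ip by simp
  also have "\<dots> \<le> tv_dist p q + tv_dist p q"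
    using prob_diff_le_tv_dist[of p A q] prob_diff_le_tv_dist[of p "-A" q] by (intro add_mono) (auto simp: abs_le_iff)
  finally show ?thesis by simp
qed

lemma (in group) expectation_character_convolution_power:
  assumes "set_pmf \<mu> \<subseteq> carrier G" and \<zeta>: "\<And>x y. x \<in> carrier G \<Longrightarrow> y \<in> carrier G \<Longrightarrow> \<zeta> (x \<otimes> y) = \<zeta> x * (\<zeta> y :: complex)"
    and one: "\<zeta> \<one> = 1" and norm: "\<And>x. norm (\<zeta> x) \<le> 1"
  shows "\<E> (convolution_power G \<mu> n) \<zeta> = \<E> \<mu> \<zeta> ^ n"
proof (induction n)
  case (Suc n)
  have car: "x \<in> carrier G" if "x \<in> set_pmf (convolution_power G \<mu> n)" for x
    using convolution_power_carrier[OF assms(1)] that by blast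
  have "\<E> (convolution_power G \<mu> (Suc n)) \<zeta> =
      \<E> (convolution_power G \<mu> n) (\<lambda>x. \<E> \<mu> (\<lambda>y. \<zeta> (x \<otimes> y)))"
    using norm by (simp add: expectation_convolution_pmf[where B = 1])
  also have "\<dots> = \<E> (convolution_power G \<mu> n) (\<lambda>x. \<zeta> x * \<E> \<mu> \<zeta>)"
  proof (intro integral_cong_AE)
    show "AE x in convolution_power G \<mu> n. \<E> \<mu> (\<lambda>y. \<zeta> (x \<otimes> y)) = \<zeta> x * \<E> \<mu> \<zeta>"
      unfolding AE_measure_pmf_iff
    proof
      fix x assume "x \<in> set_pmf (convolution_power G \<mu> n)"
      then have "\<E> \<mu> (\<lambda>y. \<zeta> (x \<otimes> y)) = \<E> \<mu> (\<lambda>y. \<zeta> x * \<zeta> y)"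
        using car assms(1) \<zeta> by (intro integral_cong_AE) (auto simp: AE_measure_pmf_iff subset_iff)
      then show "\<E> \<mu> (\<lambda>y. \<zeta> (x \<otimes> y)) = \<zeta> x * \<E> \<mu> \<zeta>" by simp
    qed
  qed auto
  finally show ?case using Suc by simp
qed (simp add: one)

text \<open>An independent step contributes the squared modulus of the characteristic function; on
  the diagonal the two phases cancel and the contribution is 1.\<close>

lemma expectation_noise_character:
  fixes \<phi> :: "'a \<Rightarrow> int" and t :: real
  assumes "0 \<le> \<rho>" "\<rho> \<le> 1"
  shows "\<E> (noise_pmf \<rho> \<mu>) (\<lambda>(x, y). iexp (t * (\<phi> x - \<phi> y))) =
    of_real (1 - \<rho> * (1 - (norm (\<E> \<mu> (\<lambda>x. iexp (t * \<phi> x))))\<^sup>2))"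
proof -
  define \<psi> where "\<psi> = \<E> \<mu> (\<lambda>x. iexp (t * \<phi> x))"
  define f where "f = (\<lambda>(x, y). iexp (t * (\<phi> x - \<phi> y)))"
  have f1: "norm (f z) \<le> 1" for z by (cases z) (simp add: f_def)
  have i: "integrable \<mu> (\<lambda>x. iexp (t * \<phi> x))" by (rule integrable_pmf_bounded[where B = 1]) auto
  have "\<E> (pair_pmf \<mu> \<mu>) f = \<E> \<mu> (\<lambda>x. \<E> \<mu> (\<lambda>y. f (x, y)))"
    unfolding pair_pmf_def using f1 by (simp add: expectation_bind_pmf[where B = 1])
  also have "\<dots> = \<E> \<mu> (\<lambda>x. iexp (t * \<phi> x) * cnj \<psi>)"
  proof (intro Bochner_Integration.integral_cong refl)
    fix x
    have "\<E> \<mu> (\<lambda>y. f (x, y)) = \<E> \<mu> (\<lambda>y. iexp (t * \<phi> x) * cnj (iexp (t * \<phi> y)))"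
      by (intro Bochner_Integration.integral_cong refl) (simp add: f_def exp_cnj algebra_simps flip: exp_add)
    also have "\<dots> = iexp (t * \<phi> x) * cnj \<psi>" unfolding \<psi>_def by simp
    finally show "\<E> \<mu> (\<lambda>y. f (x, y)) = iexp (t * \<phi> x) * cnj \<psi>" .
  qed
  also have "\<dots> = \<psi> * cnj \<psi>" unfolding \<psi>_def by simp
  also have "\<dots> = of_real ((norm \<psi>)\<^sup>2)" by (simp only: complex_norm_square)
  finally have pair: "\<E> (pair_pmf \<mu> \<mu>) f = of_real ((norm \<psi>)\<^sup>2)" .
  have diag: "\<E> (diag_pmf \<mu>) f = 1" by (simp add: diag_pmf_def f_def)
  have "\<E> (noise_pmf \<rho> \<mu>) f =
    \<E> (bernoulli_pmf \<rho>) (\<lambda>b. \<E> (if b then pair_pmf \<mu> \<mu> else diag_pmf \<mu>) f)"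
    unfolding noise_pmf_def using f1 by (intro expectation_bind_pmf[where B = 1])
  also have "\<dots> = \<E> (bernoulli_pmf \<rho>) (\<lambda>b. if b then of_real ((norm \<psi>)\<^sup>2) else 1)"
    by (intro Bochner_Integration.integral_cong refl) (simp add: pair diag)
  also have "\<dots> = of_real (1 - \<rho> * (1 - (norm \<psi>)\<^sup>2))"
    using assms by (subst integral_measure_pmf[of UNIV]) (auto simp: UNIV_bool scaleR_conv_of_real algebra_simps)
  finally show ?thesis by (simp add: f_def \<psi>_def)
qed

lemma continuous_char_pmf:
  "continuous_on UNIV (\<lambda>t. \<E> \<mu> (\<lambda>x. iexp (t * real_of_int (\<phi> x))))"
proof -
  have eq: "char (distr (measure_pmf \<mu>) borel (\<lambda>x. real_of_int (\<phi> x))) t = \<E> \<mu> (\<lambda>x. iexp (t * real_of_int (\<phi> x)))" for t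
    unfolding char_def by (subst integral_distr) auto
  interpret real_distribution "distr (measure_pmf \<mu>) borel (\<lambda>x. real_of_int (\<phi> x))"
    by (rule prob_space.real_distribution_distr[OF measure_pmf.prob_space_axioms]) simp
  show ?thesis unfolding eq[symmetric] by (intro continuous_at_imp_continuous_on ballI isCont_char)
qed

text \<open>It rules out that an epimorphism is constant on the support: the identity would have
  value \<open>n * c\<close> with \<open>n \<ge> 1\<close>, which forces \<open>c = 0\<close> and
  hence the zero homomorphism.\<close>

lemma (in group) semigroup_generate_hom_constant:
  assumes \<phi>: "\<phi> \<in> hom G integer_group" and S: "S \<subseteq> carrier G" and c: "\<And>s. s \<in> S \<Longrightarrow> \<phi> s = c"
    and x: "x \<in> semigroup_generate G S"
  shows "x \<in> carrier G \<and> (\<exists>n::nat. n \<ge> 1 \<and> \<phi> x = int n * c)"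
  using x
proof induction
  case (incl s)
  then show ?case using S c by (auto intro!: exI[of _ 1])
next
  case (mult x y)
  then obtain n k where "n \<ge> 1" "\<phi> x = int n * c" "k \<ge> (1::nat)" "\<phi> y = int k * c" by blast
  then have "\<phi> (x \<otimes> y) = int (n + k) * c" using mult hom_mult[OF \<phi>, of x y] by (simp add: algebra_simps)
  then show ?case using mult \<open>n \<ge> 1\<close> by (auto intro!: exI[of _ "n + k"])
qed

lemma (in group) not_noise_sensitive_if_epi:
  assumes supp: "set_pmf \<mu> \<subseteq> carrier G" and gen: "semigroup_generate G (set_pmf \<mu>) = carrier G"
    and epi: "\<phi> \<in> epi G integer_group"
  shows "\<not> noise_sensitive_tv G \<mu>"
proof
  assume ns: "noise_sensitive_tv G \<mu>"
  have hom: "\<phi> \<in> hom G integer_group" and surj: "\<phi> ` carrier G = UNIV" using epi by (auto simp: epi_def)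
  have mult: "\<phi> (x \<otimes> y) = \<phi> x + \<phi> y" if "x \<in> carrier G" "y \<in> carrier G" for x y
    using hom_mult[OF hom that] by simp
  have \<phi>1: "\<phi> \<one> = 0" using mult[of \<one> \<one>] by simp
  have "\<exists>x\<in>set_pmf \<mu>. \<exists>y\<in>set_pmf \<mu>. \<phi> x \<noteq> \<phi> y"
  proof (rule ccontr)
    assume neg: "\<not> ?thesis"
    obtain s where "s \<in> set_pmf \<mu>" using set_pmf_not_empty[of \<mu>] by auto
    then have const: "\<phi> x = \<phi> s" if "x \<in> set_pmf \<mu>" for x using neg that by metis
    have *: "\<exists>n::nat. n \<ge> 1 \<and> \<phi> x = int n * \<phi> s" if "x \<in> carrier G" for x
      using semigroup_generate_hom_constant[OF hom supp const] that gen by auto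
    have "\<phi> s = 0" using *[OF one_closed] \<phi>1 by auto
    then have "\<phi> x = 0" if "x \<in> carrier G" for x using *[OF that] by auto
    then show False using surj by (metis UNIV_I image_iff zero_neq_one)
  qed
  then obtain x y where xy: "x \<in> set_pmf \<mu>" "y \<in> set_pmf \<mu>" "\<phi> x \<noteq> \<phi> y" by blast
  then have xny: "x \<noteq> y" by blast
  define \<psi> where "\<psi> = (\<lambda>t. \<E> \<mu> (\<lambda>x. iexp (t * real_of_int (\<phi> x))))"
  define f where "f = (\<lambda>t. (norm (\<psi> t))\<^sup>2)"
  have contf: "continuous_on UNIV f" unfolding f_def \<psi>_def by (intro continuous_intros continuous_char_pmf)
  have f0: "f 0 = 1" by (simp add: f_def \<psi>_def)
  \<comment> \<open>At \<open>t1\<close> the phases of \<open>x\<close> and \<open>y\<close> are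
    opposite, so these two points cancel and the characteristic function has modulus below
    1.\<close>
  define t1 where "t1 = pi / real_of_int (\<phi> x - \<phi> y)"
  have f1: "f t1 < 1"
  proof -
    define a where "a = min (pmf \<mu> x) (pmf \<mu> y)"
    have a: "a > 0" using xy by (simp add: a_def pmf_positive_iff)
    have "norm (\<psi> t1) \<le> a * norm (\<Sum>h\<in>{x, y}. iexp (t1 * real_of_int (\<phi> h))) + (1 - a * card {x, y}) * 1"
      unfolding \<psi>_def using a by (intro norm_expectation_minorized_le) (auto simp: a_def)
    also have "(\<Sum>h\<in>{x, y}. iexp (t1 * real_of_int (\<phi> h))) = 0"
    proof -
      have "t1 * real_of_int (\<phi> x) = t1 * real_of_int (\<phi> y) + pi"
        using xy(3) by (simp add: t1_def field_simps)
      then have "iexp (t1 * real_of_int (\<phi> x)) = iexp (t1 * real_of_int (\<phi> y)) * iexp pi"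
        by (simp only: of_real_add distrib_left exp_add)
      then show ?thesis using xny by simp
    qed
    also have "card {x, y} = 2" using xny by simp
    finally have "norm (\<psi> t1) < 1" using a by simp
    then show ?thesis unfolding f_def by (simp add: power_less_one_iff abs_square_less_1)
  qed
  have iv: "{f t1..1} \<subseteq> range f"
    using connected_contains_Icc[OF connected_continuous_image[OF contf connected_UNIV], of "f t1" "f 0"] f0 by auto
  \<comment> \<open>From \<open>N\<close> on, \<open>1 - 1 / n\<close> lies between
    \<open>f t1\<close> and 1, where the intermediate value theorem finds a suitable
    \<open>t\<close>.\<close>
  obtain N :: nat where N: "real N > 1 / (1 - f t1)" using reals_Archimedean2 by blast
  have "\<exists>t. f t = 1 - 1 / real n" if n: "n \<ge> N" for n
  proof -
    have "1 / (1 - f t1) < real n" using N n by linarith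
    moreover have "0 < 1 / (1 - f t1)" using f1 by simp
    ultimately have n0: "0 < real n" and "1 < real n * (1 - f t1)" using f1 by (linarith, simp add: pos_divide_less_eq)
    then have "1 / real n < 1 - f t1" by (simp add: pos_divide_less_eq mult.commute)
    then have "1 - 1 / real n \<in> {f t1..1}" using n0 by simp
    then show ?thesis using iv by force
  qed
  then obtain t where t: "\<And>n. n \<ge> N \<Longrightarrow> f (t n) = 1 - 1 / real n" by metis
  interpret GG: group "G \<times>\<times> G" by (rule DirProd_group) (rule is_group)+
  have power: "\<E> (convolution_power (G \<times>\<times> G) (noise_pmf \<rho> \<mu>) n) (\<lambda>(x, y). iexp (t n * (\<phi> x - \<phi> y))) =
      of_real ((1 - \<rho> / real n) ^ n)" if \<rho>: "0 \<le> \<rho>" "\<rho> \<le> 1" and n: "n \<ge> N" for \<rho> n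
  proof -
    have "\<E> (convolution_power (G \<times>\<times> G) (noise_pmf \<rho> \<mu>) n) (\<lambda>(x, y). iexp (t n * (\<phi> x - \<phi> y))) =
       \<E> (noise_pmf \<rho> \<mu>) (\<lambda>(x, y). iexp (t n * (\<phi> x - \<phi> y))) ^ n"
    proof (rule GG.expectation_character_convolution_power)
      show "set_pmf (noise_pmf \<rho> \<mu>) \<subseteq> carrier (G \<times>\<times> G)"
        using set_noise_pmf_subset[of \<rho> \<mu>] supp by (auto simp: DirProd_def)
      show "(\<lambda>(x, y). iexp (t n * (\<phi> x - \<phi> y))) (z \<otimes>\<^bsub>G \<times>\<times> G\<^esub> w) =
          (\<lambda>(x, y). iexp (t n * (\<phi> x - \<phi> y))) z * (\<lambda>(x, y). iexp (t n * (\<phi> x - \<phi> y))) w"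
        if "z \<in> carrier (G \<times>\<times> G)" "w \<in> carrier (G \<times>\<times> G)" for z w
        using that by (auto simp: DirProd_def mult algebra_simps simp flip: exp_add)
    qed (auto simp: \<phi>1)
    also have "\<dots> = of_real (1 - \<rho> * (1 - f (t n))) ^ n"
      unfolding expectation_noise_character[OF \<rho>] by (simp add: f_def \<psi>_def)
    also have "\<dots> = of_real ((1 - \<rho> / real n) ^ n)" using t[OF n] by simp
    finally show ?thesis .
  qed
  \<comment> \<open>The values \<open>1/2\<close> and 1 of \<open>\<rho>\<close> are compared, the
    latter giving the product measure. The expectations of the same character then tend to
    \<open>exp (-1/2)\<close> and \<open>exp (-1)\<close>.\<close>
  define d where "d = (\<lambda>n. tv_dist (convolution_power (G \<times>\<times> G) (noise_pmf (1/2) \<mu>) n) (pair_pmf (convolution_power G \<mu> n) (convolution_power G \<mu> n)))"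
  have "d \<longlonglongrightarrow> 0" using ns by (simp add: noise_sensitive_tv_def d_def)
  then have "(\<lambda>n. 2 * d n) \<longlonglongrightarrow> 2 * 0" by (rule tendsto_mult_left)
  moreover have bound: "\<bar>(1 + (-1/2) / real n) ^ n - (1 + (-1) / real n) ^ n\<bar> \<le> 2 * d n" if n: "n \<ge> N" for n
  proof -
    let ?h = "\<lambda>(x, y). iexp (t n * (\<phi> x - \<phi> y))"
    have "norm (\<E> (convolution_power (G \<times>\<times> G) (noise_pmf (1/2) \<mu>) n) ?h
        - \<E> (convolution_power (G \<times>\<times> G) (noise_pmf 1 \<mu>) n) ?h) \<le> 2 * d n"
      unfolding d_def convolution_power_noise_1[symmetric] by (rule norm_expectation_diff_le_tv_dist) (auto simp: split_def)
    then have "norm (complex_of_real ((1 - (1/2) / real n) ^ n) - of_real ((1 - 1 / real n) ^ n)) \<le> 2 * d n"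
      using power[OF _ _ n, of "1/2"] power[OF _ _ n, of 1] by simp
    then have "norm (complex_of_real ((1 - (1/2) / real n) ^ n - (1 - 1 / real n) ^ n)) \<le> 2 * d n"
      by (simp only: of_real_diff)
    then show ?thesis unfolding norm_of_real by simp
  qed
  moreover have "(\<lambda>n. \<bar>(1 + (-1/2) / real n) ^ n - (1 + (-1) / real n) ^ n\<bar>) \<longlonglongrightarrow> \<bar>exp (-1/2) - exp (-1)\<bar>"
    by (intro tendsto_intros tendsto_exp_limit_sequentially)
  ultimately have "\<bar>exp (-1/2) - exp (-1 :: real)\<bar> \<le> 2 * 0"
    by (intro LIMSEQ_le[of _ _ "\<lambda>n. 2 * d n"]) auto
  then show False by simp
qed

theorem theorem1p1:
  fixes \<Gamma> :: "('a, 'b) monoid_scheme" and \<mu> :: "'a pmf"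
  assumes "group \<Gamma>"
    and "finitely_generated \<Gamma>"
    and "virtually_abelian \<Gamma>"
    and "set_pmf \<mu> \<subseteq> carrier \<Gamma>"
    and "aperiodic_pmf \<Gamma> \<mu>"
    and "finite_second_moment \<Gamma> \<mu>"
    and "semigroup_generate \<Gamma> (set_pmf \<mu>) = carrier \<Gamma>"
  shows "noise_sensitive_tv \<Gamma> \<mu> \<longleftrightarrow> \<not> (\<exists>\<phi>. \<phi> \<in> epi \<Gamma> integer_group)"
proof -
  interpret group \<Gamma> by fact
  obtain n :: nat and b P rep where "lattice_group \<Gamma> {..<n} b P rep"
    using virtually_abelian_lattice_group[OF assms(2,3)] by blast
  then interpret lattice_group \<Gamma> "{..<n}" b P rep .
  interpret lattice_walk \<Gamma> "{..<n}" b P rep \<mu>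
    by unfold_locales (use assms(4) aperiodic_generating_eventually_pos[OF assms(4,5,7)] in auto)
  show ?thesis
    using noise_sensitive_if_no_epi coordinate_second_moment[OF _ assms(6,4)]
      not_noise_sensitive_if_epi[OF assms(4,7)] by blast
qed

end
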